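(* Let $M$ be a compact, connected, oriented, irreducible smooth 3-manifold with boundary $\partial M=\bigsqcup_{h=1}^k B_h$, $k\ge 0$, each $B_h\cong T^2$ a torus. Let $T=\bigsqcup_{i=1}^m T_i\subseteq M$ be a JSJ decomposition of $M$ with JSJ components $M_1,\dots,M_n$, and let $G$ be the associated decorated graph. Then there are exact sequences \[ 1\to \mathrm{Diff}^+(M,(B_h),(T_i),(M_j))\to \mathrm{Diff}^+(M,T)\to \mathrm{Aut}(G), \] \[ 1\to \pi_0\mathrm{Diff}^+(M,(B_h),(T_i),(M_j))\to \pi_0\mathrm{Diff}^+(M,T)\to \mathrm{Aut}(G). \]
   Context: A 3-manifold is irreducible if every embedded 2-sphere bounds a 3-ball. It is atoroidal if every incompressible torus is boundary parallel. A compact orientable 3-manifold with (possibly empty) toroidal boundary is Seifert fibred if it decomposes into disjoint circles, each interior circle having a saturated neighbourhood equivalent to a standard fibred solid torus (the mapping torus of a rotation of $D^2$ by angle $2\pi b/a$ with $\gcd(a,b)=1$, decomposed into the circles formed by its flow lines), and each boundary circle having a trivially fibred half-disc times circle neighbourhood. A JSJ decomposition of $M$ is a minimal submanifold $T=\bigsqcup_{i=1}^m T_i\subseteq M$ ($m\ge 0$) such that each $T_i$ is an incompressible torus and each component of $M$ cut along $T$ is Seifert fibred or atoroidal. The components $M_1,\dots,M_n$ of $M$ cut along $T$ are the JSJ components. $\mathrm{Diff}^+(M)$ is the topological group of orientation-preserving diffeomorphisms of $M$ ($C^\infty$ topology); $\mathrm{Diff}^+(M,T)=\{f\in\mathrm{Diff}^+(M)\mid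 f(T)=T\}$; and $\mathrm{Diff}^+(M,(B_h),(T_i),(M_j))=\{f\in\mathrm{Diff}^+(M,T)\mid f(B_h)=B_h,\ f(T_i)=T_i,\ f(M_j)=M_j \text{ for all } h,i,j\}$. $G=(V,E,\alpha)$ is the undirected, not necessarily simple, vertex-decorated graph with $V=\{M_j\mid 1\le j\le n\}\cup\{*\}$ and $E=\{B_h\mid 1\le h\le k\}\cup\{T_i\mid 1\le i\le m\}$. The decoration is $\alpha(M_j)=$ the diffeomorphism class of $M_j$, and $\alpha( * )=\emptyset$. The edge $B_h$ connects $*$ to $M_j$ if $B_h$ is a boundary component of $M_j$; the edge $T_i$ connects the vertices corresponding to the components on its two sides (which may be equal, giving a loop). $\mathrm{Aut}(G)$ is the group of pairs of permutations of $V$ and $E$ preserving incidence and decoration. The first maps are induced by inclusion; the maps to $\mathrm{Aut}(G)$ are given by the permutations of the $B_h$, $T_i$ and $M_j$ induced by a diffeomorphism. *)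

theory Defs
  imports
    "HOL-Analysis.Analysis"
    "HOL-Algebra.Coset"
    "HOL-Combinatorics.Permutations"
begin

section \<open>Smooth maps between subsets of Euclidean spaces\<close>

text \<open>Iterated directional derivative of \<open>f\<close> along the vectors in a list, taken within \<open>S\<close>.
  It is only used for \<open>S\<close> relatively open in a closed half-space, where derivatives within \<open>S\<close>
  are unique.\<close>

primrec iter_deriv ::
  "'e::euclidean_space set \<Rightarrow> 'e list \<Rightarrow> ('e \<Rightarrow> 'f::euclidean_space) \<Rightarrow> 'e \<Rightarrow> 'f" where
  "iter_deriv S [] f = f"
| "iter_deriv S (v # vs) f = (\<lambda>x. frechet_derivative (iter_deriv S vs f) (at x within S) v)"

definition smooth_on_open :: "'e::euclidean_space set \<Rightarrow> ('e \<Rightarrow> 'f::euclidean_space) \<Rightarrow> bool" where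
  "smooth_on_open U f \<longleftrightarrow> open U \<and> (\<forall>vs. iter_deriv U vs f differentiable_on U)"

text \<open>On an arbitrary subset, smooth means locally extendable to a smooth map on an open set.\<close>

definition smooth_on :: "'e::euclidean_space set \<Rightarrow> ('e \<Rightarrow> 'f::euclidean_space) \<Rightarrow> bool" where
  "smooth_on S f \<longleftrightarrow>
     (\<forall>x\<in>S. \<exists>U g. x \<in> U \<and> smooth_on_open U g \<and> (\<forall>y\<in>S \<inter> U. f y = g y))"


section \<open>Smooth manifolds with boundary\<close>

text \<open>The model spaces are the sets \<open>{x. 0 \<le> b \<bullet> x}\<close>: a closed half-space if \<open>b \<noteq> 0\<close>, and the
  whole Euclidean space if \<open>b = 0\<close>. In a chart \<open>(U, \<phi>)\<close> only the values of \<open>\<phi>\<close> on \<open>U\<close> matter.\<close>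

type_synonym ('a, 'e) chart = "'a set \<times> ('a \<Rightarrow> 'e)"

record ('a, 'e) smfd =
  mtop :: "'a topology"
  atlas :: "('a, 'e) chart set"

abbreviation pts :: "('a, 'e) smfd \<Rightarrow> 'a set" where
  "pts M \<equiv> topspace (mtop M)"

definition half_space :: "'e::euclidean_space \<Rightarrow> 'e set" where
  "half_space b = {x. 0 \<le> b \<bullet> x}"

definition topological_chart :: "'a topology \<Rightarrow> ('a, 'e::euclidean_space) chart \<Rightarrow> bool" where
  "topological_chart X = (\<lambda>(U, \<phi>).
     openin X U \<and>
     (\<exists>b. openin (top_of_set (half_space b)) (\<phi> ` U)) \<and>
     homeomorphic_map (subtopology X U) (top_of_set (\<phi> ` U)) \<phi>)"

definition smooth_transition ::
  "('a, 'e::euclidean_space) chart \<Rightarrow> ('a, 'e) chart \<Rightarrow> bool" where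
  "smooth_transition = (\<lambda>(U, \<phi>) (V, \<psi>). smooth_on (\<phi> ` (U \<inter> V)) (\<psi> \<circ> inv_into U \<phi>))"

definition smooth_manifold :: "('a, 'e::euclidean_space) smfd \<Rightarrow> bool" where
  "smooth_manifold M \<longleftrightarrow>
     Hausdorff_space (mtop M) \<and> second_countable (mtop M) \<and>
     (\<forall>c\<in>atlas M. topological_chart (mtop M) c) \<and>
     (\<Union>c\<in>atlas M. fst c) = pts M \<and>
     (\<forall>c\<in>atlas M. \<forall>d\<in>atlas M. smooth_transition c d)"

definition max_atlas :: "('a, 'e::euclidean_space) smfd \<Rightarrow> ('a, 'e) chart set" where
  "max_atlas M = {c. topological_chart (mtop M) c \<and>
     (\<forall>d\<in>atlas M. smooth_transition c d \<and> smooth_transition d c)}"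

definition boundary :: "('a, 'e::euclidean_space) smfd \<Rightarrow> 'a set" where
  "boundary M = {p. \<exists>U \<phi> b. (U, \<phi>) \<in> max_atlas M \<and> p \<in> U \<and> b \<noteq> 0 \<and>
     openin (top_of_set (half_space b)) (\<phi> ` U) \<and> b \<bullet> \<phi> p = 0}"

definition local_rep ::
  "('a \<Rightarrow> 'b) \<Rightarrow> ('a, 'e) chart \<Rightarrow> ('b, 'f) chart \<Rightarrow> 'e \<Rightarrow> 'f" where
  "local_rep f = (\<lambda>(U, \<phi>) (V, \<psi>). \<psi> \<circ> f \<circ> inv_into U \<phi>)"

definition smooth_map ::
  "('a, 'e::euclidean_space) smfd \<Rightarrow> 'a set \<Rightarrow> ('b, 'f::euclidean_space) smfd \<Rightarrow> ('a \<Rightarrow> 'b) \<Rightarrow> bool"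
  where
  "smooth_map M A N f \<longleftrightarrow> A \<subseteq> pts M \<and> f ` A \<subseteq> pts N \<and>
     (\<forall>p\<in>A. \<exists>U \<phi> V \<psi> W. (U, \<phi>) \<in> atlas M \<and> (V, \<psi>) \<in> atlas N \<and>
        openin (mtop M) W \<and> p \<in> W \<and> W \<subseteq> U \<and> f ` (A \<inter> W) \<subseteq> V \<and>
        smooth_on (\<phi> ` (A \<inter> W)) (local_rep f (U, \<phi>) (V, \<psi>)))"

definition diffeo ::
  "('a, 'e::euclidean_space) smfd \<Rightarrow> 'a set \<Rightarrow> ('b, 'f::euclidean_space) smfd \<Rightarrow> 'b set \<Rightarrow>
   ('a \<Rightarrow> 'b) \<Rightarrow> bool" where
  "diffeo M A N B f \<longleftrightarrow>
     bij_betw f A B \<and> smooth_map M A N f \<and> smooth_map N B M (inv_into A f)"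

definition diffeomorphic ::
  "('a, 'e::euclidean_space) smfd \<Rightarrow> ('b, 'f::euclidean_space) smfd \<Rightarrow> bool" where
  "diffeomorphic M N \<longleftrightarrow> (\<exists>f. diffeo M (pts M) N (pts N) f)"

definition euc :: "('e::euclidean_space, 'e) smfd" where
  "euc = \<lparr>mtop = euclidean, atlas = {(UNIV, \<lambda>x. x)}\<rparr>"

text \<open>\<open>embeds M Z S h\<close>: \<open>h\<close> is a smooth embedding of \<open>Z\<close>, a subset of a Euclidean space, into \<open>M\<close>
  with image \<open>S\<close>. Local smooth extendability of the inverse makes \<open>h\<close> an immersion and a
  homeomorphism onto \<open>S\<close>.\<close>

abbreviation embeds ::
  "('a, 'e::euclidean_space) smfd \<Rightarrow> 'z::euclidean_space set \<Rightarrow> 'a set \<Rightarrow> ('z \<Rightarrow> 'a) \<Rightarrow> bool" where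
  "embeds M Z S h \<equiv> diffeo euc Z M S h"

text \<open>Used for open subsets \<open>K\<close>.\<close>

definition restrict_mfd :: "('a, 'e) smfd \<Rightarrow> 'a set \<Rightarrow> ('a, 'e) smfd" where
  "restrict_mfd M K =
     \<lparr>mtop = subtopology (mtop M) K, atlas = (\<lambda>(U, \<phi>). (U \<inter> K, \<phi>)) ` atlas M\<rparr>"

definition components_in :: "('a, 'e) smfd \<Rightarrow> 'a set \<Rightarrow> 'a set set" where
  "components_in M S = connected_components_of (subtopology (mtop M) S)"

definition orientation :: "('a, real^'n) smfd \<Rightarrow> ('a, real^'n) chart set \<Rightarrow> bool" where
  "orientation M Ori \<longleftrightarrow> Ori \<subseteq> max_atlas M \<and> (\<Union>c\<in>Ori. fst c) = pts M \<and>
     (\<forall>(U, \<phi>)\<in>Ori. \<forall>(V, \<psi>)\<in>Ori. \<forall>p\<in>U \<inter> V.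
        det (matrix (frechet_derivative (local_rep (\<lambda>x. x) (U, \<phi>) (V, \<psi>))
               (at (\<phi> p) within \<phi> ` (U \<inter> V)))) > 0)"

definition orientation_preserving ::
  "('a, real^'n) chart set \<Rightarrow> ('a \<Rightarrow> 'a) \<Rightarrow> bool" where
  "orientation_preserving Ori f \<longleftrightarrow>
     (\<forall>(U, \<phi>)\<in>Ori. \<forall>(V, \<psi>)\<in>Ori. \<forall>p\<in>U \<inter> f -` V.
        det (matrix (frechet_derivative (local_rep f (U, \<phi>) (V, \<psi>))
               (at (\<phi> p) within \<phi> ` (U \<inter> f -` V)))) > 0)"


section \<open>Spheres and tori in 3-manifolds\<close>

definition unit_circle :: "complex set" where
  "unit_circle = sphere 0 1"

definition unit_disc :: "complex set" where
  "unit_disc = cball 0 1"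

definition std_torus :: "(complex \<times> complex) set" where
  "std_torus = unit_circle \<times> unit_circle"

definition irreducible_3mfd :: "('a, real^3) smfd \<Rightarrow> bool" where
  "irreducible_3mfd M \<longleftrightarrow>
     (\<forall>S h. embeds M (sphere (0::real^3) 1) S h \<longrightarrow>
        (\<exists>B k. embeds M (cball (0::real^3) 1) B k \<and> k ` sphere 0 1 = S))"

definition is_torus :: "('a, real^3) smfd \<Rightarrow> 'a set \<Rightarrow> bool" where
  "is_torus M S \<longleftrightarrow> (\<exists>h. embeds M std_torus S h)"

definition incompressible_torus :: "('a, real^3) smfd \<Rightarrow> 'a set \<Rightarrow> bool" where
  "incompressible_torus M S \<longleftrightarrow> is_torus M S \<and> S \<inter> boundary M = {} \<and>
     (\<forall>D h. embeds M unit_disc D h \<and> D \<inter> S = h ` unit_circle \<longrightarrow>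
        (\<exists>D' h'. embeds M unit_disc D' h' \<and> D' \<subseteq> S \<and> h' ` unit_circle = h ` unit_circle))"

definition boundary_parallel_torus :: "('a, real^3) smfd \<Rightarrow> 'a set \<Rightarrow> bool" where
  "boundary_parallel_torus M S \<longleftrightarrow>
     (\<exists>W h. embeds M (std_torus \<times> {0..1::real}) W h \<and>
        h ` (std_torus \<times> {0}) = S \<and> h ` (std_torus \<times> {1}) \<in> components_in M (boundary M))"

definition atoroidal :: "('a, real^3) smfd \<Rightarrow> bool" where
  "atoroidal M \<longleftrightarrow> (\<forall>S. incompressible_torus M S \<longrightarrow> boundary_parallel_torus M S)"


section \<open>Seifert fibrations\<close>

text \<open>The mapping torus of the rotation by \<open>2\<pi>b/a\<close> is identified with the product of disc and
  circle by sending the class of \<open>(z, t)\<close> to \<open>(cis (2\<pi>(b/a)t) * z, cis (2\<pi>t))\<close>; this turns the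
  flow lines into the sets below.\<close>

definition solid_torus_fibres :: "int \<Rightarrow> int \<Rightarrow> (complex \<times> complex) set set" where
  "solid_torus_fibres a b =
     (\<lambda>z. range (\<lambda>t::real. (cis (2 * pi * (of_int b / of_int a) * t) * z, cis (2 * pi * t)))) `
       unit_disc"

definition half_disc :: "complex set" where
  "half_disc = {z \<in> unit_disc. 0 \<le> Re z}"

definition half_disc_fibres :: "(complex \<times> complex) set set" where
  "half_disc_fibres = (\<lambda>z. {z} \<times> unit_circle) ` half_disc"

text \<open>\<open>c\<close> has a neighbourhood \<open>W\<close> in \<open>N\<close> with a diffeomorphism from the model \<open>P\<close> that takes the
  fibres of \<open>P\<close> to members of \<open>F\<close>; as these fibres cover \<open>P\<close>, the set \<open>W\<close> is then saturated.\<close>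

definition fibred_nbhd ::
  "('a, real^3) smfd \<Rightarrow> 'a set set \<Rightarrow> 'a set \<Rightarrow>
   (complex \<times> complex) set \<Rightarrow> (complex \<times> complex) set set \<Rightarrow> bool" where
  "fibred_nbhd N F c P L \<longleftrightarrow>
     (\<exists>W h. embeds N P W h \<and> (\<forall>l\<in>L. h ` l \<in> F) \<and>
        (\<exists>O'. openin (mtop N) O' \<and> c \<subseteq> O' \<and> O' \<subseteq> W))"

definition seifert_fibred :: "('a, real^3) smfd \<Rightarrow> bool" where
  "seifert_fibred N \<longleftrightarrow>
     (\<exists>F. \<Union>F = pts N \<and> disjoint F \<and>
        (\<forall>c\<in>F. (\<exists>h. embeds N unit_circle c h) \<and>
          (if c \<inter> boundary N = {}
           then \<exists>a b. a > 0 \<and> coprime a b \<and>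
                  fibred_nbhd N F c (unit_disc \<times> unit_circle) (solid_torus_fibres a b)
           else fibred_nbhd N F c (half_disc \<times> unit_circle) half_disc_fibres)))"


section \<open>Cutting along a surface\<close>

text \<open>A local side of \<open>T\<close> at \<open>p\<close> is a compatible choice, for every open neighbourhood \<open>U\<close> of \<open>p\<close>,
  of a component of \<open>U - T\<close> accumulating at \<open>p\<close>. For a closed surface \<open>T\<close> in the interior of a
  3-manifold, there is one side at points outside \<open>T\<close>, and there are two at points of \<open>T\<close>. The
  value is \<open>{}\<close> at all sets that are not open neighbourhoods of \<open>p\<close>.\<close>

definition local_sides :: "'a topology \<Rightarrow> 'a set \<Rightarrow> 'a \<Rightarrow> ('a set \<Rightarrow> 'a set) set" where
  "local_sides X T p =
     {s. (\<forall>U. if openin X U \<and> p \<in> U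
              then s U \<in> connected_components_of (subtopology X (U - T)) \<and> p \<in> X closure_of s U
              else s U = {}) \<and>
         (\<forall>U V. openin X U \<and> openin X V \<and> p \<in> U \<and> U \<subseteq> V \<longrightarrow> s U \<subseteq> s V)}"

type_synonym 'a cut_point = "'a \<times> ('a set \<Rightarrow> 'a set)"

definition cut_top :: "'a topology \<Rightarrow> 'a set \<Rightarrow> 'a cut_point topology" where
  "cut_top X T = topology_generated_by
     {{(p, s). p \<in> U \<and> s \<in> local_sides X T p \<and> s U = C} | U C. openin X U}"

text \<open>\<open>M\<close> cut along \<open>T\<close>, with regluing map \<open>fst\<close>. The smooth structure is the one for which the
  regluing map is locally a diffeomorphism onto its image: the charts are those of the form
  \<open>\<phi> \<circ> fst\<close> with \<open>\<phi>\<close> a chart of \<open>M\<close>.\<close>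

definition cut :: "('a, 'e::euclidean_space) smfd \<Rightarrow> 'a set \<Rightarrow> ('a cut_point, 'e) smfd" where
  "cut M T = \<lparr>mtop = cut_top (mtop M) T,
     atlas = {(W, \<phi> \<circ> fst) | W U \<phi>. (U, \<phi>) \<in> max_atlas M \<and> fst ` W \<subseteq> U \<and>
                topological_chart (cut_top (mtop M) T) (W, \<phi> \<circ> fst)}\<rparr>"

text \<open>The map induced on \<open>M\<close> cut along \<open>T\<close> by a homeomorphism of \<open>M\<close> preserving \<open>T\<close>.\<close>

definition cut_map :: "('a \<Rightarrow> 'a) \<Rightarrow> 'a cut_point \<Rightarrow> 'a cut_point" where
  "cut_map f = (\<lambda>(p, s). (f p, \<lambda>U. f ` s (f -` U)))"

definition pieces :: "('a, 'e::euclidean_space) smfd \<Rightarrow> 'a set \<Rightarrow> 'a cut_point set set" where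
  "pieces M T = connected_components_of (mtop (cut M T))"

definition piece_mfd ::
  "('a, 'e::euclidean_space) smfd \<Rightarrow> 'a set \<Rightarrow> 'a cut_point set \<Rightarrow> ('a cut_point, 'e) smfd" where
  "piece_mfd M T K = restrict_mfd (cut M T) K"


section \<open>JSJ decompositions\<close>

definition jsj_system :: "('a, real^3) smfd \<Rightarrow> 'a set \<Rightarrow> bool" where
  "jsj_system M T \<longleftrightarrow> T \<subseteq> pts M \<and> finite (components_in M T) \<and>
     (\<forall>S\<in>components_in M T. incompressible_torus M S) \<and>
     (\<forall>K\<in>pieces M T. seifert_fibred (piece_mfd M T K) \<or> atoroidal (piece_mfd M T K))"

definition jsj_decomposition :: "('a, real^3) smfd \<Rightarrow> 'a set \<Rightarrow> bool" where
  "jsj_decomposition M T \<longleftrightarrow>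
     jsj_system M T \<and> (\<forall>T'. jsj_system M T' \<and> T' \<subseteq> T \<longrightarrow> T' = T)"

abbreviation boundary_components :: "('a, 'e::euclidean_space) smfd \<Rightarrow> 'a set set" where
  "boundary_components M \<equiv> components_in M (boundary M)"


section \<open>Decorated graphs and their automorphisms\<close>

record ('v, 'e, 'd) decorated_graph =
  verts :: "'v set"
  edges :: "'e set"
  ends :: "'e \<Rightarrow> 'v set"
  deco :: "'v \<Rightarrow> 'd"

definition Aut ::
  "('v, 'e, 'd) decorated_graph \<Rightarrow> (('v \<Rightarrow> 'v) \<times> ('e \<Rightarrow> 'e)) monoid" where
  "Aut G = \<lparr>carrier = {(\<sigma>, \<tau>). \<sigma> permutes verts G \<and> \<tau> permutes edges G \<and>
               (\<forall>e\<in>edges G. ends G (\<tau> e) = \<sigma> ` ends G e) \<and>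
               (\<forall>v\<in>verts G. deco G (\<sigma> v) = deco G v)},
            mult = (\<lambda>(\<sigma>, \<tau>) (\<sigma>', \<tau>'). (\<sigma> \<circ> \<sigma>', \<tau> \<circ> \<tau>')),
            one = (id, id)\<rparr>"

text \<open>The vertex \<open>*\<close> is \<open>None\<close>. The set of ends of a loop is a singleton. The decoration of a
  piece is the class of all smooth manifolds (with points in a fixed type) diffeomorphic to it.\<close>

definition jsj_graph ::
  "('a, real^3) smfd \<Rightarrow> 'a set \<Rightarrow>
   ('a cut_point set option, 'a set, ('a cut_point, real^3) smfd set) decorated_graph" where
  "jsj_graph M T =
     \<lparr>verts = insert None (Some ` pieces M T),
      edges = boundary_components M \<union> components_in M T,
      ends = (\<lambda>X. Some ` {K \<in> pieces M T. fst ` K \<inter> X \<noteq> {}} \<union>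
                  (if X \<in> boundary_components M then {None} else {})),
      deco = (\<lambda>v. case v of
                None \<Rightarrow> {}
              | Some K \<Rightarrow> {N. smooth_manifold N \<and> diffeomorphic (piece_mfd M T K) N})\<rparr>"


section \<open>Diffeomorphism groups\<close>

text \<open>Diffeomorphisms are extended by the identity outside the manifold.\<close>

definition Diff_set :: "('a, 'e::euclidean_space) smfd \<Rightarrow> ('a \<Rightarrow> 'a) set" where
  "Diff_set M = {f. f permutes pts M \<and> diffeo M (pts M) M (pts M) f}"

text \<open>The subbasic neighbourhoods of \<open>f\<close> in the (weak) Whitney \<open>C\<^sup>\<infinity>\<close> topology: closeness, on a
  compact set \<open>Q\<close> inside a chart domain, of all partial derivatives of order at most \<open>r\<close>.\<close>

definition Cinf_nbhd ::
  "('a, 'e::euclidean_space) smfd \<Rightarrow> ('a \<Rightarrow> 'a) \<Rightarrow> ('a, 'e) chart \<Rightarrow> ('a, 'e) chart \<Rightarrow>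
   'a set \<Rightarrow> nat \<Rightarrow> real \<Rightarrow> ('a \<Rightarrow> 'a) set" where
  "Cinf_nbhd M f = (\<lambda>(U, \<phi>) (V, \<psi>) Q r \<epsilon>.
     {g \<in> Diff_set M. g ` Q \<subseteq> V \<and>
        (\<forall>p\<in>Q. \<forall>vs. set vs \<subseteq> Basis \<and> length vs \<le> r \<longrightarrow>
           norm (iter_deriv (\<phi> ` U) vs (local_rep f (U, \<phi>) (V, \<psi>)) (\<phi> p) -
                 iter_deriv (\<phi> ` U) vs (local_rep g (U, \<phi>) (V, \<psi>)) (\<phi> p)) < \<epsilon>)})"

definition Cinf_top :: "('a, 'e::euclidean_space) smfd \<Rightarrow> ('a \<Rightarrow> 'a) topology" where
  "Cinf_top M = topology_generated_by
     {Cinf_nbhd M f (U, \<phi>) (V, \<psi>) Q r \<epsilon> | f U \<phi> V \<psi> Q r \<epsilon>.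
        f \<in> Diff_set M \<and> (U, \<phi>) \<in> max_atlas M \<and> (V, \<psi>) \<in> max_atlas M \<and>
        compactin (mtop M) Q \<and> Q \<subseteq> U \<and> f ` Q \<subseteq> V \<and> \<epsilon> > 0}"

definition Diff_plus :: "('a, real^3) smfd \<Rightarrow> ('a, real^3) chart set \<Rightarrow> ('a \<Rightarrow> 'a) set" where
  "Diff_plus M Ori = {f \<in> Diff_set M. orientation_preserving Ori f}"

definition Diff_plus_T ::
  "('a, real^3) smfd \<Rightarrow> ('a, real^3) chart set \<Rightarrow> 'a set \<Rightarrow> ('a \<Rightarrow> 'a) set" where
  "Diff_plus_T M Ori T = {f \<in> Diff_plus M Ori. f ` T = T}"

definition Diff_plus_BTM ::
  "('a, real^3) smfd \<Rightarrow> ('a, real^3) chart set \<Rightarrow> 'a set \<Rightarrow> ('a \<Rightarrow> 'a) set" where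
  "Diff_plus_BTM M Ori T = {f \<in> Diff_plus_T M Ori T.
     (\<forall>B\<in>boundary_components M. f ` B = B) \<and>
     (\<forall>S\<in>components_in M T. f ` S = S) \<and>
     (\<forall>K\<in>pieces M T. cut_map f ` K = K)}"

definition comp_group :: "('a \<Rightarrow> 'a) set \<Rightarrow> ('a \<Rightarrow> 'a) monoid" where
  "comp_group D = \<lparr>carrier = D, mult = (\<circ>), one = id\<rparr>"

text \<open>The product of path components in a topological group is the product of sets.\<close>

definition pi0 :: "('g, 'm) monoid_scheme \<Rightarrow> 'g topology \<Rightarrow> 'g set monoid" where
  "pi0 G X = \<lparr>carrier = path_components_of X, mult = (\<lambda>C D. C <#>\<^bsub>G\<^esub> D),
              one = path_component_of_set X \<one>\<^bsub>G\<^esub>\<rparr>"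

definition graph_action ::
  "('a, real^3) smfd \<Rightarrow> 'a set \<Rightarrow> ('a \<Rightarrow> 'a) \<Rightarrow>
   ('a cut_point set option \<Rightarrow> 'a cut_point set option) \<times> ('a set \<Rightarrow> 'a set)" where
  "graph_action M T f =
     (\<lambda>v. case v of
        None \<Rightarrow> None
      | Some K \<Rightarrow> if K \<in> pieces M T then Some (cut_map f ` K) else Some K,
      \<lambda>X. if X \<in> edges (jsj_graph M T) then f ` X else X)"

text \<open>Exactness of \<open>1 \<rightarrow> A \<rightarrow> B \<rightarrow> C\<close>.\<close>

definition left_exact ::
  "('x, 'm) monoid_scheme \<Rightarrow> ('x \<Rightarrow> 'y) \<Rightarrow> ('y, 'n) monoid_scheme \<Rightarrow> ('y \<Rightarrow> 'z) \<Rightarrow>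
   ('z, 'o) monoid_scheme \<Rightarrow> bool" where
  "left_exact A i B p C \<longleftrightarrow> group_hom A B i \<and> group_hom B C p \<and>
     inj_on i (carrier A) \<and> i ` carrier A = kernel B C p"

end

theory Submission
  imports Defs
begin

text \<open>Exactness of the first sequence is formal once its maps are known to exist: the subgroup
  on the left is the kernel of the action on the graph. What has to be shown is that orientation
  preserving diffeomorphisms form a group and that each of them acts by automorphisms of the
  decorated graph. The group property rests on the chain rule: it makes compositions of smooth
  maps smooth and Jacobian determinants multiplicative. The rest is transport of structure. A
  diffeomorphism \<open>f\<close> carries charts of the maximal atlas to charts of the maximal atlas
  (\<open>Diff_set_push_max_atlas\<close>), so it preserves everything defined in terms of charts, in
  particular the boundary; if it preserves \<open>T\<close>, it induces a homeomorphism of the manifold cut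
  along \<open>T\<close> that permutes its charts, hence permutes the pieces without changing their
  diffeomorphism types (\<open>diffeomorphic_piece_iff\<close>).

  For the second sequence, the \<open>C\<^sup>\<infinity>\<close> topology enters through two facts. Translations are
  continuous, because they carry a subbasic neighbourhood to the one given by transported charts;
  hence products of path components are path components, and \<open>\<pi>\<^sub>0\<close> is a group. Evaluation at a
  point is continuous, so an isotopy \<open>f\<^sub>t\<close> moves each point along a path. Points of the boundary
  stay in the boundary and points of \<open>T\<close> stay in \<open>T\<close>, so that \<open>f\<^sub>0\<close> and \<open>f\<^sub>1\<close> permute the
  components of both in the same way. A point outside \<open>T\<close> has a unique local side, whence its
  path outside \<open>T\<close> lifts to the cut-open manifold; as every piece contains such points,
  \<open>f\<^sub>0\<close> and \<open>f\<^sub>1\<close> also permute the pieces in the same way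
  (\<open>graph_action_isotopy_invariant\<close>).

  Thus the action on the graph is constant on path components and descends to \<open>\<pi>\<^sub>0\<close>. Moreover a
  path of diffeomorphisms that starts in the kernel of the action stays in the kernel. So the path
  components of the kernel are path components of the whole group, the map induced by inclusion
  on \<open>\<pi>\<^sub>0\<close> is injective, and its image is the kernel of the induced action
  (\<open>left_exact_pi0\<close>).\<close>


section \<open>Compositions of smooth maps on open sets\<close>

lemma has_derivative_within_cong:
  assumes "\<And>y. y \<in> S \<Longrightarrow> f y = g y" "x \<in> S"
  shows "(f has_derivative D) (at x within S) \<longleftrightarrow> (g has_derivative D) (at x within S)"
  using assms by (metis has_derivative_transform)

lemma frechet_derivative_within_cong:
  assumes "\<And>y. y \<in> S \<Longrightarrow> f y = g y" "x \<in> S"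
  shows "frechet_derivative f (at x within S) = frechet_derivative g (at x within S)"
  unfolding frechet_derivative_def using has_derivative_within_cong[OF assms] by simp

lemma frechet_derivative_within_open_eq:
  assumes "(f has_derivative D) (at x within U)" "open U" "x \<in> U"
  shows "frechet_derivative f (at x within U) = D"
  using assms by (metis at_within_open frechet_derivative_at)

lemma iter_deriv_cong:
  assumes "\<And>y. y \<in> S \<Longrightarrow> f y = g y" "x \<in> S"
  shows "iter_deriv S vs f x = iter_deriv S vs g x"
  using assms(2)
proof (induction vs arbitrary: x)
  case Nil
  then show ?case using assms(1) by simp
next
  case (Cons v vs)
  then show ?case
    using frechet_derivative_within_cong[of S "iter_deriv S vs f" "iter_deriv S vs g" x] by simp
qed

lemma iter_deriv_append:
  "iter_deriv S (vs @ ws) f = iter_deriv S vs (iter_deriv S ws f)"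
  by (induction vs) simp_all

lemma iter_deriv_open_subset:
  assumes "open U" "open V" "V \<subseteq> U" "x \<in> V"
  shows "iter_deriv V vs f x = iter_deriv U vs f x"
  using assms(4)
proof (induction vs arbitrary: x)
  case (Cons v vs)
  have "frechet_derivative (iter_deriv V vs f) (at x within V) =
        frechet_derivative (iter_deriv U vs f) (at x within V)"
    using Cons by (intro frechet_derivative_within_cong) auto
  moreover have "at x within V = at x within U"
    using assms Cons.prems by (metis at_within_open subset_iff)
  ultimately show ?case by simp
qed simp

lemma smooth_on_open_subset:
  assumes "smooth_on_open U f" "open V" "V \<subseteq> U"
  shows "smooth_on_open V f"
  unfolding smooth_on_open_def
proof (intro conjI allI)
  fix vs
  have U: "open U" "iter_deriv U vs f differentiable_on U"
    using assms(1) by (auto simp: smooth_on_open_def)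
  have "iter_deriv U vs f differentiable_on V"
    using U assms(3) differentiable_on_subset by blast
  then show "iter_deriv V vs f differentiable_on V"
    unfolding differentiable_on_def differentiable_def
    using has_derivative_within_cong[of V "iter_deriv V vs f" "iter_deriv U vs f"]
      iter_deriv_open_subset[OF U(1) assms(2,3)] by blast
qed (use assms in auto)

text \<open>For inductive proofs, smoothness is resolved into finite orders of differentiability,
  where the recursion peels off the innermost directional derivative.\<close>

primrec times_differentiable ::
  "nat \<Rightarrow> 'e::euclidean_space set \<Rightarrow> ('e \<Rightarrow> 'f::euclidean_space) \<Rightarrow> bool" where
  "times_differentiable 0 U f \<longleftrightarrow> f differentiable_on U"
| "times_differentiable (Suc k) U f \<longleftrightarrow> f differentiable_on U \<and>
     (\<forall>v. times_differentiable k U (\<lambda>x. frechet_derivative f (at x within U) v))"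

lemma times_differentiable_iff_iter_deriv:
  "times_differentiable k U f \<longleftrightarrow>
     (\<forall>vs. length vs \<le> k \<longrightarrow> iter_deriv U vs f differentiable_on U)"
proof (induction k arbitrary: f)
  case (Suc k)
  have *: "iter_deriv U (vs @ [v]) f = iter_deriv U vs (\<lambda>x. frechet_derivative f (at x within U) v)"
    for vs v by (simp add: iter_deriv_append)
  show ?case
  proof
    assume l: "times_differentiable (Suc k) U f"
    show "\<forall>vs. length vs \<le> Suc k \<longrightarrow> iter_deriv U vs f differentiable_on U"
    proof (intro allI impI)
      fix vs :: "'a list" assume "length vs \<le> Suc k"
      then show "iter_deriv U vs f differentiable_on U"
      proof (cases vs rule: rev_cases)
        case (snoc ws v)
        then show ?thesis
          using l \<open>length vs \<le> Suc k\<close> Suc by (simp add: *)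
      qed (use l in auto)
    qed
  next
    assume r: "\<forall>vs. length vs \<le> Suc k \<longrightarrow> iter_deriv U vs f differentiable_on U"
    have "iter_deriv U [] f differentiable_on U" using r by (metis le0 list.size(3))
    moreover have "iter_deriv U vs (\<lambda>x. frechet_derivative f (at x within U) v) differentiable_on U"
      if "length vs \<le> k" for vs v
      using r that unfolding *[symmetric] by simp
    ultimately show "times_differentiable (Suc k) U f"
      using Suc by simp
  qed
qed simp

lemma smooth_on_open_iff_times_differentiable:
  "smooth_on_open U f \<longleftrightarrow> open U \<and> (\<forall>k. times_differentiable k U f)"
  unfolding smooth_on_open_def times_differentiable_iff_iter_deriv by blast

lemma times_differentiable_imp_differentiable_on:
  "times_differentiable k U f \<Longrightarrow> f differentiable_on U"
  by (cases k) auto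

lemma times_differentiable_mono:
  assumes "times_differentiable k U f" "j \<le> k"
  shows "times_differentiable j U f"
  using assms unfolding times_differentiable_iff_iter_deriv by auto

lemma times_differentiable_cong:
  assumes "\<And>x. x \<in> U \<Longrightarrow> f x = g x"
  shows "times_differentiable k U f \<longleftrightarrow> times_differentiable k U g"
  unfolding times_differentiable_iff_iter_deriv differentiable_on_def differentiable_def
  using has_derivative_within_cong[of U "iter_deriv U _ f" "iter_deriv U _ g"]
    iter_deriv_cong[of U f g, OF assms] by blast

text \<open>On an open set derivatives are unique, so the derivative in the recursion may be given by any
  explicit formula. All closure properties below are instances of this induction step.\<close>

lemma times_differentiable_SucI:
  assumes "open U"
    and der: "\<And>x. x \<in> U \<Longrightarrow> (f has_derivative D x) (at x within U)"
    and rec: "\<And>v. times_differentiable k U (\<lambda>x. D x v)"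
  shows "times_differentiable (Suc k) U f"
proof -
  have "f differentiable_on U"
    using der unfolding differentiable_on_def differentiable_def by blast
  moreover have "times_differentiable k U (\<lambda>x. frechet_derivative f (at x within U) v)" for v
    using rec[of v] frechet_derivative_within_open_eq[OF der assms(1)]
    by (subst times_differentiable_cong) auto
  ultimately show ?thesis by simp
qed

lemma times_differentiable_has_derivative:
  assumes "times_differentiable k U f" "x \<in> U"
  shows "(f has_derivative frechet_derivative f (at x within U)) (at x within U)"
  using times_differentiable_imp_differentiable_on[OF assms(1)] assms(2)
  by (simp add: differentiable_on_def frechet_derivative_works)

lemma times_differentiable_add:
  assumes "open U" "times_differentiable k U f" "times_differentiable k U g"
  shows "times_differentiable k U (\<lambda>x. f x + g x)"
  using assms(2,3)
proof (induction k arbitrary: f g)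
  case 0
  then show ?case by (simp add: differentiable_on_add)
next
  case (Suc k)
  show ?case
  proof (rule times_differentiable_SucI[OF assms(1)])
    fix x assume "x \<in> U"
    then show "((\<lambda>x. f x + g x) has_derivative
        (\<lambda>v. frechet_derivative f (at x within U) v + frechet_derivative g (at x within U) v))
        (at x within U)"
      using Suc.prems by (intro has_derivative_add times_differentiable_has_derivative)
  qed (use Suc in auto)
qed

lemma times_differentiable_const:
  assumes "open U"
  shows "times_differentiable k U (\<lambda>x. c)"
proof (induction k arbitrary: c)
  case (Suc k)
  show ?case
    by (rule times_differentiable_SucI[OF assms, where D = "\<lambda>x v. 0"]) (auto intro: Suc)
qed auto

lemma times_differentiable_sum:
  assumes "open U" "finite I" "\<And>i. i \<in> I \<Longrightarrow> times_differentiable k U (f i)"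
  shows "times_differentiable k U (\<lambda>x. \<Sum>i\<in>I. f i x)"
  using assms(2,3)
proof (induction I)
  case empty
  then show ?case using times_differentiable_const[OF assms(1)] by simp
next
  case (insert i I)
  then show ?case
    using times_differentiable_add[OF assms(1), of k "f i" "\<lambda>x. \<Sum>i\<in>I. f i x"] by simp
qed

lemma times_differentiable_scaleR:
  assumes "open U" "times_differentiable k U a" "times_differentiable k U f"
  shows "times_differentiable k U (\<lambda>x. a x *\<^sub>R f x)"
  using assms(2,3)
proof (induction k arbitrary: a f)
  case 0
  then show ?case
    unfolding times_differentiable.simps differentiable_on_def differentiable_def
    by (blast intro: has_derivative_scaleR)
next
  case (Suc k)
  have low: "times_differentiable k U a" "times_differentiable k U f"
    using Suc.prems times_differentiable_mono le_SucI order_refl by blast+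
  show ?case
  proof (rule times_differentiable_SucI[OF assms(1)])
    fix x assume "x \<in> U"
    then show "((\<lambda>x. a x *\<^sub>R f x) has_derivative
        (\<lambda>v. a x *\<^sub>R frechet_derivative f (at x within U) v +
             frechet_derivative a (at x within U) v *\<^sub>R f x)) (at x within U)"
      using Suc.prems by (intro has_derivative_scaleR times_differentiable_has_derivative)
  next
    fix v
    show "times_differentiable k U (\<lambda>x. a x *\<^sub>R frechet_derivative f (at x within U) v +
             frechet_derivative a (at x within U) v *\<^sub>R f x)"
      using Suc.prems low by (intro times_differentiable_add[OF assms(1)] Suc.IH) auto
  qed
qed

lemma times_differentiable_inner_const:
  assumes "open U" "times_differentiable k U f"
  shows "times_differentiable k U (\<lambda>x. f x \<bullet> c)"
  using assms(2)
proof (induction k arbitrary: f)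
  case 0
  then show ?case
    unfolding times_differentiable.simps differentiable_on_def differentiable_def
    by (blast intro: has_derivative_inner_left)
next
  case (Suc k)
  show ?case
  proof (rule times_differentiable_SucI[OF assms(1)])
    fix x assume "x \<in> U"
    then show "((\<lambda>x. f x \<bullet> c) has_derivative
        (\<lambda>v. frechet_derivative f (at x within U) v \<bullet> c)) (at x within U)"
      using Suc.prems by (intro has_derivative_inner_left times_differentiable_has_derivative)
  qed (use Suc in auto)
qed

text \<open>By the chain rule, written in coordinates of the middle space, the directional
  derivatives of a composition are built from the derivatives of \<open>f\<close> and from compositions of
  derivatives of \<open>g\<close> with \<open>f\<close>; to the latter the induction hypothesis applies.\<close>

lemma times_differentiable_compose:
  fixes f :: "'e::euclidean_space \<Rightarrow> 'f::euclidean_space" and g :: "'f \<Rightarrow> 'g::euclidean_space"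
  assumes "open U" "open V" "f ` U \<subseteq> V" "times_differentiable k U f" "times_differentiable k V g"
  shows "times_differentiable k U (\<lambda>x. g (f x))"
  using assms(4,5)
proof (induction k arbitrary: g)
  case 0
  have "g differentiable_on f ` U"
    using 0 assms(3) differentiable_on_subset by auto
  then show ?case
    using 0 differentiable_on_compose[of f U g] by (simp add: o_def)
next
  case (Suc k)
  have low: "times_differentiable k U f"
    using Suc.prems times_differentiable_mono le_SucI order_refl by blast
  let ?D = "\<lambda>x v. \<Sum>b\<in>Basis. (frechet_derivative f (at x within U) v \<bullet> b) *\<^sub>R
                    frechet_derivative g (at (f x) within V) b"
  show ?case
  proof (rule times_differentiable_SucI[OF assms(1), where D = ?D])
    fix x assume x: "x \<in> U"
    then have fx: "f x \<in> V" using assms(3) by auto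
    let ?g' = "frechet_derivative g (at (f x) within V)"
    have g': "(g has_derivative ?g') (at (f x) within V)"
      using times_differentiable_has_derivative[OF Suc.prems(2) fx] .
    then have lin: "linear ?g'"
      using has_derivative_linear by blast
    have "((\<lambda>x. g (f x)) has_derivative (\<lambda>v. ?g' (frechet_derivative f (at x within U) v)))
        (at x within U)"
      using has_derivative_in_compose[OF times_differentiable_has_derivative[OF Suc.prems(1) x]
          has_derivative_subset[OF g' assms(3)]] .
    moreover have rep: "?g' w = (\<Sum>b\<in>Basis. (w \<bullet> b) *\<^sub>R ?g' b)" for w
    proof -
      have "?g' w = ?g' (\<Sum>b\<in>Basis. (w \<bullet> b) *\<^sub>R b)" by (simp add: euclidean_representation)
      then show ?thesis by (simp only: linear_sum[OF lin] linear_cmul[OF lin])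
    qed
    moreover have "(\<lambda>v. ?g' (frechet_derivative f (at x within U) v)) = ?D x"
      by (rule ext) (rule rep)
    ultimately show "((\<lambda>x. g (f x)) has_derivative ?D x) (at x within U)"
      by metis
  next
    fix v
    show "times_differentiable k U (\<lambda>x. ?D x v)"
      using Suc.prems
      by (intro times_differentiable_sum[OF assms(1)] times_differentiable_scaleR[OF assms(1)]
          times_differentiable_inner_const[OF assms(1)] Suc.IH[OF low]) auto
  qed
qed

lemma smooth_on_open_compose:
  assumes "smooth_on_open U f" "smooth_on_open V g" "f ` U \<subseteq> V"
  shows "smooth_on_open U (g \<circ> f)"
  using assms times_differentiable_compose[of U V f _ g]
  unfolding smooth_on_open_iff_times_differentiable by (simp add: o_def)

lemma smooth_on_open_id: "smooth_on_open UNIV (\<lambda>x. x)"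
proof -
  have "times_differentiable k UNIV (\<lambda>x::'a. x)" for k
  proof (cases k)
    case (Suc j)
    show ?thesis unfolding Suc
      by (rule times_differentiable_SucI[where D = "\<lambda>x v. v"])
         (auto intro: times_differentiable_const)
  qed (simp add: differentiable_on_def)
  then show ?thesis by (simp add: smooth_on_open_iff_times_differentiable)
qed


section \<open>Smooth maps on arbitrary subsets\<close>

lemma smooth_on_cong:
  assumes "\<And>x. x \<in> S \<Longrightarrow> f x = g x"
  shows "smooth_on S f \<longleftrightarrow> smooth_on S g"
proof -
  have "(\<forall>y\<in>S \<inter> U. f y = h y) \<longleftrightarrow> (\<forall>y\<in>S \<inter> U. g y = h y)" for U and h :: "'a \<Rightarrow> 'b"
    using assms by auto
  then show ?thesis unfolding smooth_on_def by presburger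
qed

lemma smooth_on_id: "smooth_on S (\<lambda>x. x)"
  unfolding smooth_on_def using smooth_on_open_id by blast

lemma smooth_on_extension:
  assumes "smooth_on S f" "x \<in> S"
  shows "\<exists>U g. open U \<and> x \<in> U \<and> smooth_on_open U g \<and> (\<forall>y\<in>S \<inter> U. f y = g y)"
  using assms unfolding smooth_on_def smooth_on_open_def by meson

lemma smooth_on_subset:
  assumes "smooth_on S f" "S' \<subseteq> S"
  shows "smooth_on S' f"
  unfolding smooth_on_def
proof
  fix x assume "x \<in> S'"
  then obtain U g where "x \<in> U" "smooth_on_open U g" "\<forall>y\<in>S \<inter> U. f y = g y"
    using smooth_on_extension[OF assms(1), of x] assms(2) by blast
  then show "\<exists>U g. x \<in> U \<and> smooth_on_open U g \<and> (\<forall>y\<in>S' \<inter> U. f y = g y)"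
    using assms(2) by (intro exI[of _ U] exI[of _ g]) auto
qed

lemma smooth_on_open_has_derivative:
  assumes "smooth_on_open U f" "x \<in> U"
  shows "(f has_derivative frechet_derivative f (at x)) (at x)"
proof -
  have "iter_deriv U [] f differentiable_on U" and "open U"
    using assms unfolding smooth_on_open_def by blast+
  then have "f differentiable (at x)"
    using assms(2) by (simp add: differentiable_on_eq_differentiable_at)
  then show ?thesis by (simp add: frechet_derivative_works)
qed

lemma smooth_on_open_continuous_on: "smooth_on_open U f \<Longrightarrow> continuous_on U f"
  by (intro continuous_at_imp_continuous_on ballI)
     (rule has_derivative_continuous[OF smooth_on_open_has_derivative])

lemma smooth_on_compose:
  assumes f: "smooth_on S f" and g: "smooth_on S' g" and sub: "f ` S \<subseteq> S'"
  shows "smooth_on S (g \<circ> f)"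
  unfolding smooth_on_def
proof
  fix x assume x: "x \<in> S"
  obtain U F where U: "open U" "x \<in> U" "smooth_on_open U F" "\<And>y. y \<in> S \<inter> U \<Longrightarrow> f y = F y"
    using smooth_on_extension[OF f x] by blast
  have fx: "f x \<in> S'" using x sub by auto
  obtain V G where V: "open V" "f x \<in> V" "smooth_on_open V G" "\<And>y. y \<in> S' \<inter> V \<Longrightarrow> g y = G y"
    using smooth_on_extension[OF g fx] by blast
  let ?W = "U \<inter> F -` V"
  have W: "open ?W"
    using smooth_on_open_continuous_on[OF U(3)] U(1) V(1)
    by (simp add: continuous_open_preimage)
  have "smooth_on_open ?W (G \<circ> F)"
    using smooth_on_open_subset[OF U(3) W] V(3) by (intro smooth_on_open_compose) auto
  moreover have "x \<in> ?W" using x U V by auto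
  moreover have "\<forall>y\<in>S \<inter> ?W. (g \<circ> f) y = (G \<circ> F) y"
  proof
    fix y assume y: "y \<in> S \<inter> ?W"
    then have "f y = F y" "f y \<in> S'" using U(4) sub by auto
    then show "(g \<circ> f) y = (G \<circ> F) y" using V(4)[of "f y"] y by auto
  qed
  ultimately show "\<exists>U ga. x \<in> U \<and> smooth_on_open U ga \<and> (\<forall>y\<in>S \<inter> U. (g \<circ> f) y = ga y)"
    by (intro exI conjI) assumption+
qed

lemma smooth_on_local:
  assumes "\<And>x. x \<in> S \<Longrightarrow> \<exists>S'. openin (top_of_set S) S' \<and> x \<in> S' \<and> smooth_on S' f"
  shows "smooth_on S f"
  unfolding smooth_on_def
proof
  fix x assume "x \<in> S"
  then obtain S' where S': "openin (top_of_set S) S'" "x \<in> S'" "smooth_on S' f"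
    using assms by blast
  then obtain O' where O': "open O'" "S' = S \<inter> O'" by (auto simp: openin_open)
  obtain U g where U: "open U" "x \<in> U" "smooth_on_open U g" "\<And>y. y \<in> S' \<inter> U \<Longrightarrow> f y = g y"
    using smooth_on_extension[OF S'(3,2)] by blast
  have "smooth_on_open (U \<inter> O') g"
    using smooth_on_open_subset[OF U(3)] U(1) O' by blast
  then show "\<exists>U g. x \<in> U \<and> smooth_on_open U g \<and> (\<forall>y\<in>S \<inter> U. f y = g y)"
    using U O' S'(2) by blast
qed

lemma smooth_on_has_derivative:
  assumes "smooth_on S f" "x \<in> S"
  shows "(f has_derivative frechet_derivative f (at x within S)) (at x within S)"
proof -
  obtain U g where U: "open U" "x \<in> U" "smooth_on_open U g" "\<And>y. y \<in> S \<inter> U \<Longrightarrow> f y = g y"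
    using smooth_on_extension[OF assms] by blast
  let ?D = "frechet_derivative g (at x)"
  have "(g has_derivative ?D) (at x within S \<inter> U)"
    using smooth_on_open_has_derivative[OF U(3,2)] has_derivative_at_withinI by blast
  then have "(f has_derivative ?D) (at x within S \<inter> U)"
    using has_derivative_within_cong[of "S \<inter> U" f g x] U assms(2) by blast
  then have "(f has_derivative ?D) (at x within S)"
    using at_within_nhd[OF U(2,1), of "S \<inter> U" S] by auto
  then show ?thesis
    using frechet_derivative_works differentiable_def by blast
qed

lemma smooth_on_continuous_on: "smooth_on S f \<Longrightarrow> continuous_on S f"
  unfolding continuous_on_eq_continuous_within
  using smooth_on_has_derivative has_derivative_continuous by blast

lemma smooth_on_eq:
  assumes "smooth_on S f" "\<And>x. x \<in> S \<Longrightarrow> f x = g x"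
  shows "smooth_on S g"
  using assms smooth_on_cong by metis


section \<open>Charts and smooth maps\<close>

lemma topological_chart_openin: "topological_chart X (U, \<phi>) \<Longrightarrow> openin X U"
  by (simp add: topological_chart_def)

lemma topological_chart_subset: "topological_chart X (U, \<phi>) \<Longrightarrow> U \<subseteq> topspace X"
  by (simp add: topological_chart_openin openin_subset)

lemma topological_chart_homeo:
  "topological_chart X (U, \<phi>) \<Longrightarrow> homeomorphic_map (subtopology X U) (top_of_set (\<phi> ` U)) \<phi>"
  by (simp add: topological_chart_def)

lemma topological_chart_inj_on: "topological_chart X (U, \<phi>) \<Longrightarrow> inj_on \<phi> U"
  using topological_chart_subset[of X U \<phi>] topological_chart_homeo[of X U \<phi>]
    homeomorphic_imp_injective_map by (metis Int_absorb1 topspace_subtopology)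

lemma topological_chart_continuous_inv:
  assumes "topological_chart X (U, \<phi>)"
  shows "continuous_map (top_of_set (\<phi> ` U)) X (inv_into U \<phi>)"
proof -
  have U: "U \<subseteq> topspace X" "inj_on \<phi> U"
    using assms topological_chart_subset topological_chart_inj_on by auto
  obtain g where "homeomorphic_maps (subtopology X U) (top_of_set (\<phi> ` U)) \<phi> g"
    using topological_chart_homeo[OF assms] homeomorphic_map_maps by blast
  then have g: "continuous_map (top_of_set (\<phi> ` U)) (subtopology X U) g"
    and gf: "\<And>x. x \<in> U \<Longrightarrow> g (\<phi> x) = x"
    using U by (auto simp: homeomorphic_maps_def)
  have "continuous_map (top_of_set (\<phi> ` U)) (subtopology X U) (inv_into U \<phi>)"
    by (rule continuous_map_eq[OF g]) (use U gf in \<open>auto simp: inv_into_f_f\<close>)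
  then show ?thesis using continuous_map_in_subtopology by blast
qed

lemma topological_chart_open_image:
  assumes "topological_chart X (U, \<phi>)" "openin X W" "W \<subseteq> U"
  shows "openin (top_of_set (\<phi> ` U)) (\<phi> ` W)"
proof -
  have "openin (subtopology X U) W"
    using assms by (simp add: topological_chart_openin openin_open_subtopology)
  then show ?thesis
    using topological_chart_homeo[OF assms(1)] homeomorphic_imp_open_map open_map_def by blast
qed

text \<open>Uniqueness of derivatives within the image needs it to be relatively open in a half-space, a
  property that passes to smaller chart domains.\<close>

lemma topological_chart_open_image_half_space:
  assumes "topological_chart X (U, \<phi>)" "openin X W" "W \<subseteq> U"
  shows "\<exists>b. openin (top_of_set (half_space b)) (\<phi> ` W)"
proof -
  obtain b where "openin (top_of_set (half_space b)) (\<phi> ` U)"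
    using assms(1) by (auto simp: topological_chart_def)
  then show ?thesis
    using topological_chart_open_image[OF assms] openin_trans by blast
qed

lemma topological_chart_restrict:
  assumes "topological_chart X (U, \<phi>)" "openin X W"
  shows "topological_chart X (U \<inter> W, \<phi>)"
proof -
  have W: "openin X (U \<inter> W)"
    using assms topological_chart_openin by blast
  have U: "U \<subseteq> topspace X" "inj_on \<phi> U"
    using assms topological_chart_subset topological_chart_inj_on by auto
  have "homeomorphic_map (subtopology (subtopology X U) (U \<inter> W))
          (subtopology (top_of_set (\<phi> ` U)) (\<phi> ` (U \<inter> W))) \<phi>"
    by (rule homeomorphic_map_subtopologies[OF topological_chart_homeo[OF assms(1)]])
       (use U in auto)
  moreover have "subtopology (subtopology X U) (U \<inter> W) = subtopology X (U \<inter> W)"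
    by (simp add: subtopology_subtopology Int_absorb1)
  moreover have "subtopology (top_of_set (\<phi> ` U)) (\<phi> ` (U \<inter> W)) = top_of_set (\<phi> ` (U \<inter> W))"
    by (simp add: subtopology_subtopology Int_absorb1 image_mono)
  ultimately show ?thesis
    using W topological_chart_open_image_half_space[OF assms(1) W]
    by (auto simp: topological_chart_def)
qed

text \<open>The notation \<open>inv\<close> stands for inverses in groups here, so the inverse of a bijection of a
  type gets a name of its own.\<close>

abbreviation inv_fun :: "('a \<Rightarrow> 'b) \<Rightarrow> 'b \<Rightarrow> 'a" where
  "inv_fun f \<equiv> inv_into UNIV f"

text \<open>The chart obtained from a chart by transport of structure along a bijection \<open>F\<close>. Local
  representations in transported charts are local representations in the original ones of the
  map composed with \<open>F\<close>, so no derivatives have to be computed when structure is transported.\<close>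

definition push_chart :: "('a \<Rightarrow> 'b) \<Rightarrow> ('a, 'e) chart \<Rightarrow> ('b, 'e) chart" where
  "push_chart F = (\<lambda>(U, \<phi>). (F ` U, \<phi> \<circ> inv_fun F))"

lemma image_push_chart:
  assumes "bij F"
  shows "(\<phi> \<circ> inv_fun F) ` (F ` U) = \<phi> ` U"
  using assms by (auto simp: image_comp o_def bij_is_inj inv_f_f)

lemma inv_into_push_chart:
  assumes "bij F" "inj_on \<phi> U" "y \<in> \<phi> ` U"
  shows "inv_into (F ` U) (\<phi> \<circ> inv_fun F) y = F (inv_into U \<phi> y)"
proof -
  let ?x = "inv_into U \<phi> y"
  have inj: "inj F" using assms(1) bij_is_inj by blast
  have "inj_on (\<phi> \<circ> inv_fun F) (F ` U)"
    using assms(2) inj by (auto simp: inj_on_def)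
  moreover have "F ?x \<in> F ` U" "(\<phi> \<circ> inv_fun F) (F ?x) = y"
    using assms(3) inj by (auto simp: inv_into_into f_inv_into_f)
  ultimately show ?thesis using inv_into_f_eq by metis
qed

lemma topological_chart_push:
  assumes F: "homeomorphic_map X Y F" "bij F" and c: "topological_chart X c"
  shows "topological_chart Y (push_chart F c)"
proof -
  obtain U \<phi> where c': "c = (U, \<phi>)" by (cases c)
  have ch: "topological_chart X (U, \<phi>)" using c c' by simp
  have U: "U \<subseteq> topspace X" using topological_chart_subset[OF ch] .
  have inj: "inj F" using F(2) bij_is_inj by blast
  obtain g where g: "homeomorphic_maps X Y F g"
    using F(1) homeomorphic_map_maps by blast
  have FU: "openin Y (F ` U)"
    using homeomorphic_imp_open_map[OF F(1)] topological_chart_openin[OF ch]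
    by (simp add: open_map_def)
  have "homeomorphic_maps Y X g F"
    using g homeomorphic_maps_sym by blast
  moreover have "g y = inv_fun F y" if "y \<in> topspace Y" for y
  proof -
    have "F (g y) = y" using g that by (simp add: homeomorphic_maps_def)
    then show ?thesis using inv_f_f[OF inj, of "g y"] by simp
  qed
  ultimately have "homeomorphic_maps Y X (inv_fun F) F"
    by (rule homeomorphic_maps_eq) auto
  then have inv: "homeomorphic_map Y X (inv_fun F)"
    using homeomorphic_map_maps by blast
  have sub: "homeomorphic_map (subtopology Y (F ` U)) (subtopology X U) (inv_fun F)"
  proof (rule homeomorphic_map_subtopologies[OF inv])
    show "inv_fun F ` (topspace Y \<inter> F ` U) = topspace X \<inter> U"
      by (simp only: Int_absorb1[OF openin_subset[OF FU]] Int_absorb1[OF U] image_inv_f_f[OF inj])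
  qed
  have "homeomorphic_map (subtopology Y (F ` U)) (top_of_set (\<phi> ` U)) (\<phi> \<circ> inv_fun F)"
    using homeomorphic_map_compose[OF sub topological_chart_homeo[OF ch]] .
  then show ?thesis
    using FU ch image_push_chart[OF F(2), of \<phi> U]
    by (simp add: topological_chart_def push_chart_def c')
qed

lemma local_rep_cong:
  assumes "\<And>p. p \<in> A \<Longrightarrow> f p = g p" "A \<subseteq> U" "inj_on \<phi> U" "y \<in> \<phi> ` A"
  shows "local_rep f (U, \<phi>) d y = local_rep g (U, \<phi>) d y"
proof -
  obtain p where p: "p \<in> A" "y = \<phi> p" using assms(4) by blast
  then have "inv_into U \<phi> y = p" using assms by (auto intro: inv_into_f_f)
  then show ?thesis using p assms(1) by (cases d) (simp add: local_rep_def)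
qed

lemma local_rep_apply:
  assumes "inj_on \<phi> U" "p \<in> U"
  shows "local_rep f (U, \<phi>) (V, \<psi>) (\<phi> p) = \<psi> (f p)"
  using assms by (simp add: local_rep_def)

lemma local_rep_push_domain:
  assumes "bij F" "inj_on \<phi> U" "y \<in> \<phi> ` U"
  shows "local_rep f (push_chart F (U, \<phi>)) d y = local_rep (f \<circ> F) (U, \<phi>) d y"
  using inv_into_push_chart[OF assms] by (cases d) (simp add: local_rep_def push_chart_def)

lemma local_rep_push_codomain:
  "local_rep f c (push_chart F d) = local_rep (inv_fun F \<circ> f) c d"
  by (cases c, cases d) (auto simp: local_rep_def push_chart_def)

lemma smooth_map_cong:
  assumes "\<And>p. p \<in> A \<Longrightarrow> f p = g p" and M: "\<forall>c\<in>atlas M. topological_chart (mtop M) c"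
  shows "smooth_map M A N f \<Longrightarrow> smooth_map M A N g"
  unfolding smooth_map_def
proof (intro conjI ballI, goal_cases)
  case 2
  then show ?case using assms(1) by auto
next
  case (3 p)
  then obtain U \<phi> V \<psi> W where c: "(U, \<phi>) \<in> atlas M" "(V, \<psi>) \<in> atlas N"
      "openin (mtop M) W" "p \<in> W" "W \<subseteq> U" "f ` (A \<inter> W) \<subseteq> V"
      "smooth_on (\<phi> ` (A \<inter> W)) (local_rep f (U, \<phi>) (V, \<psi>))"
    by meson
  have "inj_on \<phi> U" using M c(1) topological_chart_inj_on by blast
  then have "local_rep f (U, \<phi>) (V, \<psi>) y = local_rep g (U, \<phi>) (V, \<psi>) y"
    if "y \<in> \<phi> ` (A \<inter> W)" for y
    using that c(5) assms(1) by (intro local_rep_cong[of "A \<inter> W"]) auto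
  with c(7) have "smooth_on (\<phi> ` (A \<inter> W)) (local_rep g (U, \<phi>) (V, \<psi>))"
    by (rule smooth_on_eq)
  moreover have "g ` (A \<inter> W) \<subseteq> V" using c(6) assms(1) by auto
  ultimately show ?case
    by (intro exI[of _ U] exI[of _ \<phi>] exI[of _ V] exI[of _ \<psi>] exI[of _ W] conjI c)
qed auto

text \<open>Near each point the map is the composition of a chart, a smooth and hence continuous local
  representation, and the inverse of a chart.\<close>

lemma smooth_map_continuous:
  assumes M: "\<forall>c\<in>atlas M. topological_chart (mtop M) c"
    and N: "\<forall>c\<in>atlas N. topological_chart (mtop N) c"
    and f: "smooth_map M A N f"
  shows "continuous_map (subtopology (mtop M) A) (mtop N) f"
proof -
  have A: "A \<subseteq> pts M" "f ` A \<subseteq> pts N" using f by (auto simp: smooth_map_def)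
  have nbhd: "\<exists>W. openin (mtop M) W \<and> p \<in> W \<and> continuous_map (subtopology (mtop M) (A \<inter> W)) (mtop N) f"
    if "p \<in> A" for p
  proof -
    obtain U \<phi> V \<psi> W where c: "(U, \<phi>) \<in> atlas M" "(V, \<psi>) \<in> atlas N"
      "openin (mtop M) W" "p \<in> W" "W \<subseteq> U" "f ` (A \<inter> W) \<subseteq> V"
      "smooth_on (\<phi> ` (A \<inter> W)) (local_rep f (U, \<phi>) (V, \<psi>))"
      using f \<open>p \<in> A\<close> unfolding smooth_map_def by meson
    let ?r = "local_rep f (U, \<phi>) (V, \<psi>)"
    have chU: "topological_chart (mtop M) (U, \<phi>)" and chV: "topological_chart (mtop N) (V, \<psi>)"
      using M N c by auto
    have inj: "inj_on \<phi> U" "inj_on \<psi> V"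
      using topological_chart_inj_on chU chV by auto
    have 1: "continuous_map (subtopology (mtop M) (A \<inter> W)) (top_of_set (\<phi> ` (A \<inter> W))) \<phi>"
    proof -
      have "continuous_map (subtopology (mtop M) U) (top_of_set (\<phi> ` U)) \<phi>"
        using topological_chart_homeo[OF chU] homeomorphic_imp_continuous_map by blast
      then have "continuous_map (subtopology (mtop M) U) euclidean \<phi>"
        using continuous_map_in_subtopology by blast
      then have "continuous_map (subtopology (mtop M) (A \<inter> W)) euclidean \<phi>"
        using continuous_map_from_subtopology_mono c(5) by (metis le_infI2)
      then show ?thesis by (auto simp: continuous_map_in_subtopology)
    qed
    have 2: "continuous_map (top_of_set (\<phi> ` (A \<inter> W))) (top_of_set (\<psi> ` V)) ?r"
    proof -
      have "?r ` \<phi> ` (A \<inter> W) \<subseteq> \<psi> ` V"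
      proof clarify
        fix x assume "x \<in> A" "x \<in> W"
        then have "x \<in> U" "f x \<in> V" using c(5,6) by auto
        then show "?r (\<phi> x) \<in> \<psi> ` V" by (simp add: local_rep_apply[OF inj(1)])
      qed
      then show ?thesis
        using smooth_on_continuous_on[OF c(7)] by (auto simp: continuous_map_in_subtopology)
    qed
    have "continuous_map (subtopology (mtop M) (A \<inter> W)) (mtop N) (inv_into V \<psi> \<circ> (?r \<circ> \<phi>))"
      using 1 2 topological_chart_continuous_inv[OF chV] by (blast intro: continuous_map_compose)
    then have "continuous_map (subtopology (mtop M) (A \<inter> W)) (mtop N) f"
    proof (rule continuous_map_eq)
      fix x assume "x \<in> topspace (subtopology (mtop M) (A \<inter> W))"
      then have "x \<in> A \<inter> W" by auto
      then have "x \<in> U" "f x \<in> V" using c(5,6) by auto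
      then have "?r (\<phi> x) = \<psi> (f x)" "f x \<in> V"
        by (simp_all add: local_rep_apply[OF inj(1)])
      then show "(inv_into V \<psi> \<circ> (?r \<circ> \<phi>)) x = f x"
        using inj(2) by simp
    qed
    then show ?thesis using c by blast
  qed
  show ?thesis
    unfolding continuous_map
  proof (intro conjI allI impI)
    show "f ` topspace (subtopology (mtop M) A) \<subseteq> pts N" using A by auto
  next
    fix O' assume O': "openin (mtop N) O'"
    let ?P = "{x \<in> topspace (subtopology (mtop M) A). f x \<in> O'}"
    show "openin (subtopology (mtop M) A) ?P"
    proof (subst openin_subopen, intro ballI)
      fix p assume p: "p \<in> ?P"
      then have "p \<in> A" by auto
      then obtain W where W: "openin (mtop M) W" "p \<in> W"
        "continuous_map (subtopology (mtop M) (A \<inter> W)) (mtop N) f"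
        using nbhd by blast
      have "openin (subtopology (mtop M) (A \<inter> W)) {x \<in> topspace (subtopology (mtop M) (A \<inter> W)). f x \<in> O'}"
        using W(3) O' openin_continuous_map_preimage by blast
      moreover have "{x \<in> topspace (subtopology (mtop M) (A \<inter> W)). f x \<in> O'} = {x \<in> A \<inter> W. f x \<in> O'}"
        using A by auto
      ultimately obtain Q where Q: "openin (mtop M) Q" "{x \<in> A \<inter> W. f x \<in> O'} = Q \<inter> (A \<inter> W)"
        by (auto simp: openin_subtopology)
      have "openin (subtopology (mtop M) A) {x \<in> A \<inter> W. f x \<in> O'}"
        unfolding openin_subtopology
        by (rule exI[of _ "Q \<inter> W"]) (use Q W in auto)
      then show "\<exists>T. openin (subtopology (mtop M) A) T \<and> p \<in> T \<and> T \<subseteq> ?P"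
        using p W(2) A by (intro exI[of _ "{x \<in> A \<inter> W. f x \<in> O'}"]) auto
    qed
  qed
qed

lemma smooth_manifold_charts:
  "smooth_manifold M \<Longrightarrow> \<forall>c\<in>atlas M. topological_chart (mtop M) c"
  by (simp add: smooth_manifold_def)

lemma max_atlas_chart: "c \<in> max_atlas M \<Longrightarrow> topological_chart (mtop M) c"
  by (simp add: max_atlas_def)

lemma atlas_subset_max_atlas: "smooth_manifold M \<Longrightarrow> atlas M \<subseteq> max_atlas M"
  by (auto simp: smooth_manifold_def max_atlas_def)

lemma smooth_manifold_chart_at:
  assumes "smooth_manifold M" "p \<in> pts M"
  obtains U \<phi> where "(U, \<phi>) \<in> atlas M" "p \<in> U"
  using assms unfolding smooth_manifold_def by (metis UN_E prod.collapse)

lemma max_atlas_restrict: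
  assumes "(U, \<phi>) \<in> max_atlas M" "openin (mtop M) W"
  shows "(U \<inter> W, \<phi>) \<in> max_atlas M"
proof -
  have ch: "topological_chart (mtop M) (U, \<phi>)" using assms max_atlas_chart by blast
  have inj: "inj_on \<phi> U" using topological_chart_inj_on[OF ch] .
  have inv: "inv_into (U \<inter> W) \<phi> y = inv_into U \<phi> y" if "y \<in> \<phi> ` (U \<inter> W)" for y
  proof -
    obtain p where "p \<in> U \<inter> W" "y = \<phi> p" using \<open>y \<in> \<phi> ` (U \<inter> W)\<close> by blast
    then show ?thesis using inj by (metis IntD1 inj_on_Int inv_into_f_f)
  qed
  have "smooth_transition (U \<inter> W, \<phi>) d \<and> smooth_transition d (U \<inter> W, \<phi>)" if "d \<in> atlas M" for d
  proof -
    obtain V \<psi> where d: "d = (V, \<psi>)" by (cases d)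
    have t: "smooth_on (\<phi> ` (U \<inter> V)) (\<psi> \<circ> inv_into U \<phi>)" "smooth_on (\<psi> ` (V \<inter> U)) (\<phi> \<circ> inv_into V \<psi>)"
      using assms(1) that d by (auto simp: max_atlas_def smooth_transition_def)
    have "smooth_on (\<phi> ` (U \<inter> W \<inter> V)) (\<psi> \<circ> inv_into U \<phi>)"
      by (rule smooth_on_subset[OF t(1)]) auto
    then have "smooth_on (\<phi> ` (U \<inter> W \<inter> V)) (\<psi> \<circ> inv_into (U \<inter> W) \<phi>)"
      by (rule smooth_on_eq) (use inv in auto)
    moreover have "smooth_on (\<psi> ` (V \<inter> (U \<inter> W))) (\<phi> \<circ> inv_into V \<psi>)"
      by (rule smooth_on_subset[OF t(2)]) auto
    ultimately show ?thesis by (simp add: d smooth_transition_def)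
  qed
  then show ?thesis
    using topological_chart_restrict[OF ch assms(2)] by (simp add: max_atlas_def)
qed

lemma smooth_map_continuous_map:
  assumes "smooth_manifold M" "smooth_manifold N" "smooth_map M (pts M) N f"
  shows "continuous_map (mtop M) (mtop N) f"
  using smooth_map_continuous[OF _ _ assms(3)] assms(1,2) by (simp add: smooth_manifold_charts)

lemma openin_chart_preimage:
  assumes "continuous_map X Y f" "openin X U" "openin Y V"
  shows "openin X (U \<inter> f -` V)"
proof -
  have "U \<inter> f -` V = U \<inter> {x \<in> topspace X. f x \<in> V}"
    using openin_subset[OF assms(2)] by auto
  then show ?thesis
    using openin_continuous_map_preimage[OF assms(1,3)] openin_Int[OF assms(2)] by metis
qed

text \<open>A map that is smooth in suitable charts of the given atlases is smooth in all charts of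
  the maximal atlases: near a point, precompose and postcompose with smooth transitions.\<close>

lemma smooth_map_local_rep:
  assumes M: "smooth_manifold M" and N: "smooth_manifold N" and f: "smooth_map M (pts M) N f"
    and c: "(U, \<phi>) \<in> max_atlas M" and d: "(V, \<psi>) \<in> max_atlas N"
  shows "smooth_on (\<phi> ` (U \<inter> f -` V)) (local_rep f (U, \<phi>) (V, \<psi>))"
proof (rule smooth_on_local)
  fix x assume "x \<in> \<phi> ` (U \<inter> f -` V)"
  then obtain p where p: "p \<in> U" "f p \<in> V" "x = \<phi> p" by auto
  have ch: "topological_chart (mtop M) (U, \<phi>)" "topological_chart (mtop N) (V, \<psi>)"
    using c d max_atlas_chart by blast+
  have pM: "p \<in> pts M" using topological_chart_subset[OF ch(1)] p by blast
  then obtain U1 \<phi>1 V1 \<psi>1 W where l: "(U1, \<phi>1) \<in> atlas M" "(V1, \<psi>1) \<in> atlas N"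
      "openin (mtop M) W" "p \<in> W" "W \<subseteq> U1" "f ` (pts M \<inter> W) \<subseteq> V1"
      "smooth_on (\<phi>1 ` (pts M \<inter> W)) (local_rep f (U1, \<phi>1) (V1, \<psi>1))"
    using f unfolding smooth_map_def by meson
  have "pts M \<inter> W = W" using l(3) openin_subset by blast
  with l have l': "f ` W \<subseteq> V1" "smooth_on (\<phi>1 ` W) (local_rep f (U1, \<phi>1) (V1, \<psi>1))" by auto
  have ch1: "topological_chart (mtop M) (U1, \<phi>1)" "topological_chart (mtop N) (V1, \<psi>1)"
    using M N l(1,2) smooth_manifold_charts by blast+
  have inj: "inj_on \<phi> U" "inj_on \<psi> V" "inj_on \<phi>1 U1" "inj_on \<psi>1 V1"
    using ch ch1 topological_chart_inj_on by blast+
  have cont: "continuous_map (mtop M) (mtop N) f"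
    using smooth_map_continuous_map[OF M N f] .
  define W' where "W' = W \<inter> (U \<inter> f -` V)"
  have W': "openin (mtop M) W'" "W' \<subseteq> U \<inter> f -` V" "p \<in> W'"
    using openin_chart_preimage[OF cont] topological_chart_openin[OF ch(1)]
      topological_chart_openin[OF ch(2)] l(3,4) p by (auto simp: W'_def)
  have "openin (top_of_set (\<phi> ` U)) (\<phi> ` W')"
    using topological_chart_open_image[OF ch(1) W'(1)] W'(2) by blast
  then have op: "openin (top_of_set (\<phi> ` (U \<inter> f -` V))) (\<phi> ` W')"
    by (rule openin_subset_trans) (use W'(2) in auto)
  have "smooth_on (\<phi> ` (U \<inter> U1)) (\<phi>1 \<circ> inv_into U \<phi>)"
    using c l(1) by (auto simp: max_atlas_def smooth_transition_def)
  then have s1: "smooth_on (\<phi> ` W') (\<phi>1 \<circ> inv_into U \<phi>)"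
    by (rule smooth_on_subset) (use W' l(5) in \<open>auto simp: W'_def\<close>)
  have e1: "(\<phi>1 \<circ> inv_into U \<phi>) (\<phi> q) = \<phi>1 q" if "q \<in> W'" for q
    using that W'(2) inj(1) by auto
  have e2: "local_rep f (U1, \<phi>1) (V1, \<psi>1) (\<phi>1 q) = \<psi>1 (f q)" if "q \<in> W'" for q
  proof -
    have "q \<in> U1" using that l(5) by (auto simp: W'_def)
    then show ?thesis by (rule local_rep_apply[OF inj(3)])
  qed
  have s2: "smooth_on (\<phi> ` W') (local_rep f (U1, \<phi>1) (V1, \<psi>1) \<circ> (\<phi>1 \<circ> inv_into U \<phi>))"
    using s1 l'(2) by (rule smooth_on_compose) (use e1 in \<open>auto simp: W'_def\<close>)
  have s3: "smooth_on (\<psi>1 ` (V1 \<inter> V)) (\<psi> \<circ> inv_into V1 \<psi>1)"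
    using d l(2) by (auto simp: max_atlas_def smooth_transition_def)
  have fV: "f q \<in> V1 \<inter> V" if "q \<in> W'" for q
    using that l'(1) by (auto simp: W'_def)
  \<comment> \<open>In the charts of \<open>f\<close> at \<open>p\<close>, between transitions to and from the given charts.\<close>
  have s4: "smooth_on (\<phi> ` W')
      ((\<psi> \<circ> inv_into V1 \<psi>1) \<circ> (local_rep f (U1, \<phi>1) (V1, \<psi>1) \<circ> (\<phi>1 \<circ> inv_into U \<phi>)))"
    using s2 s3 by (rule smooth_on_compose) (use e1 e2 fV in auto)
  have "((\<psi> \<circ> inv_into V1 \<psi>1) \<circ> (local_rep f (U1, \<phi>1) (V1, \<psi>1) \<circ> (\<phi>1 \<circ> inv_into U \<phi>))) y =
      local_rep f (U, \<phi>) (V, \<psi>) y" if "y \<in> \<phi> ` W'" for y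
  proof -
    obtain q where q: "q \<in> W'" "y = \<phi> q" using \<open>y \<in> \<phi> ` W'\<close> by blast
    have "q \<in> U" using q W'(2) by blast
    then show ?thesis
      using e1[OF q(1)] e2[OF q(1)] fV[OF q(1)] inj(4) q(2) by (simp add: local_rep_apply[OF inj(1)])
  qed
  with s4 have "smooth_on (\<phi> ` W') (local_rep f (U, \<phi>) (V, \<psi>))"
    by (rule smooth_on_eq)
  then show "\<exists>S'. openin (top_of_set (\<phi> ` (U \<inter> f -` V))) S' \<and> x \<in> S' \<and>
      smooth_on S' (local_rep f (U, \<phi>) (V, \<psi>))"
    using op W'(3) p(3) by blast
qed

lemma smooth_map_compose:
  assumes L: "smooth_manifold L" and M: "smooth_manifold M" and N: "smooth_manifold N"
    and f: "smooth_map L (pts L) M f" and g: "smooth_map M (pts M) N g"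
  shows "smooth_map L (pts L) N (g \<circ> f)"
  unfolding smooth_map_def
proof (intro conjI ballI)
  have im: "f ` pts L \<subseteq> pts M" "g ` pts M \<subseteq> pts N" using f g by (auto simp: smooth_map_def)
  then show "(g \<circ> f) ` pts L \<subseteq> pts N" by auto
  fix p assume p: "p \<in> pts L"
  obtain U \<phi> where U: "(U, \<phi>) \<in> atlas L" "p \<in> U"
    using smooth_manifold_chart_at[OF L p] .
  obtain V \<psi> where V: "(V, \<psi>) \<in> atlas M" "f p \<in> V"
    using smooth_manifold_chart_at[OF M, of "f p"] p im by blast
  obtain V' \<psi>' where V': "(V', \<psi>') \<in> atlas N" "g (f p) \<in> V'"
    using smooth_manifold_chart_at[OF N, of "g (f p)"] p im by blast
  have ch: "topological_chart (mtop L) (U, \<phi>)" "topological_chart (mtop M) (V, \<psi>)"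
      "topological_chart (mtop N) (V', \<psi>')"
    using L M N U V V' smooth_manifold_charts by blast+
  have inj: "inj_on \<phi> U" "inj_on \<psi> V" using ch topological_chart_inj_on by blast+
  define W where "W = U \<inter> f -` (V \<inter> g -` V')"
  have W: "openin (mtop L) W" unfolding W_def
    using ch topological_chart_openin openin_chart_preimage
      smooth_map_continuous_map[OF L M f] smooth_map_continuous_map[OF M N g] by meson
  have WL: "pts L \<inter> W = W" using W openin_subset by blast
  have "smooth_on (\<phi> ` (U \<inter> f -` V)) (local_rep f (U, \<phi>) (V, \<psi>))"
    using atlas_subset_max_atlas[OF L] atlas_subset_max_atlas[OF M] U V
    by (intro smooth_map_local_rep[OF L M f]) auto
  then have sf: "smooth_on (\<phi> ` W) (local_rep f (U, \<phi>) (V, \<psi>))"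
    by (rule smooth_on_subset) (auto simp: W_def)
  have sg: "smooth_on (\<psi> ` (V \<inter> g -` V')) (local_rep g (V, \<psi>) (V', \<psi>'))"
    using atlas_subset_max_atlas[OF M] atlas_subset_max_atlas[OF N] V V'
    by (intro smooth_map_local_rep[OF M N g]) auto
  have sgf: "smooth_on (\<phi> ` W) (local_rep g (V, \<psi>) (V', \<psi>') \<circ> local_rep f (U, \<phi>) (V, \<psi>))"
    using sf sg by (rule smooth_on_compose) (auto simp: W_def local_rep_apply[OF inj(1)])
  have "(local_rep g (V, \<psi>) (V', \<psi>') \<circ> local_rep f (U, \<phi>) (V, \<psi>)) y =
      local_rep (g \<circ> f) (U, \<phi>) (V', \<psi>') y" if "y \<in> \<phi> ` W" for y
    using that by (auto simp: W_def local_rep_apply[OF inj(1)] local_rep_apply[OF inj(2)])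
  with sgf have "smooth_on (\<phi> ` W) (local_rep (g \<circ> f) (U, \<phi>) (V', \<psi>'))"
    by (rule smooth_on_eq)
  then have "smooth_on (\<phi> ` (pts L \<inter> W)) (local_rep (g \<circ> f) (U, \<phi>) (V', \<psi>'))"
    unfolding WL .
  moreover have "p \<in> W" "W \<subseteq> U" "(g \<circ> f) ` (pts L \<inter> W) \<subseteq> V'"
    using U V V' by (auto simp: W_def)
  ultimately show "\<exists>U \<phi> V \<psi> W. (U, \<phi>) \<in> atlas L \<and> (V, \<psi>) \<in> atlas N \<and>
        openin (mtop L) W \<and> p \<in> W \<and> W \<subseteq> U \<and> (g \<circ> f) ` (pts L \<inter> W) \<subseteq> V \<and>
        smooth_on (\<phi> ` (pts L \<inter> W)) (local_rep (g \<circ> f) (U, \<phi>) (V, \<psi>))"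
    using U V' W by blast
qed simp

lemma smooth_map_id:
  assumes M: "smooth_manifold M"
  shows "smooth_map M (pts M) M id"
  unfolding smooth_map_def
proof (intro conjI ballI)
  fix p assume "p \<in> pts M"
  then obtain U \<phi> where U: "(U, \<phi>) \<in> atlas M" "p \<in> U"
    using smooth_manifold_chart_at[OF M] by blast
  have ch: "topological_chart (mtop M) (U, \<phi>)" using M U smooth_manifold_charts by blast
  have U': "pts M \<inter> U = U" "openin (mtop M) U"
    using topological_chart_subset[OF ch] topological_chart_openin[OF ch] by auto
  have "local_rep id (U, \<phi>) (U, \<phi>) y = y" if "y \<in> \<phi> ` U" for y
    using that by (auto simp: local_rep_def f_inv_into_f)
  then have "smooth_on (\<phi> ` U) (local_rep id (U, \<phi>) (U, \<phi>))"
    by (intro smooth_on_eq[OF smooth_on_id]) simp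
  then show "\<exists>U \<phi> V \<psi> W. (U, \<phi>) \<in> atlas M \<and> (V, \<psi>) \<in> atlas M \<and>
        openin (mtop M) W \<and> p \<in> W \<and> W \<subseteq> U \<and> id ` (pts M \<inter> W) \<subseteq> V \<and>
        smooth_on (\<phi> ` (pts M \<inter> W)) (local_rep id (U, \<phi>) (V, \<psi>))"
    using U U'
    by (intro exI[of _ U] exI[of _ \<phi>] conjI) auto
qed auto


section \<open>The group of diffeomorphisms\<close>

lemma Diff_set_permutes: "f \<in> Diff_set M \<Longrightarrow> f permutes pts M"
  by (simp add: Diff_set_def)

lemma Diff_set_bij: "f \<in> Diff_set M \<Longrightarrow> bij f"
  using Diff_set_permutes permutes_bij by blast

lemma permutes_inv_into_eq:
  assumes "f permutes S" "y \<in> S"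
  shows "inv_into S f y = inv_fun f y"
proof (rule inv_into_f_eq)
  show "inj_on f S" using assms(1) permutes_inj_on by blast
  show "inv_fun f y \<in> S" using assms by (simp add: permutes_in_image permutes_inv)
  show "f (inv_fun f y) = y" using assms(1) permutes_inverses(1) by metis
qed

lemma Diff_set_iff:
  assumes M: "smooth_manifold M"
  shows "f \<in> Diff_set M \<longleftrightarrow> f permutes pts M \<and> smooth_map M (pts M) M f \<and>
           smooth_map M (pts M) M (inv_fun f)"
proof -
  have "smooth_map M (pts M) M (inv_into (pts M) f) \<longleftrightarrow> smooth_map M (pts M) M (inv_fun f)"
    if "f permutes pts M"
    using permutes_inv_into_eq[OF that] smooth_map_cong[OF _ smooth_manifold_charts[OF M]] by metis
  then show ?thesis
    by (auto simp: Diff_set_def diffeo_def permutes_imp_bij)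
qed

lemma Diff_set_id: "smooth_manifold M \<Longrightarrow> id \<in> Diff_set M"
  by (simp add: Diff_set_iff smooth_map_id permutes_id)

lemma Diff_set_compose:
  assumes "smooth_manifold M" "f \<in> Diff_set M" "g \<in> Diff_set M"
  shows "g \<circ> f \<in> Diff_set M"
proof -
  have "inv_fun (g \<circ> f) = inv_fun f \<circ> inv_fun g"
    using assms Diff_set_bij o_inv_distrib by blast
  then show ?thesis
    using assms by (simp add: Diff_set_iff permutes_compose smooth_map_compose)
qed

lemma Diff_set_inv:
  assumes "smooth_manifold M" "f \<in> Diff_set M"
  shows "inv_fun f \<in> Diff_set M"
proof -
  have "inv_fun (inv_fun f) = f"
    using Diff_set_bij[OF assms(2)] inv_inv_eq by blast
  then show ?thesis
    using assms by (simp add: Diff_set_iff permutes_inv)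
qed

lemma Diff_set_homeomorphic_map:
  assumes M: "smooth_manifold M" and f: "f \<in> Diff_set M"
  shows "homeomorphic_map (mtop M) (mtop M) f"
proof -
  have "smooth_map M (pts M) M f" "smooth_map M (pts M) M (inv_fun f)" "f permutes pts M"
    using f Diff_set_iff[OF M] by auto
  then have "homeomorphic_maps (mtop M) (mtop M) f (inv_fun f)"
    unfolding homeomorphic_maps_def
    using smooth_map_continuous_map[OF M M] permutes_inverses by metis
  then show ?thesis using homeomorphic_map_maps by blast
qed

text \<open>The transition maps between the transported chart and a chart of the atlas are local
  representations of \<open>f\<close> and of its inverse, which are smooth.\<close>

lemma Diff_set_push_max_atlas:
  assumes M: "smooth_manifold M" and f: "f \<in> Diff_set M" and c: "c \<in> max_atlas M"
  shows "push_chart f c \<in> max_atlas M"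
proof -
  obtain U \<phi> where c': "c = (U, \<phi>)" by (cases c)
  have b: "bij f" using f Diff_set_bij by blast
  then have inj: "inj f" using bij_is_inj by blast
  have sm: "smooth_map M (pts M) M f" "smooth_map M (pts M) M (inv_fun f)"
    using f Diff_set_iff[OF M] by auto
  have ch: "topological_chart (mtop M) (U, \<phi>)" using c c' max_atlas_chart by blast
  have injU: "inj_on \<phi> U" using topological_chart_inj_on[OF ch] .
  have "smooth_transition (push_chart f c) d \<and> smooth_transition d (push_chart f c)"
    if "d \<in> atlas M" for d
  proof
    obtain V \<psi> where d: "d = (V, \<psi>)" by (cases d)
    have dm: "(V, \<psi>) \<in> max_atlas M" using that d atlas_subset_max_atlas[OF M] by blast
    have set1: "(\<phi> \<circ> inv_fun f) ` (f ` U \<inter> V) = \<phi> ` (U \<inter> f -` V)"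
    proof -
      have "f ` U \<inter> V = f ` (U \<inter> f -` V)" by auto
      then show ?thesis using image_push_chart[OF b] by metis
    qed
    have "smooth_on (\<phi> ` (U \<inter> f -` V)) (local_rep f (U, \<phi>) (V, \<psi>))"
      using smooth_map_local_rep[OF M M sm(1)] c c' dm by blast
    then have "smooth_on (\<phi> ` (U \<inter> f -` V)) (\<psi> \<circ> inv_into (f ` U) (\<phi> \<circ> inv_fun f))"
      by (rule smooth_on_eq)
         (auto simp: local_rep_def inv_into_push_chart[OF b injU])
    then show "smooth_transition (push_chart f c) d"
      by (simp only: c' d smooth_transition_def push_chart_def prod.case set1)
    have "inv_fun f -` U = f ` U"
      using b by (simp add: bij_vimage_eq_inv_image bij_imp_bij_inv inv_inv_eq)
    moreover have "smooth_on (\<psi> ` (V \<inter> inv_fun f -` U)) (local_rep (inv_fun f) (V, \<psi>) (U, \<phi>))"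
      using smooth_map_local_rep[OF M M sm(2)] c c' dm by blast
    ultimately show "smooth_transition d (push_chart f c)"
      by (simp add: c' d smooth_transition_def push_chart_def local_rep_def)
  qed
  then show ?thesis
    using topological_chart_push[OF Diff_set_homeomorphic_map[OF M f] b max_atlas_chart[OF c]]
    by (simp add: max_atlas_def)
qed

text \<open>A chart exhibiting \<open>p\<close> as a boundary point is transported to a chart with the same image
  that exhibits \<open>f p\<close> as a boundary point; the same applies to the inverse of \<open>f\<close>.\<close>

lemma Diff_set_image_boundary:
  assumes M: "smooth_manifold M" and f: "f \<in> Diff_set M"
  shows "f ` boundary M = boundary M"
proof -
  have sub: "g ` boundary M \<subseteq> boundary M" if g: "g \<in> Diff_set M" for g
  proof clarify
    fix p assume "p \<in> boundary M"
    then obtain U \<phi> b where c: "(U, \<phi>) \<in> max_atlas M" "p \<in> U" "b \<noteq> 0"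
        "openin (top_of_set (half_space b)) (\<phi> ` U)" "b \<bullet> \<phi> p = 0"
      unfolding boundary_def by blast
    have b: "bij g" using g Diff_set_bij by blast
    have "(g ` U, \<phi> \<circ> inv_fun g) \<in> max_atlas M"
      using Diff_set_push_max_atlas[OF M g c(1)] by (simp add: push_chart_def)
    moreover have "openin (top_of_set (half_space b)) ((\<phi> \<circ> inv_fun g) ` g ` U)"
      using c(4) image_push_chart[OF b] by metis
    moreover have "b \<bullet> (\<phi> \<circ> inv_fun g) (g p) = 0"
      using c(5) b by (simp add: bij_is_inj)
    ultimately show "g p \<in> boundary M"
      unfolding boundary_def using c(2,3) by blast
  qed
  have "inv_fun f ` boundary M \<subseteq> boundary M" using sub Diff_set_inv[OF M f] by blast
  then have "f ` inv_fun f ` boundary M \<subseteq> f ` boundary M" by blast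
  then show ?thesis
    using sub[OF f] Diff_set_bij[OF f] by (metis bij_is_surj image_f_inv_f subset_antisym)
qed

lemma homeomorphic_map_components_in:
  assumes "homeomorphic_map (mtop M) (mtop M) f" "inj f" "f ` S = S"
  shows "image f ` components_in M S = components_in M S"
proof -
  have "homeomorphic_map (subtopology (mtop M) S) (subtopology (mtop M) S) f"
    by (rule homeomorphic_map_subtopologies_alt[OF assms(1)])
       (use assms(2,3) in \<open>metis inj_image_mem_iff\<close>)
  then show ?thesis
    unfolding components_in_def using homeomorphic_map_connected_components_of by metis
qed


section \<open>Orientation-preserving diffeomorphisms\<close>

text \<open>At each point of the half-space, one of the opposite coordinate directions \<open>i\<close> and \<open>- i\<close>
  does not lead out of it, and difference quotients in that direction determine the value of the
  derivative at \<open>i\<close>.\<close>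

lemma half_space_derivative_unique:
  fixes f :: "'e::euclidean_space \<Rightarrow> 'f::real_normed_vector"
  assumes S: "openin (top_of_set (half_space b)) S" "x \<in> S"
    and D: "(f has_derivative D) (at x within S)" and D': "(f has_derivative D') (at x within S)"
  shows "D = D'"
proof (rule frechet_derivative_unique_within[OF D D'])
  fix i :: 'e and e :: real
  assume i: "i \<in> Basis" and e: "e > 0"
  obtain O' where O': "open O'" "S = half_space b \<inter> O'"
    using S(1) by (auto simp: openin_open)
  then obtain r where r: "r > 0" "ball x r \<subseteq> O'"
    using S(2) open_contains_ball by blast
  \<comment> \<open>The sign is chosen such that a step from \<open>x\<close> along \<open>t *\<^sub>R i\<close> does not decrease \<open>b \<bullet> x\<close>.\<close>
  define t where "t = (if b \<bullet> i \<ge> 0 then 1 else -1) * (min e r / 2)"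
  have t: "0 < \<bar>t\<bar>" "\<bar>t\<bar> < e" "\<bar>t\<bar> < r"
    using e r by (auto simp: t_def abs_mult)
  have "t * (b \<bullet> i) \<ge> 0"
    using e r by (auto simp: t_def zero_le_mult_iff mult_le_0_iff)
  then have "x + t *\<^sub>R i \<in> half_space b"
    using S(2) O'(2) by (simp add: half_space_def inner_add_right)
  moreover have "x + t *\<^sub>R i \<in> ball x r"
    using t i by (simp add: dist_norm)
  ultimately show "\<exists>d. 0 < \<bar>d\<bar> \<and> \<bar>d\<bar> < e \<and> x + d *\<^sub>R i \<in> S"
    using t r O' by blast
qed

abbreviation local_derivative ::
  "('a \<Rightarrow> 'a) \<Rightarrow> ('a, 'e::euclidean_space) chart \<Rightarrow> ('a, 'e) chart \<Rightarrow> 'a \<Rightarrow> 'e \<Rightarrow> 'e" where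
  "local_derivative f c d p \<equiv>
     frechet_derivative (local_rep f c d) (at (snd c p) within snd c ` (fst c \<inter> f -` fst d))"

lemma local_derivative_works:
  assumes M: "smooth_manifold M" and f: "smooth_map M (pts M) M f"
    and c: "(U, \<phi>) \<in> max_atlas M" and d: "(V, \<psi>) \<in> max_atlas M" and p: "p \<in> U" "f p \<in> V"
  shows "(local_rep f (U, \<phi>) (V, \<psi>) has_derivative local_derivative f (U, \<phi>) (V, \<psi>) p)
           (at (\<phi> p) within \<phi> ` (U \<inter> f -` V))"
  using smooth_on_has_derivative[OF smooth_map_local_rep[OF M M f c d]] p by auto

text \<open>The three derivatives are taken within different sets. All of them restrict to the image of
  the set \<open>W\<close> of points where all the local representations are defined, which is relatively
  open in a half-space, so that the chain rule there determines the derivative.\<close>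

lemma local_derivative_compose:
  assumes M: "smooth_manifold M"
    and f: "smooth_map M (pts M) M f" and g: "smooth_map M (pts M) M g"
    and c: "(U, \<phi>) \<in> max_atlas M" and d: "(V, \<psi>) \<in> max_atlas M"
    and e: "(V', \<psi>') \<in> max_atlas M"
    and p: "p \<in> U" "f p \<in> V" "g (f p) \<in> V'"
  shows "local_derivative (g \<circ> f) (U, \<phi>) (V', \<psi>') p =
           local_derivative g (V, \<psi>) (V', \<psi>') (f p) \<circ> local_derivative f (U, \<phi>) (V, \<psi>) p"
proof -
  let ?f = "local_rep f (U, \<phi>) (V, \<psi>)" and ?g = "local_rep g (V, \<psi>) (V', \<psi>')"
  let ?gf = "local_rep (g \<circ> f) (U, \<phi>) (V', \<psi>')"
  let ?A = "local_derivative f (U, \<phi>) (V, \<psi>) p" and ?B = "local_derivative g (V, \<psi>) (V', \<psi>') (f p)"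
  have ch: "topological_chart (mtop M) (U, \<phi>)" "topological_chart (mtop M) (V, \<psi>)"
      "topological_chart (mtop M) (V', \<psi>')"
    using c d e max_atlas_chart by blast+
  have inj: "inj_on \<phi> U" "inj_on \<psi> V" using ch topological_chart_inj_on by blast+
  have gf: "smooth_map M (pts M) M (g \<circ> f)" using smooth_map_compose[OF M M M f g] .
  define W where "W = U \<inter> f -` V \<inter> (g \<circ> f) -` V'"
  have W: "openin (mtop M) W" unfolding W_def
    using ch[THEN topological_chart_openin] smooth_map_continuous_map[OF M M f]
      smooth_map_continuous_map[OF M M gf] by (intro openin_chart_preimage) auto
  have WU: "W \<subseteq> U" "\<phi> p \<in> \<phi> ` W" using p by (auto simp: W_def)
  obtain b where b: "openin (top_of_set (half_space b)) (\<phi> ` W)"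
    using topological_chart_open_image_half_space[OF ch(1) W WU(1)] by blast
  have fp: "?f (\<phi> p) = \<psi> (f p)" using p by (simp add: local_rep_apply[OF inj(1)])
  have 1: "(?f has_derivative ?A) (at (\<phi> p) within \<phi> ` W)"
    using local_derivative_works[OF M f c d p(1,2)]
    by (rule has_derivative_subset) (auto simp: W_def)
  have "(?g has_derivative ?B) (at (?f (\<phi> p)) within \<psi> ` (V \<inter> g -` V'))"
    using local_derivative_works[OF M g d e p(2,3)] fp by simp
  then have 2: "(?g has_derivative ?B) (at (?f (\<phi> p)) within ?f ` \<phi> ` W)"
    by (rule has_derivative_subset) (auto simp: W_def local_rep_apply[OF inj(1)])
  have "(?g \<circ> ?f has_derivative ?B \<circ> ?A) (at (\<phi> p) within \<phi> ` W)"
    using diff_chain_within[OF 1 2] .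
  moreover have "(?g \<circ> ?f) y = ?gf y" if "y \<in> \<phi> ` W" for y
    using that by (auto simp: W_def local_rep_apply[OF inj(1)] local_rep_apply[OF inj(2)])
  ultimately have 3: "(?gf has_derivative ?B \<circ> ?A) (at (\<phi> p) within \<phi> ` W)"
    using has_derivative_within_cong[of "\<phi> ` W" "?g \<circ> ?f" ?gf] WU(2) by blast
  have "(g \<circ> f) p \<in> V'" using p by simp
  have "(?gf has_derivative local_derivative (g \<circ> f) (U, \<phi>) (V', \<psi>') p) (at (\<phi> p) within \<phi> ` W)"
    using local_derivative_works[OF M gf c e p(1) \<open>(g \<circ> f) p \<in> V'\<close>]
    by (rule has_derivative_subset) (auto simp: W_def)
  then show ?thesis
    using 3 by (rule half_space_derivative_unique[OF b WU(2)])
qed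

lemma orientation_preserving_iff:
  "orientation_preserving Ori f \<longleftrightarrow>
     (\<forall>U \<phi> V \<psi> p. (U, \<phi>) \<in> Ori \<longrightarrow> (V, \<psi>) \<in> Ori \<longrightarrow> p \<in> U \<longrightarrow> f p \<in> V \<longrightarrow>
        det (matrix (local_derivative f (U, \<phi>) (V, \<psi>) p)) > 0)"
  unfolding orientation_preserving_def Ball_def split_paired_All by auto

lemma orientation_preservingD:
  assumes "orientation_preserving Ori f" "(U, \<phi>) \<in> Ori" "(V, \<psi>) \<in> Ori" "p \<in> U" "f p \<in> V"
  shows "det (matrix (local_derivative f (U, \<phi>) (V, \<psi>) p)) > 0"
  using assms unfolding orientation_preserving_iff by blast

lemma orientation_preserving_id: "orientation M Ori \<Longrightarrow> orientation_preserving Ori id"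
  unfolding orientation_def orientation_preserving_def by (auto simp: id_def)

lemma orientation_chart_at:
  assumes "orientation M Ori" "p \<in> pts M"
  obtains U \<phi> where "(U, \<phi>) \<in> Ori" "p \<in> U"
proof -
  have "p \<in> (\<Union>c\<in>Ori. fst c)" using assms by (simp add: orientation_def)
  then obtain c where "c \<in> Ori" "p \<in> fst c" by blast
  then show ?thesis using that[of "fst c" "snd c"] by simp
qed

lemma det_local_derivative_compose:
  fixes M :: "('a, real^'n) smfd"
  assumes M: "smooth_manifold M"
    and f: "smooth_map M (pts M) M f" and g: "smooth_map M (pts M) M g"
    and c: "(U, \<phi>) \<in> max_atlas M" and d: "(V, \<psi>) \<in> max_atlas M"
    and e: "(V', \<psi>') \<in> max_atlas M"
    and p: "p \<in> U" "f p \<in> V" "g (f p) \<in> V'"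
  shows "det (matrix (local_derivative (g \<circ> f) (U, \<phi>) (V', \<psi>') p)) =
         det (matrix (local_derivative g (V, \<psi>) (V', \<psi>') (f p))) *
         det (matrix (local_derivative f (U, \<phi>) (V, \<psi>) p))"
proof -
  have "linear (local_derivative f (U, \<phi>) (V, \<psi>) p)"
       "linear (local_derivative g (V, \<psi>) (V', \<psi>') (f p))"
    using local_derivative_works[OF M f c d p(1,2)] local_derivative_works[OF M g d e p(2,3)]
      has_derivative_linear by blast+
  then show ?thesis
    unfolding local_derivative_compose[OF assms] by (simp add: matrix_compose det_mul)
qed

lemma orientation_preserving_compose:
  assumes M: "smooth_manifold M" and Ori: "orientation M Ori"
    and f: "smooth_map M (pts M) M f" and g: "smooth_map M (pts M) M g"
    and of: "orientation_preserving Ori f" and og: "orientation_preserving Ori g"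
  shows "orientation_preserving Ori (g \<circ> f)"
  unfolding orientation_preserving_iff
proof (clarify)
  fix U \<phi> V' \<psi>' p
  assume c: "(U, \<phi>) \<in> Ori" "(V', \<psi>') \<in> Ori" "p \<in> U" "(g \<circ> f) p \<in> V'"
  have sub: "Ori \<subseteq> max_atlas M" using Ori by (simp add: orientation_def)
  have "topological_chart (mtop M) (U, \<phi>)" using c(1) sub max_atlas_chart by blast
  then have "p \<in> pts M" using topological_chart_subset c(3) by blast
  then have "f p \<in> pts M" using f by (auto simp: smooth_map_def)
  then obtain V \<psi> where d: "(V, \<psi>) \<in> Ori" "f p \<in> V"
    using orientation_chart_at[OF Ori] by blast
  have "det (matrix (local_derivative g (V, \<psi>) (V', \<psi>') (f p))) > 0"
       "det (matrix (local_derivative f (U, \<phi>) (V, \<psi>) p)) > 0"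
    using orientation_preservingD[OF og d(1) c(2) d(2)] orientation_preservingD[OF of c(1) d(1) c(3) d(2)]
      c(4) by simp_all
  moreover have "det (matrix (local_derivative (g \<circ> f) (U, \<phi>) (V', \<psi>') p)) =
         det (matrix (local_derivative g (V, \<psi>) (V', \<psi>') (f p))) *
         det (matrix (local_derivative f (U, \<phi>) (V, \<psi>) p))"
    using c d sub by (intro det_local_derivative_compose[OF M f g]) auto
  ultimately show "det (matrix (local_derivative (g \<circ> f) (U, \<phi>) (V', \<psi>') p)) > 0"
    by (metis mult_pos_pos)
qed

text \<open>The Jacobian determinants of \<open>f\<close> and of its inverse have product that of the
  identity, which is positive as the charts in \<open>Ori\<close> are compatibly oriented.\<close>

lemma orientation_preserving_inv:
  assumes M: "smooth_manifold M" and Ori: "orientation M Ori" and "bij f"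
    and f: "smooth_map M (pts M) M f" and g: "smooth_map M (pts M) M (inv_fun f)"
    and of: "orientation_preserving Ori f"
  shows "orientation_preserving Ori (inv_fun f)"
  unfolding orientation_preserving_iff
proof (clarify)
  fix V \<psi> U \<phi> p
  assume c: "(V, \<psi>) \<in> Ori" "(U, \<phi>) \<in> Ori" "p \<in> V" "inv_fun f p \<in> U"
  define q where "q = inv_fun f p"
  have fq: "f q = p" using \<open>bij f\<close> by (simp add: q_def bij_is_surj surj_f_inv_f)
  have comp: "inv_fun f \<circ> f = id" using \<open>bij f\<close> by (simp add: bij_is_inj)
  have sub: "Ori \<subseteq> max_atlas M" using Ori by (simp add: orientation_def)
  have "det (matrix (local_derivative (inv_fun f \<circ> f) (U, \<phi>) (U, \<phi>) q)) =
         det (matrix (local_derivative (inv_fun f) (V, \<psi>) (U, \<phi>) (f q))) *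
         det (matrix (local_derivative f (U, \<phi>) (V, \<psi>) q))"
    using c fq sub by (intro det_local_derivative_compose[OF M f g]) (auto simp: q_def)
  moreover have "det (matrix (local_derivative (inv_fun f \<circ> f) (U, \<phi>) (U, \<phi>) q)) > 0"
    unfolding comp using c
    by (intro orientation_preservingD[OF orientation_preserving_id[OF Ori]]) (auto simp: q_def)
  moreover have "det (matrix (local_derivative f (U, \<phi>) (V, \<psi>) q)) > 0"
    using c fq by (intro orientation_preservingD[OF of]) (auto simp: q_def)
  ultimately show "det (matrix (local_derivative (inv_fun f) (V, \<psi>) (U, \<phi>) p)) > 0"
    unfolding fq by (metis zero_less_mult_pos2)
qed

lemma Diff_plus_id:
  "smooth_manifold M \<Longrightarrow> orientation M Ori \<Longrightarrow> id \<in> Diff_plus M Ori"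
  by (simp add: Diff_plus_def Diff_set_id orientation_preserving_id)

lemma Diff_plus_compose:
  assumes "smooth_manifold M" "orientation M Ori" "f \<in> Diff_plus M Ori" "g \<in> Diff_plus M Ori"
  shows "g \<circ> f \<in> Diff_plus M Ori"
  using assms Diff_set_compose orientation_preserving_compose
  unfolding Diff_plus_def mem_Collect_eq by (metis Diff_set_iff)

lemma Diff_plus_inv:
  assumes "smooth_manifold M" "orientation M Ori" "f \<in> Diff_plus M Ori"
  shows "inv_fun f \<in> Diff_plus M Ori"
  using assms Diff_set_inv orientation_preserving_inv Diff_set_bij
  unfolding Diff_plus_def mem_Collect_eq by (metis Diff_set_iff)

lemma Diff_plus_T_id:
  "smooth_manifold M \<Longrightarrow> orientation M Ori \<Longrightarrow> id \<in> Diff_plus_T M Ori T"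
  by (simp add: Diff_plus_T_def Diff_plus_id)

lemma Diff_plus_T_compose:
  assumes "smooth_manifold M" "orientation M Ori" "f \<in> Diff_plus_T M Ori T" "g \<in> Diff_plus_T M Ori T"
  shows "g \<circ> f \<in> Diff_plus_T M Ori T"
  using assms(3,4) Diff_plus_compose[OF assms(1,2)] image_comp[of g f T]
  unfolding Diff_plus_T_def mem_Collect_eq by metis

lemma Diff_plus_T_Diff_set: "f \<in> Diff_plus_T M Ori T \<Longrightarrow> f \<in> Diff_set M"
  by (simp add: Diff_plus_T_def Diff_plus_def)

lemma Diff_plus_T_inv:
  assumes "smooth_manifold M" "orientation M Ori" "f \<in> Diff_plus_T M Ori T"
  shows "inv_fun f \<in> Diff_plus_T M Ori T"
proof -
  have "inv_fun f ` T = inv_fun f ` f ` T" using assms(3) by (simp add: Diff_plus_T_def)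
  also have "\<dots> = T"
    using Diff_set_bij[OF Diff_plus_T_Diff_set[OF assms(3)]] by (simp add: bij_is_inj image_inv_f_f)
  finally show ?thesis
    using Diff_plus_inv[OF assms(1,2)] assms(3) by (simp add: Diff_plus_T_def)
qed

lemma group_comp_group:
  assumes "id \<in> D" "\<And>f g. f \<in> D \<Longrightarrow> g \<in> D \<Longrightarrow> f \<circ> g \<in> D"
    and "\<And>f. f \<in> D \<Longrightarrow> bij f \<and> inv_fun f \<in> D"
  shows "group (comp_group D)"
proof (rule groupI)
  fix f assume "f \<in> carrier (comp_group D)"
  then have "bij f" "inv_fun f \<in> D" using assms(3) by (auto simp: comp_group_def)
  then show "\<exists>g\<in>carrier (comp_group D). g \<otimes>\<^bsub>comp_group D\<^esub> f = \<one>\<^bsub>comp_group D\<^esub>"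
    by (intro bexI[of _ "inv_fun f"]) (auto simp: comp_group_def bij_is_inj)
qed (use assms in \<open>auto simp: comp_group_def o_assoc\<close>)

lemma group_Diff_plus_T:
  assumes "smooth_manifold M" "orientation M Ori"
  shows "group (comp_group (Diff_plus_T M Ori T))"
  using Diff_plus_T_id[OF assms] Diff_plus_T_compose[OF assms] Diff_plus_T_inv[OF assms]
    Diff_set_bij[OF Diff_plus_T_Diff_set]
  by (intro group_comp_group) blast+


section \<open>Translations and evaluations in the smooth topology\<close>

text \<open>The subbasic neighbourhoods are formulated in terms of arbitrary charts of the maximal
  atlas, so composition with a diffeomorphism carries them to neighbourhoods of the same kind,
  in transported charts.\<close>

lemma Cinf_nbhd_push_domain:
  assumes g: "bij g" and U: "inj_on \<phi> U" "Q \<subseteq> U" and h: "h \<in> Diff_set M" "h \<circ> g \<in> Diff_set M"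
  shows "h \<in> Cinf_nbhd M (f \<circ> inv_fun g) (push_chart g (U, \<phi>)) d (g ` Q) r \<epsilon> \<longleftrightarrow>
         h \<circ> g \<in> Cinf_nbhd M f (U, \<phi>) d Q r \<epsilon>"
proof -
  obtain V \<psi> where d: "d = (V, \<psi>)" by (cases d)
  have inj: "inj g" using g bij_is_inj by blast
  have "iter_deriv (\<phi> ` U) vs (local_rep k (g ` U, \<phi> \<circ> inv_fun g) d) (\<phi> p) =
        iter_deriv (\<phi> ` U) vs (local_rep (k \<circ> g) (U, \<phi>) d) (\<phi> p)" if "p \<in> Q" for p k vs
    using local_rep_push_domain[OF g U(1), of _ k d] that U(2)
    by (intro iter_deriv_cong) (auto simp: push_chart_def)
  moreover have "f \<circ> inv_fun g \<circ> g = f" using inj by (simp add: comp_assoc)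
  moreover have "(\<phi> \<circ> inv_fun g) ` g ` U = \<phi> ` U" using image_push_chart[OF g] .
  moreover have "(\<phi> \<circ> inv_fun g) (g p) = \<phi> p" for p using inj by simp
  ultimately show ?thesis
    using h unfolding Cinf_nbhd_def push_chart_def d prod.case mem_Collect_eq ball_simps
    by (simp only: image_comp[symmetric]) (simp add: image_comp)
qed

lemma Cinf_nbhd_push_codomain:
  assumes g: "bij g" and h: "h \<in> Diff_set M" "g \<circ> h \<in> Diff_set M"
  shows "h \<in> Cinf_nbhd M (inv_fun g \<circ> f) c (push_chart (inv_fun g) d) Q r \<epsilon> \<longleftrightarrow>
         g \<circ> h \<in> Cinf_nbhd M f c d Q r \<epsilon>"
proof -
  obtain U \<phi> where c: "c = (U, \<phi>)" by (cases c)
  obtain V \<psi> where d: "d = (V, \<psi>)" by (cases d)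
  have gg: "g \<circ> inv_fun g = id" using bij_is_surj[OF g] surj_iff by blast
  have ii: "inv_fun (inv_fun g) = g" using g by (rule inv_inv_eq)
  have "local_rep k c (push_chart (inv_fun g) d) = local_rep (g \<circ> k) c d" for k
    using local_rep_push_codomain[of k c "inv_fun g" d] ii by simp
  moreover have "g \<circ> (inv_fun g \<circ> f) = f" using gg by (metis comp_assoc id_comp)
  moreover have "h ` Q \<subseteq> inv_fun g ` V \<longleftrightarrow> (g \<circ> h) ` Q \<subseteq> V"
  proof -
    have "inv_fun g ` V = g -` V" using g by (simp add: bij_vimage_eq_inv_image)
    then show ?thesis by auto
  qed
  ultimately show ?thesis
    using h by (simp add: Cinf_nbhd_def push_chart_def c d)
qed

definition Cinf_subbasis :: "('a, 'e::euclidean_space) smfd \<Rightarrow> ('a \<Rightarrow> 'a) set set" where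
  "Cinf_subbasis M = {Cinf_nbhd M f (U, \<phi>) (V, \<psi>) Q r \<epsilon> | f U \<phi> V \<psi> Q r \<epsilon>.
        f \<in> Diff_set M \<and> (U, \<phi>) \<in> max_atlas M \<and> (V, \<psi>) \<in> max_atlas M \<and>
        compactin (mtop M) Q \<and> Q \<subseteq> U \<and> f ` Q \<subseteq> V \<and> \<epsilon> > 0}"

lemma Cinf_subbasis_subset: "N \<in> Cinf_subbasis M \<Longrightarrow> N \<subseteq> Diff_set M"
  by (auto simp: Cinf_subbasis_def Cinf_nbhd_def)

lemma Cinf_subbasisI:
  assumes "f \<in> Diff_set M" "c \<in> max_atlas M" "d \<in> max_atlas M"
    and "compactin (mtop M) Q" "Q \<subseteq> fst c" "f ` Q \<subseteq> fst d" "\<epsilon> > 0"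
  shows "Cinf_nbhd M f c d Q r \<epsilon> \<in> Cinf_subbasis M"
  unfolding Cinf_subbasis_def mem_Collect_eq using assms
  by (intro exI[of _ f] exI[of _ "fst c"] exI[of _ "snd c"] exI[of _ "fst d"] exI[of _ "snd d"]
      exI[of _ Q] exI[of _ r] exI[of _ \<epsilon>]) simp

lemma Cinf_subbasisE:
  assumes "N \<in> Cinf_subbasis M"
  obtains f U \<phi> V \<psi> Q r \<epsilon> where "N = Cinf_nbhd M f (U, \<phi>) (V, \<psi>) Q r \<epsilon>"
    "f \<in> Diff_set M" "(U, \<phi>) \<in> max_atlas M" "(V, \<psi>) \<in> max_atlas M"
    "compactin (mtop M) Q" "Q \<subseteq> U" "f ` Q \<subseteq> V" "\<epsilon> > 0"
  using assms unfolding Cinf_subbasis_def mem_Collect_eq by metis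

lemma Cinf_nbhd_self:
  assumes "f \<in> Diff_set M" "f ` Q \<subseteq> fst d" "\<epsilon> > 0"
  shows "f \<in> Cinf_nbhd M f c d Q r \<epsilon>"
  using assms by (cases c, cases d) (simp add: Cinf_nbhd_def)

lemma Cinf_top_alt: "Cinf_top M = topology_generated_by (Cinf_subbasis M)"
  by (simp add: Cinf_top_def Cinf_subbasis_def)

lemma topspace_Cinf_top:
  assumes M: "smooth_manifold M" and "pts M \<noteq> {}"
  shows "topspace (Cinf_top M) = Diff_set M"
proof -
  obtain p where "p \<in> pts M" using assms(2) by blast
  then obtain U \<phi> where "(U, \<phi>) \<in> atlas M" using smooth_manifold_chart_at[OF M] by blast
  then have c: "(U, \<phi>) \<in> max_atlas M" using atlas_subset_max_atlas[OF M] by blast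
  have "f \<in> \<Union>(Cinf_subbasis M)" if f: "f \<in> Diff_set M" for f
  proof (rule UnionI)
    \<comment> \<open>For the empty compact set all conditions are vacuous.\<close>
    show "Cinf_nbhd M f (U, \<phi>) (U, \<phi>) {} 0 1 \<in> Cinf_subbasis M"
      using f c by (intro Cinf_subbasisI) auto
    show "f \<in> Cinf_nbhd M f (U, \<phi>) (U, \<phi>) {} 0 1"
      using f by (intro Cinf_nbhd_self) auto
  qed
  moreover have "\<Union>(Cinf_subbasis M) \<subseteq> Diff_set M"
    using Cinf_subbasis_subset by (intro Union_least) blast
  ultimately show ?thesis
    unfolding Cinf_top_alt topology_generated_by_topspace by (intro subset_antisym subsetI) auto
qed

lemma openin_Cinf_top: "N \<in> Cinf_subbasis M \<Longrightarrow> openin (Cinf_top M) N"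
  unfolding Cinf_top_alt by (rule topology_generated_by_Basis)

text \<open>Continuity may be tested on the subbasis; for translations the preimage of a subbasic set is
  again subbasic, not merely open.\<close>

lemma Cinf_top_continuousI:
  assumes M: "smooth_manifold M" and ne: "pts M \<noteq> {}"
    and maps: "\<And>h. h \<in> Diff_set M \<Longrightarrow> F h \<in> Diff_set M"
    and pre: "\<And>N. N \<in> Cinf_subbasis M \<Longrightarrow>
                \<exists>N'\<in>Cinf_subbasis M. \<forall>h\<in>Diff_set M. h \<in> N' \<longleftrightarrow> F h \<in> N"
  shows "continuous_map (Cinf_top M) (Cinf_top M) F"
proof -
  have top: "topspace (Cinf_top M) = Diff_set M" using topspace_Cinf_top[OF M ne] .
  have "continuous_map (Cinf_top M) (topology_generated_by (Cinf_subbasis M)) F"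
  proof (rule continuous_on_generated_topo)
    fix N assume "N \<in> Cinf_subbasis M"
    then obtain N' where N': "N' \<in> Cinf_subbasis M" "\<forall>h\<in>Diff_set M. h \<in> N' \<longleftrightarrow> F h \<in> N"
      using pre by blast
    then have "F -` N \<inter> topspace (Cinf_top M) = N'"
      using Cinf_subbasis_subset[OF N'(1)] unfolding top by auto
    then show "openin (Cinf_top M) (F -` N \<inter> topspace (Cinf_top M))"
      using openin_Cinf_top[OF N'(1)] by simp
  next
    have "\<Union>(Cinf_subbasis M) = Diff_set M"
      using top unfolding Cinf_top_alt topology_generated_by_topspace .
    then show "F ` topspace (Cinf_top M) \<subseteq> \<Union>(Cinf_subbasis M)"
      using maps top by auto
  qed
  then show ?thesis unfolding Cinf_top_alt .
qed

lemma Cinf_top_right_translation: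
  assumes M: "smooth_manifold M" and ne: "pts M \<noteq> {}" and g: "g \<in> Diff_set M"
  shows "continuous_map (Cinf_top M) (Cinf_top M) (\<lambda>h. h \<circ> g)"
proof (rule Cinf_top_continuousI[OF M ne])
  fix h assume "h \<in> Diff_set M"
  then show "h \<circ> g \<in> Diff_set M" using Diff_set_compose[OF M g] by blast
next
  fix N assume "N \<in> Cinf_subbasis M"
  then obtain f U \<phi> V \<psi> Q r \<epsilon> where N: "N = Cinf_nbhd M f (U, \<phi>) (V, \<psi>) Q r \<epsilon>"
    and f: "f \<in> Diff_set M" and c: "(U, \<phi>) \<in> max_atlas M" and d: "(V, \<psi>) \<in> max_atlas M"
    and Q: "compactin (mtop M) Q" "Q \<subseteq> U" "f ` Q \<subseteq> V" and \<epsilon>: "\<epsilon> > 0"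
    by (rule Cinf_subbasisE)
  have b: "bij g" using Diff_set_bij[OF g] .
  let ?N = "Cinf_nbhd M (f \<circ> inv_fun g) (push_chart g (U, \<phi>)) (V, \<psi>) (g ` Q) r \<epsilon>"
  have "?N \<in> Cinf_subbasis M"
  proof (rule Cinf_subbasisI)
    show "f \<circ> inv_fun g \<in> Diff_set M" using Diff_set_compose[OF M Diff_set_inv[OF M g] f] .
    show "push_chart g (U, \<phi>) \<in> max_atlas M" using Diff_set_push_max_atlas[OF M g c] .
    show "compactin (mtop M) (g ` Q)"
      using image_compactin[OF Q(1)] Diff_set_homeomorphic_map[OF M g]
        homeomorphic_imp_continuous_map by blast
    show "g ` Q \<subseteq> fst (push_chart g (U, \<phi>))" using Q(2) by (auto simp: push_chart_def)
    show "(f \<circ> inv_fun g) ` g ` Q \<subseteq> fst (V, \<psi>)"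
      using Q(3) b by (auto simp: bij_is_inj)
  qed (use d \<epsilon> in auto)
  moreover have "h \<in> ?N \<longleftrightarrow> h \<circ> g \<in> N" if h: "h \<in> Diff_set M" for h
    unfolding N
    by (rule Cinf_nbhd_push_domain[OF b topological_chart_inj_on[OF max_atlas_chart[OF c]] Q(2) h
          Diff_set_compose[OF M g h]])
  ultimately show "\<exists>N'\<in>Cinf_subbasis M. \<forall>h\<in>Diff_set M. h \<in> N' \<longleftrightarrow> h \<circ> g \<in> N"
    by blast
qed

lemma Cinf_top_left_translation:
  assumes M: "smooth_manifold M" and ne: "pts M \<noteq> {}" and g: "g \<in> Diff_set M"
  shows "continuous_map (Cinf_top M) (Cinf_top M) (\<lambda>h. g \<circ> h)"
proof (rule Cinf_top_continuousI[OF M ne])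
  fix h assume "h \<in> Diff_set M"
  then show "g \<circ> h \<in> Diff_set M" using Diff_set_compose[OF M _ g] by blast
next
  fix N assume "N \<in> Cinf_subbasis M"
  then obtain f U \<phi> V \<psi> Q r \<epsilon> where N: "N = Cinf_nbhd M f (U, \<phi>) (V, \<psi>) Q r \<epsilon>"
    and f: "f \<in> Diff_set M" and c: "(U, \<phi>) \<in> max_atlas M" and d: "(V, \<psi>) \<in> max_atlas M"
    and Q: "compactin (mtop M) Q" "Q \<subseteq> U" "f ` Q \<subseteq> V" and \<epsilon>: "\<epsilon> > 0"
    by (rule Cinf_subbasisE)
  have b: "bij g" using Diff_set_bij[OF g] .
  have ig: "inv_fun g \<in> Diff_set M" using Diff_set_inv[OF M g] .
  let ?N = "Cinf_nbhd M (inv_fun g \<circ> f) (U, \<phi>) (push_chart (inv_fun g) (V, \<psi>)) Q r \<epsilon>"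
  have "?N \<in> Cinf_subbasis M"
  proof (rule Cinf_subbasisI)
    show "inv_fun g \<circ> f \<in> Diff_set M" using Diff_set_compose[OF M f ig] .
    show "push_chart (inv_fun g) (V, \<psi>) \<in> max_atlas M" using Diff_set_push_max_atlas[OF M ig d] .
    show "(inv_fun g \<circ> f) ` Q \<subseteq> fst (push_chart (inv_fun g) (V, \<psi>))"
      using Q(3) by (auto simp: push_chart_def)
  qed (use c Q \<epsilon> in auto)
  moreover have "h \<in> ?N \<longleftrightarrow> g \<circ> h \<in> N" if h: "h \<in> Diff_set M" for h
    unfolding N by (rule Cinf_nbhd_push_codomain[OF b h Diff_set_compose[OF M h g]])
  ultimately show "\<exists>N'\<in>Cinf_subbasis M. \<forall>h\<in>Diff_set M. h \<in> N' \<longleftrightarrow> g \<circ> h \<in> N"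
    by blast
qed

text \<open>Shrink the domain of a chart around \<open>f p\<close> to the given open set: the members \<open>g\<close> of the
  subbasic neighbourhood for the compact set \<open>{p}\<close> and this chart send \<open>p\<close> into it.\<close>

lemma Cinf_top_evaluation:
  assumes M: "smooth_manifold M" and p: "p \<in> pts M"
  shows "continuous_map (Cinf_top M) (mtop M) (\<lambda>f. f p)"
  unfolding continuous_map
proof (intro conjI allI impI)
  have top: "topspace (Cinf_top M) = Diff_set M" using topspace_Cinf_top[OF M] p by blast
  show "(\<lambda>f. f p) ` topspace (Cinf_top M) \<subseteq> pts M"
    unfolding top using p Diff_set_permutes permutes_in_image by fastforce
  fix O' assume O': "openin (mtop M) O'"
  let ?P = "{f \<in> topspace (Cinf_top M). f p \<in> O'}"
  show "openin (Cinf_top M) ?P"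
  proof (subst openin_subopen, intro ballI)
    fix f assume "f \<in> ?P"
    then have f: "f \<in> Diff_set M" "f p \<in> O'" unfolding top by auto
    have "f p \<in> pts M" using f(2) O' openin_subset by blast
    then obtain V \<psi> where V: "(V, \<psi>) \<in> atlas M" "f p \<in> V"
      using smooth_manifold_chart_at[OF M] by blast
    obtain U \<phi> where U: "(U, \<phi>) \<in> atlas M" "p \<in> U"
      using smooth_manifold_chart_at[OF M p] .
    \<comment> \<open>The order \<open>0\<close> and the bound \<open>1\<close> are arbitrary.\<close>
    let ?N = "Cinf_nbhd M f (U, \<phi>) (V \<inter> O', \<psi>) {p} 0 1"
    have N: "?N \<in> Cinf_subbasis M"
    proof (rule Cinf_subbasisI[OF f(1)])
      show "(U, \<phi>) \<in> max_atlas M" using U atlas_subset_max_atlas[OF M] by blast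
      show "(V \<inter> O', \<psi>) \<in> max_atlas M"
        using V atlas_subset_max_atlas[OF M] max_atlas_restrict[OF _ O'] by blast
    qed (use p U V f in auto)
    have "f \<in> ?N" using f V by (intro Cinf_nbhd_self) auto
    moreover have "?N \<subseteq> ?P" unfolding top by (auto simp: Cinf_nbhd_def)
    ultimately show "\<exists>T. openin (Cinf_top M) T \<and> f \<in> T \<and> T \<subseteq> ?P"
      using openin_Cinf_top[OF N] by blast
  qed
qed


section \<open>Local topology of manifolds\<close>

lemma locally_connected_convex_open:
  fixes S :: "'e::euclidean_space set"
  assumes "convex S" "openin (top_of_set S) W"
  shows "locally_connected_space (top_of_set W)"
  unfolding locally_connected_space
proof (intro allI impI, elim conjE)
  fix V x assume V: "openin (top_of_set W) V" "x \<in> V"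
  have VS: "openin (top_of_set S) V" using V(1) assms(2) openin_trans by blast
  then obtain O' where O': "open O'" "V = S \<inter> O'" by (auto simp: openin_open)
  then obtain r where r: "r > 0" "ball x r \<subseteq> O'" using V(2) open_contains_ball by blast
  let ?B = "S \<inter> ball x r"
  have sub: "?B \<subseteq> V" using r O' by blast
  have VW: "V \<subseteq> W" using V(1) openin_imp_subset by blast
  have "openin (top_of_set S) ?B" by (auto simp: openin_open)
  then have "openin (top_of_set W) ?B"
    by (rule openin_subset_trans) (use sub VW assms(2) openin_imp_subset in blast)+
  moreover have "connected ?B" using assms(1) by (simp add: convex_Int convex_connected)
  then have "connectedin (top_of_set W) ?B"
    using sub VW by (simp add: connectedin_subtopology)
  moreover have "x \<in> ?B" using V(2) O' r by auto
  ultimately show "\<exists>U. openin (top_of_set W) U \<and> connectedin (top_of_set W) U \<and> x \<in> U \<and> U \<subseteq> V"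
    using sub by blast
qed

lemma convex_half_space: "convex (half_space b)"
  unfolding half_space_def by (rule convex_halfspace_ge)

text \<open>Needed so that components of open sets, which define the local sides, are open.\<close>

lemma smooth_manifold_locally_connected:
  assumes M: "smooth_manifold M"
  shows "locally_connected_space (mtop M)"
  unfolding locally_connected_space
proof (intro allI impI, elim conjE)
  fix V x assume V: "openin (mtop M) V" "x \<in> V"
  then have "x \<in> pts M" using openin_subset by blast
  then obtain U \<phi> where U: "(U, \<phi>) \<in> atlas M" "x \<in> U"
    using smooth_manifold_chart_at[OF M] by blast
  have ch: "topological_chart (mtop M) (U, \<phi>)" using M U smooth_manifold_charts by blast
  have op: "openin (mtop M) U" using topological_chart_openin[OF ch] .
  obtain b where "openin (top_of_set (half_space b)) (\<phi> ` U)"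
    using ch by (auto simp: topological_chart_def)
  then have "locally_connected_space (top_of_set (\<phi> ` U))"
    using locally_connected_convex_open[OF convex_half_space] by blast
  then have "locally_connected_space (subtopology (mtop M) U)"
    using homeomorphic_map_imp_homeomorphic_space[OF topological_chart_homeo[OF ch]]
      homeomorphic_locally_connected_space by blast
  moreover have "openin (subtopology (mtop M) U) (V \<inter> U)" "x \<in> V \<inter> U"
    using V U by (auto simp: openin_subtopology)
  ultimately obtain W where W: "openin (subtopology (mtop M) U) W"
      "connectedin (subtopology (mtop M) U) W" "x \<in> W" "W \<subseteq> V \<inter> U"
    unfolding locally_connected_space by blast
  then show "\<exists>U. openin (mtop M) U \<and> connectedin (mtop M) U \<and> x \<in> U \<and> U \<subseteq> V"
    using openin_trans_full[OF W(1) op] connectedin_subtopology by blast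
qed

lemma embeds_compactin:
  fixes Z :: "'z::euclidean_space set"
  assumes M: "smooth_manifold M" and Z: "compact Z" and h: "embeds M Z S h"
  shows "compactin (mtop M) S"
proof -
  have "topological_chart euclidean (UNIV :: 'z set, \<lambda>x. x)"
    using homeomorphic_map_id[of euclidean]
    by (auto simp: topological_chart_def half_space_def id_def intro!: exI[of _ 0])
  then have "\<forall>c\<in>atlas (euc :: ('z, 'z) smfd). topological_chart (mtop euc) c"
    by (simp add: euc_def)
  moreover have h': "smooth_map euc Z M h" "h ` Z = S"
    using h by (auto simp: diffeo_def bij_betw_def)
  ultimately have "continuous_map (subtopology (mtop euc) Z) (mtop M) h"
    by (intro smooth_map_continuous[OF _ smooth_manifold_charts[OF M]])
  then have "continuous_map (top_of_set Z) (mtop M) h" by (simp add: euc_def)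
  moreover have "compactin (top_of_set Z) Z" using Z by (simp add: compactin_subtopology)
  ultimately show ?thesis
    using image_compactin h'(2) by blast
qed

lemma compact_std_torus: "compact std_torus"
  by (simp add: std_torus_def unit_circle_def compact_Times)

text \<open>Tori are compact, a JSJ decomposition has finitely many components, and \<open>M\<close> is Hausdorff.\<close>

lemma jsj_decomposition_closedin:
  assumes M: "smooth_manifold M" and T: "jsj_decomposition M T"
  shows "closedin (mtop M) T"
proof -
  have *: "T \<subseteq> pts M" "finite (components_in M T)"
      "\<And>S. S \<in> components_in M T \<Longrightarrow> incompressible_torus M S"
    using T by (auto simp: jsj_decomposition_def jsj_system_def)
  have "Hausdorff_space (mtop M)" using M by (simp add: smooth_manifold_def)
  have "closedin (mtop M) S" if "S \<in> components_in M T" for S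
  proof -
    obtain h where "embeds M std_torus S h"
      using *(3)[OF \<open>S \<in> components_in M T\<close>] by (auto simp: incompressible_torus_def is_torus_def)
    then show ?thesis
      using embeds_compactin[OF M compact_std_torus] compactin_imp_closedin \<open>Hausdorff_space (mtop M)\<close>
      by metis
  qed
  then have "closedin (mtop M) (\<Union>(components_in M T))"
    using *(2) by (intro closedin_Union) auto
  moreover have "\<Union>(components_in M T) = T"
    using *(1) by (simp add: components_in_def Union_connected_components_of Int_absorb1)
  ultimately show ?thesis by simp
qed


section \<open>Homeomorphisms of the cut-open manifold\<close>

lemma cut_map_apply: "cut_map f (p, s) = (f p, \<lambda>U. f ` s (f -` U))"
  by (simp add: cut_map_def)

lemma fst_cut_map: "fst (cut_map f x) = f (fst x)"
  by (cases x) (simp add: cut_map_def)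

lemma cut_map_compose: "cut_map (f \<circ> g) = cut_map f \<circ> cut_map g"
  by (auto simp: fun_eq_iff cut_map_def image_comp vimage_comp o_def)

lemma cut_map_id: "cut_map id = id"
  by (auto simp: fun_eq_iff cut_map_def)

lemma cut_map_inverse:
  assumes "bij f"
  shows "cut_map (inv_fun f) \<circ> cut_map f = id" "cut_map f \<circ> cut_map (inv_fun f) = id"
  using assms bij_is_surj[OF assms] surj_iff[of f]
  by (simp_all add: cut_map_compose[symmetric] cut_map_id bij_is_inj)

lemma bij_cut_map: "bij f \<Longrightarrow> bij (cut_map f)"
  using cut_map_inverse o_bij by blast

lemma inv_cut_map: "bij f \<Longrightarrow> inv_fun (cut_map f) = cut_map (inv_fun f)"
  using cut_map_inverse inv_unique_comp by blast

lemma local_sides_component: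
  assumes "s \<in> local_sides X T p" "openin X U" "p \<in> U"
  shows "s U \<in> connected_components_of (subtopology X (U - T))"
  using assms by (auto simp: local_sides_def)

lemma local_sides_mono:
  assumes "s \<in> local_sides X T p" "openin X U" "openin X V" "p \<in> U" "U \<subseteq> V"
  shows "s U \<subseteq> s V"
  using assms by (auto simp: local_sides_def)

text \<open>Homeomorphisms preserve components and closures, the notions by which local sides are
  defined. The side \<open>\<lambda>U. f ` s (f -` U)\<close> has the value \<open>{}\<close> at sets that are not open
  neighbourhoods of \<open>f p\<close>, as required, because \<open>f\<close> is a bijection of the whole type.\<close>

lemma local_sides_cut_map:
  assumes f: "homeomorphic_map X X f" "bij f" "f ` T = T" and p: "p \<in> topspace X"
    and s: "s \<in> local_sides X T p"
  shows "(\<lambda>U. f ` s (f -` U)) \<in> local_sides X T (f p)"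
proof -
  have inj: "inj f" and ff: "f ` (f -` U) = U" for U
    using bij_is_inj[OF f(2)] surj_image_vimage_eq[OF bij_is_surj[OF f(2)]] by blast+
  have op: "openin X (f -` U) \<longleftrightarrow> openin X U" for U
  proof -
    have "openin X (f -` U) \<longleftrightarrow> f -` U \<subseteq> topspace X \<and> openin X (f ` (f -` U))"
      by (rule homeomorphic_map_openness_eq[OF f(1)])
    also have "\<dots> \<longleftrightarrow> openin X U"
    proof -
      have "f -` U \<subseteq> topspace X" if "openin X U"
      proof -
        have "f -` U \<subseteq> f -` topspace X" using openin_subset[OF that] by blast
        also have "\<dots> = f -` f ` topspace X" by (simp add: homeomorphic_imp_surjective_map[OF f(1)])
        finally show ?thesis by (simp only: inj_vimage_image_eq[OF inj])
      qed
      then show ?thesis unfolding ff by blast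
    qed
    finally show ?thesis .
  qed
  have TT: "f -` T = T" using f(3) inj inj_vimage_image_eq by metis
  show ?thesis
    unfolding local_sides_def mem_Collect_eq
  proof (intro conjI allI impI, goal_cases)
    case (1 U)
    show ?case
    proof (cases "openin X U \<and> f p \<in> U")
      case True
      then have U: "openin X (f -` U)" "p \<in> f -` U" using op by auto
      let ?C = "s (f -` U)"
      have C: "?C \<in> connected_components_of (subtopology X (f -` U - T))" "p \<in> X closure_of ?C"
        using s U by (auto simp: local_sides_def)
      have "homeomorphic_map (subtopology X (f -` U - T)) (subtopology X (U - T)) f"
        by (rule homeomorphic_map_subtopologies_alt[OF f(1)]) (use TT in auto)
      then have "f ` ?C \<in> connected_components_of (subtopology X (U - T))"
        using C(1) homeomorphic_map_connected_components_of by blast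
      moreover have "f p \<in> X closure_of (f ` ?C)"
        using continuous_map_image_closure_subset[OF homeomorphic_imp_continuous_map[OF f(1)]] C(2)
        by blast
      ultimately show ?thesis using True by simp
    next
      case False
      then have "\<not> (openin X (f -` U) \<and> p \<in> f -` U)" using op by auto
      then have "s (f -` U) = {}" using s unfolding local_sides_def mem_Collect_eq by meson
      then show ?thesis using False by simp
    qed
  next
    case (2 U V)
    then have "s (f -` U) \<subseteq> s (f -` V)"
      using op by (intro local_sides_mono[OF s]) auto
    then show ?case by blast
  qed
qed

lemma topspace_cut_top: "topspace (cut_top X T) = {(p, s). p \<in> topspace X \<and> s \<in> local_sides X T p}"
proof -
  have "(p, s) \<in> \<Union>{{(p, s). p \<in> U \<and> s \<in> local_sides X T p \<and> s U = C} | U C. openin X U}"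
    if "p \<in> topspace X" "s \<in> local_sides X T p" for p s
    by (rule UnionI[of "{(q, t). q \<in> topspace X \<and> t \<in> local_sides X T q \<and> t (topspace X) = s (topspace X)}"])
       (use that in blast)+
  moreover have "p \<in> topspace X \<and> s \<in> local_sides X T p"
    if "(p, s) \<in> \<Union>{{(p, s). p \<in> U \<and> s \<in> local_sides X T p \<and> s U = C} | U C. openin X U}" for p s
    using that openin_subset by blast
  ultimately show ?thesis
    unfolding cut_top_def topology_generated_by_topspace by blast
qed

text \<open>The preimage of the subbasic set for \<open>U\<close> and \<open>C\<close> is the one for their preimages
  under \<open>f\<close>.\<close>

lemma continuous_map_cut_map:
  fixes X :: "'a topology"
  assumes f: "homeomorphic_map X X f" "bij f" "f ` T = T" and g: "inv_fun f ` T = T"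
    "homeomorphic_map X X (inv_fun f)"
  shows "continuous_map (cut_top X T) (cut_top X T) (cut_map f)"
proof -
  let ?S = "{{(p, s). p \<in> U \<and> s \<in> local_sides X T p \<and> s U = C} | U C. openin X U}"
  have im: "cut_map f ` topspace (cut_top X T) \<subseteq> topspace (cut_top X T)"
  proof (rule image_subsetI)
    fix x assume "x \<in> topspace (cut_top X T)"
    then show "cut_map f x \<in> topspace (cut_top X T)"
      using local_sides_cut_map[OF f] homeomorphic_imp_surjective_map[OF f(1)]
      by (cases x) (auto simp: topspace_cut_top cut_map_apply)
  qed
  have "continuous_map (cut_top X T) (topology_generated_by ?S) (cut_map f)"
  proof (rule continuous_on_generated_topo)
    fix N assume "N \<in> ?S"
    then obtain U C where N: "N = {(p, s). p \<in> U \<and> s \<in> local_sides X T p \<and> s U = C}"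
      and U: "openin X U" by blast
    have opU: "openin X (f -` U)"
    proof -
      have "f -` U = inv_fun f ` U" using bij_vimage_eq_inv_image[OF f(2)] .
      then show ?thesis
        using homeomorphic_imp_open_map[OF g(2)] U by (simp add: open_map_def)
    qed
    have eq: "f ` A = C \<longleftrightarrow> A = f -` C" for A
      using f(2) by (metis bij_is_inj bij_is_surj inj_vimage_image_eq surj_image_vimage_eq)
    have "cut_map f -` N \<inter> topspace (cut_top X T) =
          {(p, s). p \<in> f -` U \<and> s \<in> local_sides X T p \<and> s (f -` U) = f -` C}"
    proof (rule Set.set_eqI)
      fix x :: "'a cut_point"
      obtain p s where x: "x = (p, s)" by (cases x)
      have "p \<in> f -` U \<Longrightarrow> p \<in> topspace X" using openin_subset[OF opU] by blast
      then show "x \<in> cut_map f -` N \<inter> topspace (cut_top X T) \<longleftrightarrow>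
          x \<in> {(p, s). p \<in> f -` U \<and> s \<in> local_sides X T p \<and> s (f -` U) = f -` C}"
        using eq[of "s (f -` U)"] local_sides_cut_map[OF f, of p s]
        by (auto simp: x N cut_map_apply topspace_cut_top)
    qed
    moreover have "openin (cut_top X T)
        {(p, s). p \<in> f -` U \<and> s \<in> local_sides X T p \<and> s (f -` U) = f -` C}"
      unfolding cut_top_def by (rule topology_generated_by_Basis) (use opU in blast)
    ultimately show "openin (cut_top X T) (cut_map f -` N \<inter> topspace (cut_top X T))" by simp
  next
    show "cut_map f ` topspace (cut_top X T) \<subseteq> \<Union>?S"
      using im unfolding cut_top_def topology_generated_by_topspace .
  qed
  then show ?thesis by (simp only: cut_top_def[of X T, symmetric])
qed

lemma homeomorphic_map_cut_map:
  assumes f: "homeomorphic_map X X f" "bij f" "f ` T = T"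
    and g: "homeomorphic_map X X (inv_fun f)"
  shows "homeomorphic_map (cut_top X T) (cut_top X T) (cut_map f)"
proof -
  have T: "inv_fun f ` T = T" using f(2,3) by (metis bij_is_inj image_inv_f_f)
  have ii: "inv_fun (inv_fun f) = f" using f(2) by (rule inv_inv_eq)
  have "continuous_map (cut_top X T) (cut_top X T) (cut_map f)"
    using continuous_map_cut_map[OF f T g] .
  moreover have "continuous_map (cut_top X T) (cut_top X T) (cut_map (inv_fun f))"
    using continuous_map_cut_map[of X "inv_fun f" T] f g T ii bij_imp_bij_inv by metis
  ultimately have "homeomorphic_maps (cut_top X T) (cut_top X T) (cut_map f) (cut_map (inv_fun f))"
    unfolding homeomorphic_maps_def using cut_map_inverse[OF f(2)] by (metis comp_apply id_apply)
  then show ?thesis using homeomorphic_map_maps by blast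
qed


section \<open>The pieces and their diffeomorphism types\<close>

text \<open>If \<open>F\<close> is a homeomorphism carrying charts of \<open>P\<close> to charts of \<open>P'\<close>, then a diffeomorphism
  from \<open>P\<close> may be precomposed with the inverse of \<open>F\<close>: the local representations do not
  change.\<close>

lemma diffeomorphic_transport:
  assumes b: "bij F" and F: "homeomorphic_map (mtop P) (mtop P') F"
    and atl: "\<And>c. c \<in> atlas P \<Longrightarrow> push_chart F c \<in> atlas P'"
    and inj: "\<And>U \<phi>. (U, \<phi>) \<in> atlas P \<Longrightarrow> inj_on \<phi> U"
    and N: "smooth_manifold N" and PN: "diffeomorphic P N"
  shows "diffeomorphic P' N"
proof -
  obtain g where g: "bij_betw g (pts P) (pts N)" "smooth_map P (pts P) N g"
      "smooth_map N (pts N) P (inv_into (pts P) g)"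
    using PN by (auto simp: diffeomorphic_def diffeo_def)
  have injF: "inj F" using b bij_is_inj by blast
  have pts': "pts P' = F ` pts P" using homeomorphic_imp_surjective_map[OF F] by simp
  have Fop: "openin (mtop P') (F ` W)" if "openin (mtop P) W" for W
    using homeomorphic_imp_open_map[OF F] that by (simp add: open_map_def)
  let ?h = "inv_into (pts P) g" and ?g = "g \<circ> inv_fun F"
  have bij: "bij_betw ?g (pts P') (pts N)"
  proof (rule bij_betw_trans)
    show "bij_betw (inv_fun F) (pts P') (pts P)"
      unfolding pts' using injF by (intro bij_betw_byWitness[where f' = F]) auto
  qed (rule g(1))
  have "smooth_map P' (pts P') N ?g"
    unfolding smooth_map_def
  proof (intro conjI ballI)
    show "?g ` pts P' \<subseteq> pts N" using bij by (simp add: bij_betw_def)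
    fix p' assume "p' \<in> pts P'"
    then obtain p where p: "p \<in> pts P" "p' = F p" unfolding pts' by blast
    obtain U \<phi> V \<psi> W where c: "(U, \<phi>) \<in> atlas P" "(V, \<psi>) \<in> atlas N"
        "openin (mtop P) W" "p \<in> W" "W \<subseteq> U" "g ` (pts P \<inter> W) \<subseteq> V"
        "smooth_on (\<phi> ` (pts P \<inter> W)) (local_rep g (U, \<phi>) (V, \<psi>))"
      using g(2) p(1) unfolding smooth_map_def by meson
    have int: "pts P' \<inter> F ` W = F ` (pts P \<inter> W)"
      unfolding pts' using injF by (simp add: image_Int)
    have "local_rep g (U, \<phi>) (V, \<psi>) y = local_rep ?g (F ` U, \<phi> \<circ> inv_fun F) (V, \<psi>) y"
      if "y \<in> \<phi> ` (pts P \<inter> W)" for y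
    proof -
      have "y \<in> \<phi> ` U" using that c(5) by blast
      moreover have "?g \<circ> F = g" using injF by (simp add: comp_assoc)
      ultimately show ?thesis
        using local_rep_push_domain[OF b inj[OF c(1)], of y ?g "(V, \<psi>)"] by (simp add: push_chart_def)
    qed
    with c(7) have "smooth_on (\<phi> ` (pts P \<inter> W)) (local_rep ?g (F ` U, \<phi> \<circ> inv_fun F) (V, \<psi>))"
      by (rule smooth_on_eq)
    then have "smooth_on ((\<phi> \<circ> inv_fun F) ` (pts P' \<inter> F ` W))
        (local_rep ?g (F ` U, \<phi> \<circ> inv_fun F) (V, \<psi>))"
      unfolding int image_push_chart[OF b] .
    moreover have "?g ` (pts P' \<inter> F ` W) \<subseteq> V"
      using c(6) injF unfolding int by auto
    moreover have "(F ` U, \<phi> \<circ> inv_fun F) \<in> atlas P'"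
      using atl[OF c(1)] by (simp add: push_chart_def)
    ultimately show "\<exists>U \<phi> V \<psi> W. (U, \<phi>) \<in> atlas P' \<and> (V, \<psi>) \<in> atlas N \<and>
        openin (mtop P') W \<and> p' \<in> W \<and> W \<subseteq> U \<and> ?g ` (pts P' \<inter> W) \<subseteq> V \<and>
        smooth_on (\<phi> ` (pts P' \<inter> W)) (local_rep ?g (U, \<phi>) (V, \<psi>))"
      using Fop[OF c(3)] c p
      by (intro exI[of _ "F ` U"] exI[of _ "\<phi> \<circ> inv_fun F"] exI[of _ V] exI[of _ \<psi>]
          exI[of _ "F ` W"] conjI) auto
  qed simp
  moreover have "smooth_map N (pts N) P' (F \<circ> ?h)"
    unfolding smooth_map_def
  proof (intro conjI ballI)
    have hN: "?h ` pts N = pts P" using g(1) bij_betw_inv_into[OF g(1)] by (simp add: bij_betw_def)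
    show "(F \<circ> ?h) ` pts N \<subseteq> pts P'" unfolding pts' using hN by auto
    fix p assume p: "p \<in> pts N"
    obtain V \<psi> U \<phi> W where c: "(V, \<psi>) \<in> atlas N" "(U, \<phi>) \<in> atlas P"
        "openin (mtop N) W" "p \<in> W" "W \<subseteq> V" "?h ` (pts N \<inter> W) \<subseteq> U"
        "smooth_on (\<psi> ` (pts N \<inter> W)) (local_rep ?h (V, \<psi>) (U, \<phi>))"
      using g(3) p unfolding smooth_map_def by meson
    have "inv_fun F \<circ> (F \<circ> ?h) = ?h" using injF by (simp add: comp_assoc[symmetric])
    then have "local_rep (F \<circ> ?h) (V, \<psi>) (F ` U, \<phi> \<circ> inv_fun F) = local_rep ?h (V, \<psi>) (U, \<phi>)"
      using local_rep_push_codomain[of "F \<circ> ?h" "(V, \<psi>)" F "(U, \<phi>)"] by (simp add: push_chart_def)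
    then have "smooth_on (\<psi> ` (pts N \<inter> W)) (local_rep (F \<circ> ?h) (V, \<psi>) (F ` U, \<phi> \<circ> inv_fun F))"
      using c(7) by metis
    moreover have "(F ` U, \<phi> \<circ> inv_fun F) \<in> atlas P'"
      using atl[OF c(2)] by (simp add: push_chart_def)
    moreover have "(F \<circ> ?h) ` (pts N \<inter> W) \<subseteq> F ` U" using c(6) by auto
    ultimately show "\<exists>U \<phi> V \<psi> W. (U, \<phi>) \<in> atlas N \<and> (V, \<psi>) \<in> atlas P' \<and>
        openin (mtop N) W \<and> p \<in> W \<and> W \<subseteq> U \<and> (F \<circ> ?h) ` (pts N \<inter> W) \<subseteq> V \<and>
        smooth_on (\<phi> ` (pts N \<inter> W)) (local_rep (F \<circ> ?h) (U, \<phi>) (V, \<psi>))"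
      using c by (intro exI[of _ V] exI[of _ \<psi>] exI[of _ "F ` U"] exI[of _ "\<phi> \<circ> inv_fun F"]
          exI[of _ W] conjI)
  qed simp
  moreover have "(F \<circ> ?h) y = inv_into (pts P') ?g y" if "y \<in> pts N" for y
  proof (rule sym, rule inv_into_f_eq)
    show "inj_on ?g (pts P')" using bij by (simp add: bij_betw_def)
    have "?h y \<in> pts P" "g (?h y) = y"
      using g(1) that by (auto simp: bij_betw_def inv_into_into f_inv_into_f)
    then show "(F \<circ> ?h) y \<in> pts P'" "?g ((F \<circ> ?h) y) = y" using injF by (auto simp: pts')
  qed
  then have "smooth_map N (pts N) P' (F \<circ> ?h) \<Longrightarrow> smooth_map N (pts N) P' (inv_into (pts P') ?g)"
    by (rule smooth_map_cong[OF _ smooth_manifold_charts[OF N]])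
  ultimately show ?thesis
    using bij unfolding diffeomorphic_def diffeo_def by blast
qed

lemma mtop_cut: "mtop (cut M T) = cut_top (mtop M) T"
  by (simp add: cut_def)

lemma homeomorphic_map_cut:
  assumes M: "smooth_manifold M" and f: "f \<in> Diff_set M" "f ` T = T"
  shows "homeomorphic_map (mtop (cut M T)) (mtop (cut M T)) (cut_map f)"
  unfolding mtop_cut
  using homeomorphic_map_cut_map[OF Diff_set_homeomorphic_map[OF M f(1)] Diff_set_bij[OF f(1)] f(2)
      Diff_set_homeomorphic_map[OF M Diff_set_inv[OF M f(1)]]] .

lemma pieces_image:
  assumes M: "smooth_manifold M" and f: "f \<in> Diff_set M" "f ` T = T"
  shows "image (cut_map f) ` pieces M T = pieces M T"
  unfolding pieces_def
  using homeomorphic_map_connected_components_of[OF homeomorphic_map_cut[OF M f]] by simp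

text \<open>The charts of the cut-open manifold are pulled back from \<open>M\<close> along the regluing map, which
  intertwines \<open>cut_map f\<close> with \<open>f\<close>.\<close>

lemma cut_atlas_push:
  assumes M: "smooth_manifold M" and f: "f \<in> Diff_set M" "f ` T = T"
    and c: "c \<in> atlas (cut M T)"
  shows "push_chart (cut_map f) c \<in> atlas (cut M T)"
proof -
  have b: "bij f" using Diff_set_bij[OF f(1)] .
  obtain W U \<phi> where c': "c = (W, \<phi> \<circ> fst)" "(U, \<phi>) \<in> max_atlas M" "fst ` W \<subseteq> U"
      "topological_chart (cut_top (mtop M) T) (W, \<phi> \<circ> fst)"
    using c by (auto simp: cut_def)
  have "\<phi> \<circ> fst \<circ> inv_fun (cut_map f) = (\<phi> \<circ> inv_fun f) \<circ> fst"
    unfolding inv_cut_map[OF b] by (simp add: fun_eq_iff fst_cut_map)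
  then have push: "push_chart (cut_map f) c = (cut_map f ` W, (\<phi> \<circ> inv_fun f) \<circ> fst)"
    by (simp add: c'(1) push_chart_def)
  have "topological_chart (cut_top (mtop M) T) (push_chart (cut_map f) c)"
    unfolding c'(1) using homeomorphic_map_cut[OF M f] bij_cut_map[OF b] c'(4)
    unfolding mtop_cut by (rule topological_chart_push)
  moreover have "(f ` U, \<phi> \<circ> inv_fun f) \<in> max_atlas M"
    using Diff_set_push_max_atlas[OF M f(1) c'(2)] by (simp add: push_chart_def)
  moreover have "fst ` cut_map f ` W \<subseteq> f ` U"
    using c'(3) by (auto simp: fst_cut_map)
  ultimately show ?thesis unfolding push by (auto simp: cut_def)
qed

lemma cut_atlas_inj_on: "(W, \<phi>) \<in> atlas (cut M T) \<Longrightarrow> inj_on \<phi> W"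
  by (auto simp: cut_def dest: topological_chart_inj_on)

lemma diffeomorphic_piece_imp:
  assumes M: "smooth_manifold M" and f: "f \<in> Diff_set M" "f ` T = T"
    and N: "smooth_manifold N" and d: "diffeomorphic (piece_mfd M T K) N"
  shows "diffeomorphic (piece_mfd M T (cut_map f ` K)) N"
proof (rule diffeomorphic_transport[OF _ _ _ _ N d])
  have b: "bij f" using Diff_set_bij[OF f(1)] .
  show bF: "bij (cut_map f)" using bij_cut_map[OF b] .
  then have inj: "inj (cut_map f)" using bij_is_inj by blast
  show "homeomorphic_map (mtop (piece_mfd M T K)) (mtop (piece_mfd M T (cut_map f ` K))) (cut_map f)"
    unfolding piece_mfd_def restrict_mfd_def smfd.simps
    using inj by (intro homeomorphic_map_subtopologies_alt[OF homeomorphic_map_cut[OF M f]])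
      (simp add: inj_image_mem_iff)
  show "push_chart (cut_map f) c \<in> atlas (piece_mfd M T (cut_map f ` K))"
    if "c \<in> atlas (piece_mfd M T K)" for c
  proof -
    obtain W \<phi> where c: "c = (W \<inter> K, \<phi>)" "(W, \<phi>) \<in> atlas (cut M T)"
      using \<open>c \<in> atlas (piece_mfd M T K)\<close> by (auto simp: piece_mfd_def restrict_mfd_def)
    have "push_chart (cut_map f) c =
        (\<lambda>(U, \<phi>). (U \<inter> cut_map f ` K, \<phi>)) (push_chart (cut_map f) (W, \<phi>))"
      using inj by (simp add: c push_chart_def image_Int)
    then show ?thesis
      using cut_atlas_push[OF M f c(2)] unfolding piece_mfd_def restrict_mfd_def smfd.simps by blast
  qed
  show "inj_on \<phi> U" if "(U, \<phi>) \<in> atlas (piece_mfd M T K)" for U \<phi>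
  proof -
    obtain W where "U = W \<inter> K" "(W, \<phi>) \<in> atlas (cut M T)"
      using \<open>(U, \<phi>) \<in> atlas (piece_mfd M T K)\<close> by (auto simp: piece_mfd_def restrict_mfd_def)
    then show ?thesis using cut_atlas_inj_on inj_on_subset by blast
  qed
qed

text \<open>Hence \<open>f\<close> preserves the decoration of the graph.\<close>

lemma diffeomorphic_piece_iff:
  assumes M: "smooth_manifold M" and f: "f \<in> Diff_set M" "f ` T = T" and N: "smooth_manifold N"
  shows "diffeomorphic (piece_mfd M T (cut_map f ` K)) N \<longleftrightarrow> diffeomorphic (piece_mfd M T K) N"
proof
  have b: "bij f" using Diff_set_bij[OF f(1)] .
  assume "diffeomorphic (piece_mfd M T (cut_map f ` K)) N"
  moreover have "inv_fun f ` T = T" using f(2) b by (metis bij_is_inj image_inv_f_f)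
  ultimately have "diffeomorphic (piece_mfd M T (cut_map (inv_fun f) ` cut_map f ` K)) N"
    by (intro diffeomorphic_piece_imp[OF M Diff_set_inv[OF M f(1)] _ N])
  moreover have "cut_map (inv_fun f) ` cut_map f ` K = K"
    unfolding image_comp cut_map_inverse(1)[OF b] by simp
  ultimately show "diffeomorphic (piece_mfd M T K) N" by simp
qed (rule diffeomorphic_piece_imp[OF M f N])


section \<open>Isotopic diffeomorphisms induce the same permutations\<close>

text \<open>Away from \<open>T\<close> a point has exactly one local side, given by the components
  containing it. This embeds the complement of \<open>T\<close> into the cut-open manifold.\<close>

definition only_side :: "'a topology \<Rightarrow> 'a set \<Rightarrow> 'a \<Rightarrow> 'a set \<Rightarrow> 'a set" where
  "only_side X T p = (\<lambda>U. if openin X U \<and> p \<in> U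
     then connected_component_of_set (subtopology X (U - T)) p else {})"

lemma component_complement_open:
  assumes "locally_connected_space X" "closedin X T" "openin X U"
    and "C \<in> connected_components_of (subtopology X (U - T))"
  shows "openin X C"
  using assms openin_diff[of X U T] locally_connected_space_open_connected_components by blast

text \<open>The component \<open>C\<close> of \<open>U - T\<close> that contains \<open>p\<close> is an open neighbourhood of \<open>p\<close>, so every
  component that accumulates at \<open>p\<close> meets \<open>C\<close> and therefore equals \<open>C\<close>.\<close>

lemma local_sides_complement:
  assumes X: "locally_connected_space X" "closedin X T" and p: "p \<in> topspace X - T"
  shows "local_sides X T p = {only_side X T p}"
proof (intro subset_antisym subsetI)
  have comp: "connected_component_of_set (subtopology X (U - T)) p \<in>
      connected_components_of (subtopology X (U - T))"
      "p \<in> connected_component_of_set (subtopology X (U - T)) p"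
    if "openin X U" "p \<in> U" for U
    using that p by (simp_all add: connected_component_in_connected_components_of
        connected_component_of_refl)
  {
    fix s assume s: "s \<in> local_sides X T p"
    have "s U = only_side X T p U" for U
    proof (cases "openin X U \<and> p \<in> U")
      case True
      let ?C = "connected_component_of_set (subtopology X (U - T)) p"
      have sU: "s U \<in> connected_components_of (subtopology X (U - T))" "p \<in> X closure_of s U"
        using s True by (auto simp: local_sides_def)
      have "openin X ?C" using component_complement_open[OF X] True comp by blast
      then obtain y where "y \<in> s U" "y \<in> ?C"
        using sU(2) comp(2) True unfolding in_closure_of by meson
      then have "s U \<inter> ?C \<noteq> {}" by blast
      then have "s U = ?C" using connected_components_of_overlap sU(1) comp(1) True by blast
      then show ?thesis using True by (simp add: only_side_def)
    next
      case False
      then have "s U = {}" using s unfolding local_sides_def mem_Collect_eq by meson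
      then show ?thesis using False by (auto simp: only_side_def)
    qed
    then show "s \<in> {only_side X T p}" by auto
  next
    fix s assume "s \<in> {only_side X T p}"
    then have s: "s = only_side X T p" by simp
    have "p \<in> X closure_of only_side X T p U" if "openin X U" "p \<in> U" for U
    proof -
      have "only_side X T p U \<subseteq> topspace X"
        using connected_component_of_subset_topspace[of "subtopology X (U - T)" p]
        by (auto simp: only_side_def)
      moreover have "p \<in> only_side X T p U" using comp(2) that by (simp add: only_side_def)
      ultimately show ?thesis using closure_of_subset by blast
    qed
    then show "s \<in> local_sides X T p"
      unfolding local_sides_def s mem_Collect_eq
      using comp(1) by (auto simp: only_side_def intro: connected_component_of_mono)
  }
qed

lemma only_side_eqI:
  assumes "openin X U" "C \<in> connected_components_of (subtopology X (U - T))" "q \<in> C"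
  shows "q \<in> U - T" "only_side X T q U = C"
proof -
  have "C \<subseteq> topspace (subtopology X (U - T))"
    using assms(2) connected_components_of_subset by blast
  then show q: "q \<in> U - T" using assms(3) by auto
  have "connected_component_of_set (subtopology X (U - T)) q = C"
    using assms(2,3) connected_component_of_eq
    by (smt (verit) connected_component_of_equiv connected_components_of_def imageE mem_Collect_eq)
  then show "only_side X T q U = C" using q assms(1) by (simp add: only_side_def)
qed

text \<open>A point at which the side in \<open>U\<close> is \<open>C\<close> lies in \<open>C\<close>, and then all points of the open set \<open>C\<close>
  have the side \<open>C\<close> in \<open>U\<close>.\<close>

lemma continuous_map_only_side:
  assumes X: "locally_connected_space X" "closedin X T"
  shows "continuous_map (subtopology X (topspace X - T)) (cut_top X T) (\<lambda>p. (p, only_side X T p))"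
proof -
  let ?S = "{{(p, s). p \<in> U \<and> s \<in> local_sides X T p \<and> s U = C} | U C. openin X U}"
  let ?\<sigma> = "\<lambda>p. (p, only_side X T p)"
  have sides: "only_side X T p \<in> local_sides X T p" if "p \<in> topspace X - T" for p
    using local_sides_complement[OF X that] by blast
  have "continuous_map (subtopology X (topspace X - T)) (topology_generated_by ?S) ?\<sigma>"
  proof (rule continuous_on_generated_topo)
    fix N assume "N \<in> ?S"
    then obtain U C where N: "N = {(p, s). p \<in> U \<and> s \<in> local_sides X T p \<and> s U = C}"
      and U: "openin X U" by blast
    show "openin (subtopology X (topspace X - T)) (?\<sigma> -` N \<inter> topspace (subtopology X (topspace X - T)))"
    proof (subst openin_subopen, intro ballI)
      fix p assume "p \<in> ?\<sigma> -` N \<inter> topspace (subtopology X (topspace X - T))"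
      then have p: "p \<in> topspace X - T" "p \<in> U" "only_side X T p U = C" by (auto simp: N)
      have C: "C \<in> connected_components_of (subtopology X (U - T))" "p \<in> C"
        using p U by (auto simp: only_side_def connected_component_in_connected_components_of
            connected_component_of_refl)
      have CU: "C \<subseteq> U - T" using only_side_eqI(1)[OF U C(1)] by blast
      have "openin X C" using component_complement_open[OF X U C(1)] .
      moreover have Csub: "C \<subseteq> topspace X - T" using CU openin_subset[OF U] by blast
      ultimately have "openin (subtopology X (topspace X - T)) C"
        using subset_openin_subtopology by blast
      moreover have "C \<subseteq> ?\<sigma> -` N"
        using only_side_eqI[OF U C(1)] Csub sides by (auto simp: N)
      ultimately show "\<exists>V. openin (subtopology X (topspace X - T)) V \<and> p \<in> V \<and>
          V \<subseteq> ?\<sigma> -` N \<inter> topspace (subtopology X (topspace X - T))"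
        using C(2) Csub by (intro exI[of _ C]) auto
    qed
  next
    have "?\<sigma> ` (topspace X - T) \<subseteq> topspace (cut_top X T)"
      using sides by (auto simp: topspace_cut_top)
    then show "?\<sigma> ` topspace (subtopology X (topspace X - T)) \<subseteq> \<Union>?S"
      unfolding cut_top_def topology_generated_by_topspace by (simp add: Int_absorb1)
  qed
  then show ?thesis by (simp only: cut_top_def[of X T, symmetric])
qed

text \<open>So the points near \<open>p\<close> on the side \<open>s\<close> converge to \<open>(p, s)\<close> in the cut-open manifold.
  For a subbasic set this is the definition of its members, and sides are monotone in the
  neighbourhood, which gives finite intersections.\<close>

lemma cut_top_nbhd_contains_side:
  assumes X: "locally_connected_space X" "closedin X T"
    and O': "openin (cut_top X T) O'" and ps: "(p, s) \<in> O'"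
  shows "\<exists>U. openin X U \<and> p \<in> U \<and> (\<forall>q\<in>s U. (q, only_side X T q) \<in> O')"
proof -
  let ?S = "{{(p, s). p \<in> U \<and> s \<in> local_sides X T p \<and> s U = C} | U C. openin X U}"
  have "(p, s) \<in> topspace (cut_top X T)" using openin_subset[OF O'] ps by blast
  then have s: "s \<in> local_sides X T p" by (simp add: topspace_cut_top)
  have "generate_topology_on ?S O'"
    using O' unfolding cut_top_def by (rule openin_topology_generated_by)
  then show ?thesis using ps
  proof (induction rule: generate_topology_on.induct)
    case (Int a b)
    obtain U V where U: "openin X U" "p \<in> U" "\<forall>q\<in>s U. (q, only_side X T q) \<in> a"
      and V: "openin X V" "p \<in> V" "\<forall>q\<in>s V. (q, only_side X T q) \<in> b"
      using Int by blast
    have "openin X (U \<inter> V)" "p \<in> U \<inter> V" using U V by auto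
    then have "s (U \<inter> V) \<subseteq> s U" "s (U \<inter> V) \<subseteq> s V"
      using local_sides_mono[OF s, of "U \<inter> V"] U(1) V(1) by simp_all
    then show ?case using U V by (intro exI[of _ "U \<inter> V"]) auto
  next
    case (UN K)
    then obtain k where k: "k \<in> K" "(p, s) \<in> k" by blast
    then obtain U where "openin X U" "p \<in> U" "\<forall>q\<in>s U. (q, only_side X T q) \<in> k"
      using UN.IH[OF k] by (elim exE conjE)
    then show ?case using k(1) by (intro exI[of _ U]) auto
  next
    case (Basis N)
    then obtain U C where N: "N = {(p, s). p \<in> U \<and> s \<in> local_sides X T p \<and> s U = C}"
      and U: "openin X U" by blast
    have ps: "p \<in> U" "s U = C" using Basis(2) by (auto simp: N)
    have C: "C \<in> connected_components_of (subtopology X (U - T))"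
      using local_sides_component[OF s U ps(1)] ps(2) by simp
    have "(q, only_side X T q) \<in> N" if "q \<in> s U" for q
    proof -
      have "q \<in> C" using that ps(2) by simp
      then have q: "q \<in> U - T" "only_side X T q U = C" using only_side_eqI[OF U C] by blast+
      then have "only_side X T q \<in> local_sides X T q"
        using local_sides_complement[OF X, of q] openin_subset[OF U] by blast
      then show ?thesis using q by (simp add: N)
    qed
    then show ?case using U ps(1) by blast
  qed simp
qed

text \<open>For a point \<open>(p, s)\<close> of the component, let \<open>C\<close> be the component of the complement of \<open>T\<close> on
  the side \<open>s\<close>. The image of \<open>C\<close> in the cut-open manifold is connected and accumulates at
  \<open>(p, s)\<close>, so it lies in the same component.\<close>

lemma cut_component_meets_complement:
  assumes X: "locally_connected_space X" "closedin X T"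
    and K: "K \<in> connected_components_of (cut_top X T)"
  obtains q where "q \<in> topspace X - T" "(q, only_side X T q) \<in> K"
proof -
  let ?\<sigma> = "\<lambda>p. (p, only_side X T p)"
  obtain p s where ps: "(p, s) \<in> K"
    using nonempty_connected_components_of[OF K] by auto
  then have top: "(p, s) \<in> topspace (cut_top X T)"
    using connected_components_of_subset[OF K] by blast
  then have p: "p \<in> topspace X" and s: "s \<in> local_sides X T p" by (auto simp: topspace_cut_top)
  let ?C = "s (topspace X)"
  have C: "?C \<in> connected_components_of (subtopology X (topspace X - T))"
    using local_sides_component[OF s openin_topspace p] .
  have "connectedin (cut_top X T) (?\<sigma> ` ?C)"
    using connectedin_continuous_map_image[OF continuous_map_only_side[OF X]]
      connectedin_connected_components_of[OF C] by blast
  then have con: "connectedin (cut_top X T) (cut_top X T closure_of (?\<sigma> ` ?C))"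
    by (rule connectedin_closure_of)
  have "(p, s) \<in> cut_top X T closure_of (?\<sigma> ` ?C)"
    unfolding in_closure_of
  proof (intro conjI allI impI top)
    fix O' assume O': "(p, s) \<in> O' \<and> openin (cut_top X T) O'"
    then obtain U where U: "openin X U" "p \<in> U" "\<forall>q\<in>s U. ?\<sigma> q \<in> O'"
      using cut_top_nbhd_contains_side[OF X] by blast
    have "s U \<noteq> {}"
      using nonempty_connected_components_of[OF local_sides_component[OF s U(1,2)]] .
    moreover have "s U \<subseteq> ?C"
      using local_sides_mono[OF s U(1) openin_topspace U(2)] openin_subset[OF U(1)] by blast
    ultimately show "\<exists>y. y \<in> ?\<sigma> ` ?C \<and> y \<in> O'" using U(3) by blast
  qed
  then have sub: "cut_top X T closure_of (?\<sigma> ` ?C) \<subseteq> K"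
    using connected_components_of_maximal[OF K con] ps by (auto simp: disjnt_iff)
  obtain q where q: "q \<in> ?C" using nonempty_connected_components_of[OF C] by blast
  have qT: "q \<in> topspace X - T" using only_side_eqI(1)[OF openin_topspace C q] .
  then have "?\<sigma> q \<in> topspace (cut_top X T)"
    using local_sides_complement[OF X qT] by (auto simp: topspace_cut_top)
  moreover have "topspace (cut_top X T) \<inter> ?\<sigma> ` ?C \<subseteq> cut_top X T closure_of (?\<sigma> ` ?C)"
    by (rule closure_of_subset_Int)
  ultimately have "?\<sigma> q \<in> K" using q sub by blast
  then show ?thesis using that qT by blast
qed

lemma pathin_component_eq:
  assumes g: "pathin X g" and C: "C \<in> connected_components_of X" "D \<in> connected_components_of X"
    and "g 0 \<in> C" "g 1 \<in> D"
  shows "C = D"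
proof -
  have con: "connectedin X (g ` {0..1})" using connectedin_path_image[OF g] .
  have ends: "g 0 \<in> g ` {0..1}" "g 1 \<in> g ` {0..1}" by auto
  then have "\<not> disjnt C (g ` {0..1})" using assms(4) unfolding disjnt_iff by blast
  then have "g 1 \<in> C" using connected_components_of_maximal[OF C(1) con] ends(2) by blast
  then show ?thesis using connected_components_of_overlap[OF C] assms(5) by blast
qed

text \<open>An isotopy through maps preserving \<open>S\<close> moves each point of \<open>S\<close> along a path in \<open>S\<close>.\<close>

lemma isotopic_image_component:
  assumes ev: "\<And>p. p \<in> S \<Longrightarrow> pathin (mtop M) (\<lambda>t. \<gamma> t p)"
    and S: "\<And>t. t \<in> {0..1} \<Longrightarrow> \<gamma> t ` S = S"
    and C: "C \<in> components_in M S" "\<gamma> 0 ` C \<in> components_in M S" "\<gamma> 1 ` C \<in> components_in M S"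
  shows "\<gamma> 0 ` C = \<gamma> 1 ` C"
proof -
  obtain p where p: "p \<in> C"
    using C(1) nonempty_connected_components_of unfolding components_in_def by blast
  have pS: "p \<in> S"
    using C(1) p connected_components_of_subset unfolding components_in_def by fastforce
  have "pathin (subtopology (mtop M) S) (\<lambda>t. \<gamma> t p)"
    unfolding pathin_subtopology using ev[OF pS] S pS by blast
  then show ?thesis
    using pathin_component_eq[of "subtopology (mtop M) S" "\<lambda>t. \<gamma> t p"] C(2,3) p
    unfolding components_in_def by blast
qed

text \<open>Follow a point of \<open>K\<close> outside \<open>T\<close>: its path stays outside \<open>T\<close>, hence lifts to a path in the
  cut-open manifold, and by uniqueness of sides the lift is the path of images under
  \<open>cut_map (\<gamma> t)\<close>.\<close>

lemma isotopic_image_piece: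
  assumes M: "smooth_manifold M" and T: "closedin (mtop M) T"
    and ev: "\<And>p. p \<in> pts M \<Longrightarrow> pathin (mtop M) (\<lambda>t. \<gamma> t p)"
    and \<gamma>: "\<And>t. t \<in> {0..1} \<Longrightarrow> \<gamma> t \<in> Diff_set M \<and> \<gamma> t ` T = T"
    and K: "K \<in> pieces M T"
  shows "cut_map (\<gamma> 0) ` K = cut_map (\<gamma> 1) ` K"
proof -
  let ?X = "mtop M" let ?\<sigma> = "\<lambda>p. (p, only_side ?X T p)"
  have X: "locally_connected_space ?X" "closedin ?X T"
    using smooth_manifold_locally_connected[OF M] T by auto
  obtain q where q: "q \<in> pts M - T" "?\<sigma> q \<in> K"
    using cut_component_meets_complement[OF X] K unfolding pieces_def mtop_cut by blast
  have moved: "\<gamma> t q \<in> pts M - T" "cut_map (\<gamma> t) (?\<sigma> q) = ?\<sigma> (\<gamma> t q)" if "t \<in> {0..1}" for t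
  proof -
    have f: "\<gamma> t \<in> Diff_set M" "\<gamma> t ` T = T" using \<gamma>[OF that] by auto
    have b: "bij (\<gamma> t)" using Diff_set_bij[OF f(1)] .
    have "\<gamma> t q \<notin> T" using f(2) q(1) b by (metis DiffD2 bij_is_inj inj_image_mem_iff)
    moreover have "\<gamma> t q \<in> pts M"
      using Diff_set_permutes[OF f(1)] q(1) by (simp add: permutes_in_image)
    ultimately show m: "\<gamma> t q \<in> pts M - T" by blast
    have "only_side ?X T q \<in> local_sides ?X T q" using local_sides_complement[OF X q(1)] by blast
    then have "(\<lambda>U. \<gamma> t ` only_side ?X T q (\<gamma> t -` U)) \<in> local_sides ?X T (\<gamma> t q)"
      using local_sides_cut_map[OF Diff_set_homeomorphic_map[OF M f(1)] b f(2)] q(1) by blast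
    then show "cut_map (\<gamma> t) (?\<sigma> q) = ?\<sigma> (\<gamma> t q)"
      unfolding local_sides_complement[OF X m] by (simp add: cut_map_apply)
  qed
  have "pathin (subtopology ?X (pts M - T)) (\<lambda>t. \<gamma> t q)"
    unfolding pathin_subtopology using ev moved q(1) by blast
  then have "pathin (cut_top ?X T) (?\<sigma> \<circ> (\<lambda>t. \<gamma> t q))"
    using pathin_compose continuous_map_only_side[OF X] by blast
  moreover have "cut_map (\<gamma> t) ` K \<in> connected_components_of (cut_top ?X T)" if "t \<in> {0..1}" for t
    using pieces_image[OF M, of "\<gamma> t" T] \<gamma>[OF that] K unfolding pieces_def mtop_cut by blast
  moreover have "(?\<sigma> \<circ> (\<lambda>t. \<gamma> t q)) t \<in> cut_map (\<gamma> t) ` K" if "t \<in> {0..1}" for t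
    using moved(2)[OF that] q(2) by (metis comp_apply image_eqI)
  ultimately show ?thesis
    by (intro pathin_component_eq[of "cut_top ?X T" "?\<sigma> \<circ> (\<lambda>t. \<gamma> t q)"]) auto
qed


section \<open>The action on the decorated graph\<close>

lemma carrier_Aut:
  "(\<sigma>, \<tau>) \<in> carrier (Aut G) \<longleftrightarrow> \<sigma> permutes verts G \<and> \<tau> permutes edges G \<and>
     (\<forall>e\<in>edges G. ends G (\<tau> e) = \<sigma> ` ends G e) \<and> (\<forall>v\<in>verts G. deco G (\<sigma> v) = deco G v)"
  by (simp add: Aut_def)

lemma mult_Aut: "(\<sigma>, \<tau>) \<otimes>\<^bsub>Aut G\<^esub> (\<sigma>', \<tau>') = (\<sigma> \<circ> \<sigma>', \<tau> \<circ> \<tau>')"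
  by (simp add: Aut_def)

lemma one_Aut: "\<one>\<^bsub>Aut G\<^esub> = (id, id)"
  by (simp add: Aut_def)

lemma group_Aut: "group (Aut G)"
proof (rule groupI)
  fix x y z assume "x \<in> carrier (Aut G)" "y \<in> carrier (Aut G)" "z \<in> carrier (Aut G)"
  then show "x \<otimes>\<^bsub>Aut G\<^esub> y \<otimes>\<^bsub>Aut G\<^esub> z = x \<otimes>\<^bsub>Aut G\<^esub> (y \<otimes>\<^bsub>Aut G\<^esub> z)"
    by (cases x, cases y, cases z) (simp add: mult_Aut comp_assoc)
next
  fix x y assume xy: "x \<in> carrier (Aut G)" "y \<in> carrier (Aut G)"
  obtain \<sigma> \<tau> \<sigma>' \<tau>' where x: "x = (\<sigma>, \<tau>)" "y = (\<sigma>', \<tau>')" by (cases x, cases y)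
  have a: "\<sigma> permutes verts G" "\<tau> permutes edges G" "\<forall>e\<in>edges G. ends G (\<tau> e) = \<sigma> ` ends G e"
      "\<forall>v\<in>verts G. deco G (\<sigma> v) = deco G v"
    "\<sigma>' permutes verts G" "\<tau>' permutes edges G" "\<forall>e\<in>edges G. ends G (\<tau>' e) = \<sigma>' ` ends G e"
      "\<forall>v\<in>verts G. deco G (\<sigma>' v) = deco G v"
    using xy by (auto simp: x carrier_Aut)
  then show "x \<otimes>\<^bsub>Aut G\<^esub> y \<in> carrier (Aut G)"
    unfolding x mult_Aut carrier_Aut
    by (simp add: permutes_compose permutes_in_image image_image)
next
  fix x assume x: "x \<in> carrier (Aut G)"
  obtain \<sigma> \<tau> where x': "x = (\<sigma>, \<tau>)" by (cases x)
  have a: "\<sigma> permutes verts G" "\<tau> permutes edges G"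
      and ends: "\<And>e. e \<in> edges G \<Longrightarrow> ends G (\<tau> e) = \<sigma> ` ends G e"
      and deco: "\<And>v. v \<in> verts G \<Longrightarrow> deco G (\<sigma> v) = deco G v"
    using x by (auto simp: x' carrier_Aut)
  have i: "inv_fun \<sigma> permutes verts G" "inv_fun \<tau> permutes edges G" using a permutes_inv by auto
  have "ends G (inv_fun \<tau> e) = inv_fun \<sigma> ` ends G e" if "e \<in> edges G" for e
  proof -
    have "ends G e = \<sigma> ` ends G (inv_fun \<tau> e)"
      using ends[of "inv_fun \<tau> e"] that i(2) a(2) by (simp add: permutes_in_image permutes_inverses)
    then show ?thesis using permutes_inj[OF a(1)] by (simp add: image_inv_f_f)
  qed
  moreover have "deco G (inv_fun \<sigma> v) = deco G v" if "v \<in> verts G" for v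
    using deco[of "inv_fun \<sigma> v"] that i(1) a(1) by (simp add: permutes_in_image permutes_inverses)
  ultimately have "(inv_fun \<sigma>, inv_fun \<tau>) \<in> carrier (Aut G)"
    using i by (simp add: carrier_Aut)
  moreover have "(inv_fun \<sigma>, inv_fun \<tau>) \<otimes>\<^bsub>Aut G\<^esub> x = \<one>\<^bsub>Aut G\<^esub>"
    using permutes_inv_o[OF a(1)] permutes_inv_o[OF a(2)] by (simp add: x' mult_Aut one_Aut)
  ultimately show "\<exists>y\<in>carrier (Aut G). y \<otimes>\<^bsub>Aut G\<^esub> x = \<one>\<^bsub>Aut G\<^esub>" by blast
next
  show "\<one>\<^bsub>Aut G\<^esub> \<in> carrier (Aut G)" by (simp add: one_Aut carrier_Aut permutes_id)
  fix x assume "x \<in> carrier (Aut G)"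
  then show "\<one>\<^bsub>Aut G\<^esub> \<otimes>\<^bsub>Aut G\<^esub> x = x" by (cases x) (simp add: one_Aut mult_Aut)
qed

lemma permutes_extend:
  assumes "inj_on h A" "h ` A = A"
  shows "(\<lambda>x. if x \<in> A then h x else x) permutes A"
proof (rule bij_imp_permutes)
  have "inj_on (\<lambda>x. if x \<in> A then h x else x) A" using assms(1) by (auto simp: inj_on_def)
  moreover have "(\<lambda>x. if x \<in> A then h x else x) ` A = A" using assms(2) by (auto simp: image_iff)
  ultimately show "bij_betw (\<lambda>x. if x \<in> A then h x else x) A A" by (simp add: bij_betw_def)
qed simp

lemma inj_image_of_inj: "inj f \<Longrightarrow> inj_on (image f) \<A>"
  by (meson inj_image_eq_iff inj_onI)

lemma filter_image: "{y \<in> h ` A. P y} = h ` {x \<in> A. P (h x)}"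
  by auto

lemma image_mem_invariant_family:
  assumes "inj f" "image f ` \<A> = \<A>"
  shows "f ` K \<in> \<A> \<longleftrightarrow> K \<in> \<A>"
  using inj_image_mem_iff[OF inj_image_of_inj[OF assms(1), of UNIV], of K \<A>] assms(2) by simp

context
  fixes M :: "('a, real^3) smfd" and T :: "'a set"
  assumes M: "smooth_manifold M"
begin

lemma components_in_image:
  assumes f: "f \<in> Diff_set M" and S: "f ` S = S"
  shows "image f ` components_in M S = components_in M S"
  by (rule homeomorphic_map_components_in[OF Diff_set_homeomorphic_map[OF M f] _ S])
     (rule bij_is_inj[OF Diff_set_bij[OF f]])

lemma graph_action_verts:
  assumes "f \<in> Diff_set M" "f ` T = T"
  shows "fst (graph_action M T f) =
    (\<lambda>v. if v \<in> verts (jsj_graph M T) then map_option (image (cut_map f)) v else v)"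
  by (auto simp: graph_action_def jsj_graph_def fun_eq_iff split: option.splits)

lemma edges_jsj_graph: "edges (jsj_graph M T) = boundary_components M \<union> components_in M T"
  by (simp add: jsj_graph_def)

lemma edges_image:
  assumes f: "f \<in> Diff_set M" "f ` T = T"
  shows "image f ` edges (jsj_graph M T) = edges (jsj_graph M T)"
  unfolding edges_jsj_graph image_Un
  using components_in_image[OF f(1)] Diff_set_image_boundary[OF M f(1)] f(2) by simp

text \<open>Incidence is preserved as the regluing map intertwines \<open>cut_map f\<close> with \<open>f\<close>; the vertex
  \<open>*\<close> is fixed as \<open>f\<close> preserves the boundary.\<close>

lemma graph_action_Aut:
  assumes f: "f \<in> Diff_set M" "f ` T = T"
  shows "graph_action M T f \<in> carrier (Aut (jsj_graph M T))"
proof -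
  let ?G = "jsj_graph M T" and ?F = "cut_map f"
  let ?\<sigma> = "fst (graph_action M T f)" and ?\<tau> = "snd (graph_action M T f)"
  have inj: "inj f" using Diff_set_bij[OF f(1)] bij_is_inj by blast
  have injF: "inj ?F" using bij_cut_map[OF Diff_set_bij[OF f(1)]] bij_is_inj by blast
  note pieces = pieces_image[OF M f]
  have bd: "image f ` boundary_components M = boundary_components M"
    using components_in_image[OF f(1) Diff_set_image_boundary[OF M f(1)]] .
  have piece: "?F ` K \<in> pieces M T \<longleftrightarrow> K \<in> pieces M T" for K
    by (rule image_mem_invariant_family[OF injF pieces])
  have bd_iff: "f ` X \<in> boundary_components M \<longleftrightarrow> X \<in> boundary_components M" for X
    by (rule image_mem_invariant_family[OF inj bd])
  have \<tau>: "?\<tau> X = f ` X" if "X \<in> edges ?G" for X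
    using that by (simp add: graph_action_def)
  have \<sigma>: "?\<sigma> (Some K) = Some (?F ` K)" if "K \<in> pieces M T" for K
    using that by (simp add: graph_action_def)
  have "?\<tau> permutes edges ?G"
    using permutes_extend[OF inj_image_of_inj[OF inj] edges_image[OF f]] by (simp add: graph_action_def)
  moreover have "?\<sigma> permutes verts ?G"
    unfolding graph_action_verts[OF f]
  proof (rule permutes_extend)
    show "inj_on (map_option (image ?F)) (verts ?G)"
      using option.inj_map[OF inj_image_of_inj[OF injF]] inj_on_subset by blast
    have "map_option (image ?F) ` Some ` pieces M T = Some ` image ?F ` pieces M T"
      by (simp add: image_image)
    then show "map_option (image ?F) ` verts ?G = verts ?G"
      by (simp add: jsj_graph_def pieces)
  qed
  moreover have "ends ?G (?\<tau> X) = ?\<sigma> ` ends ?G X" if X: "X \<in> edges ?G" for X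
  proof -
    have "{K \<in> pieces M T. fst ` K \<inter> f ` X \<noteq> {}} = image ?F ` {K \<in> pieces M T. fst ` K \<inter> X \<noteq> {}}"
    proof -
      have meet: "fst ` ?F ` K \<inter> f ` X \<noteq> {} \<longleftrightarrow> fst ` K \<inter> X \<noteq> {}" for K
      proof -
        have "fst ` ?F ` K = f ` fst ` K" by (simp add: image_image fst_cut_map)
        then show ?thesis by (simp add: image_Int[OF inj, symmetric])
      qed
      have "{K \<in> image ?F ` pieces M T. fst ` K \<inter> f ` X \<noteq> {}} =
          image ?F ` {K \<in> pieces M T. fst ` K \<inter> X \<noteq> {}}"
        unfolding filter_image meet ..
      then show ?thesis unfolding pieces .
    qed
    moreover have "?\<sigma> ` Some ` {K \<in> pieces M T. fst ` K \<inter> X \<noteq> {}} =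
        Some ` image ?F ` {K \<in> pieces M T. fst ` K \<inter> X \<noteq> {}}"
      by (auto simp: image_image \<sigma> intro!: image_cong)
    moreover have "?\<sigma> None = None" by (simp add: graph_action_def)
    ultimately show ?thesis
      unfolding \<tau>[OF X] by (simp add: jsj_graph_def bd_iff image_Un)
  qed
  moreover have "deco ?G (?\<sigma> v) = deco ?G v" if v: "v \<in> verts ?G" for v
  proof (cases v)
    case None
    then show ?thesis by (simp add: graph_action_def)
  next
    case (Some K)
    then have "K \<in> pieces M T" using v by (auto simp: jsj_graph_def)
    then show ?thesis
      using diffeomorphic_piece_iff[OF M f] by (auto simp: Some \<sigma> jsj_graph_def)
  qed
  ultimately show ?thesis
    using carrier_Aut[of ?\<sigma> ?\<tau> ?G] by simp
qed

lemma graph_action_compose: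
  assumes f: "f \<in> Diff_set M" "f ` T = T" and g: "g \<in> Diff_set M" "g ` T = T"
  shows "graph_action M T (f \<circ> g) = graph_action M T f \<otimes>\<^bsub>Aut (jsj_graph M T)\<^esub> graph_action M T g"
proof -
  have "cut_map g ` K \<in> pieces M T" if "K \<in> pieces M T" for K
    using pieces_image[OF M g] that by blast
  moreover have "g ` X \<in> edges (jsj_graph M T)" if "X \<in> edges (jsj_graph M T)" for X
    using edges_image[OF g] that by blast
  ultimately show ?thesis
    by (auto simp: graph_action_def mult_Aut fun_eq_iff cut_map_compose image_comp split: option.splits)
qed

lemma graph_action_eq_one_iff:
  "graph_action M T f = \<one>\<^bsub>Aut (jsj_graph M T)\<^esub> \<longleftrightarrow>
     (\<forall>K\<in>pieces M T. cut_map f ` K = K) \<and> (\<forall>X\<in>edges (jsj_graph M T). f ` X = X)"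
  (is "?l \<longleftrightarrow> ?r")
proof
  assume l: ?l
  then have *: "fst (graph_action M T f) (Some K) = Some K" "snd (graph_action M T f) X = X" for K X
    by (simp_all add: one_Aut)
  show ?r
  proof (intro conjI ballI)
    show "cut_map f ` K = K" if "K \<in> pieces M T" for K
      using *(1)[of K] that by (simp add: graph_action_def)
    show "f ` X = X" if "X \<in> edges (jsj_graph M T)" for X
      using *(2)[of X] that by (simp add: graph_action_def)
  qed
next
  assume ?r
  then show ?l by (auto simp: graph_action_def one_Aut fun_eq_iff split: option.splits)
qed

lemma group_hom_graph_action:
  assumes "orientation M Ori"
  shows "group_hom (comp_group (Diff_plus_T M Ori T)) (Aut (jsj_graph M T)) (graph_action M T)"
proof (intro group_hom.intro group_hom_axioms.intro homI)
  show "group (comp_group (Diff_plus_T M Ori T))" using group_Diff_plus_T[OF M assms] .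
  show "group (Aut (jsj_graph M T))" by (rule group_Aut)
  have *: "f \<in> Diff_set M" "f ` T = T" if "f \<in> carrier (comp_group (Diff_plus_T M Ori T))" for f
    using that by (auto simp: comp_group_def Diff_plus_T_def Diff_plus_def)
  show "graph_action M T f \<in> carrier (Aut (jsj_graph M T))"
    if "f \<in> carrier (comp_group (Diff_plus_T M Ori T))" for f
    using graph_action_Aut[OF *[OF that]] .
  show "graph_action M T (f \<otimes>\<^bsub>comp_group (Diff_plus_T M Ori T)\<^esub> g) =
      graph_action M T f \<otimes>\<^bsub>Aut (jsj_graph M T)\<^esub> graph_action M T g"
    if "f \<in> carrier (comp_group (Diff_plus_T M Ori T))" "g \<in> carrier (comp_group (Diff_plus_T M Ori T))"
    for f g
    using graph_action_compose[OF *[OF that(1)] *[OF that(2)]] by (simp add: comp_group_def)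
qed

lemma kernel_graph_action:
  "kernel (comp_group (Diff_plus_T M Ori T)) (Aut (jsj_graph M T)) (graph_action M T) =
     Diff_plus_BTM M Ori T"
  unfolding kernel_def graph_action_eq_one_iff edges_jsj_graph
  by (simp add: comp_group_def Diff_plus_BTM_def ball_Un conj_ac)

text \<open>As evaluations are continuous, a path of diffeomorphisms moves each point of \<open>M\<close> along a path.
  The path stays in the boundary or in \<open>T\<close> if the point lies there.\<close>

lemma graph_action_isotopy_invariant:
  assumes T: "closedin (mtop M) T"
    and path: "path_component_of (subtopology (Cinf_top M) (Diff_plus_T M Ori T)) f g"
  shows "graph_action M T f = graph_action M T g"
proof -
  obtain \<gamma> where \<gamma>: "pathin (Cinf_top M) \<gamma>" "\<And>t. t \<in> {0..1} \<Longrightarrow> \<gamma> t \<in> Diff_plus_T M Ori T"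
      "\<gamma> 0 = f" "\<gamma> 1 = g"
    using path unfolding path_component_of_def pathin_subtopology by blast
  have D: "\<gamma> t \<in> Diff_set M \<and> \<gamma> t ` T = T" if "t \<in> {0..1}" for t
    using \<gamma>(2)[OF that] by (auto simp: Diff_plus_T_def Diff_plus_def)
  have ev: "pathin (mtop M) (\<lambda>t. \<gamma> t p)" if "p \<in> pts M" for p
    using pathin_compose[OF \<gamma>(1) Cinf_top_evaluation[OF M that]] by (simp add: o_def)
  have pieces: "cut_map f ` K = cut_map g ` K" if "K \<in> pieces M T" for K
    using isotopic_image_piece[OF M T ev D that] \<gamma>(3,4) by simp
  have comp: "f ` X = g ` X"
    if X: "X \<in> components_in M S" and S: "S \<subseteq> pts M" "\<And>t. t \<in> {0..1} \<Longrightarrow> \<gamma> t ` S = S" for X S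
  proof -
    have "\<gamma> t ` X \<in> components_in M S" if "t \<in> {0..1}" for t
      using components_in_image[of "\<gamma> t" S] D[OF that] S(2)[OF that] X by blast
    then have "\<gamma> 0 ` X = \<gamma> 1 ` X"
      using ev S X by (intro isotopic_image_component[of S M \<gamma> X]) auto
    then show ?thesis using \<gamma>(3,4) by simp
  qed
  have "f ` X = g ` X" if X: "X \<in> edges (jsj_graph M T)" for X
  proof -
    have "boundary M \<subseteq> pts M"
      using topological_chart_subset max_atlas_chart unfolding boundary_def by blast
    moreover have "\<gamma> t ` boundary M = boundary M" if "t \<in> {0..1}" for t
      using Diff_set_image_boundary[OF M] D[OF that] by blast
    moreover have "T \<subseteq> pts M" using T closedin_subset by blast
    ultimately show ?thesis
      using X comp[of X "boundary M"] comp[of X T] D unfolding edges_jsj_graph by blast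
  qed
  with pieces show ?thesis
    by (auto simp: graph_action_def fun_eq_iff split: option.splits)
qed

end


section \<open>Component groups\<close>

lemma left_exact_kernel:
  assumes "group_hom G C p"
  shows "left_exact (G\<lparr>carrier := kernel G C p\<rparr>) id G p C"
proof -
  interpret group_hom G C p by (rule assms)
  have "subgroup (kernel G C p) G" using subgroup_kernel .
  then have "group (G\<lparr>carrier := kernel G C p\<rparr>)" using subgroup.subgroup_is_group G.is_group by blast
  then have "group_hom (G\<lparr>carrier := kernel G C p\<rparr>) G id"
    by (intro group_hom.intro group_hom_axioms.intro homI) (auto simp: kernel_def G.is_group)
  then show ?thesis
    using assms by (simp add: left_exact_def)
qed

text \<open>For \<open>\<pi>\<^sub>0\<close> to be a group, separate continuity of the multiplication suffices: a product of two
  paths may be travelled along one factor at a time.\<close>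

context
  fixes G :: "('g, 'm) monoid_scheme" and X :: "'g topology"
  assumes G: "group G" and top: "topspace X = carrier G"
    and left: "\<And>a. a \<in> carrier G \<Longrightarrow> continuous_map X X (\<lambda>x. a \<otimes>\<^bsub>G\<^esub> x)"
    and right: "\<And>a. a \<in> carrier G \<Longrightarrow> continuous_map X X (\<lambda>x. x \<otimes>\<^bsub>G\<^esub> a)"
begin

interpretation G: group G by (rule G)

lemma path_component_of_image:
  assumes "continuous_map X X h" "path_component_of X a b"
  shows "path_component_of X (h a) (h b)"
  using assms pathin_compose[of X _ X h] unfolding path_component_of_def by (metis comp_apply)

lemma path_component_set_mult:
  assumes a: "a \<in> carrier G" and b: "b \<in> carrier G"
  shows "path_component_of_set X a <#>\<^bsub>G\<^esub> path_component_of_set X b =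
           path_component_of_set X (a \<otimes>\<^bsub>G\<^esub> b)"
proof (intro subset_antisym subsetI)
  fix z assume "z \<in> path_component_of_set X a <#>\<^bsub>G\<^esub> path_component_of_set X b"
  then obtain x y where xy: "path_component_of X a x" "path_component_of X b y" "z = x \<otimes>\<^bsub>G\<^esub> y"
    by (auto simp: set_mult_def)
  have "x \<in> carrier G" using xy(1) path_component_in_topspace top by metis
  then have "path_component_of X (a \<otimes>\<^bsub>G\<^esub> b) (x \<otimes>\<^bsub>G\<^esub> b)" "path_component_of X (x \<otimes>\<^bsub>G\<^esub> b) (x \<otimes>\<^bsub>G\<^esub> y)"
    using path_component_of_image[OF right[OF b] xy(1)] path_component_of_image[OF left xy(2)] by auto
  then have "path_component_of X (a \<otimes>\<^bsub>G\<^esub> b) (x \<otimes>\<^bsub>G\<^esub> y)"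
    by (rule path_component_of_trans)
  then show "z \<in> path_component_of_set X (a \<otimes>\<^bsub>G\<^esub> b)" using xy(3) by simp
next
  fix z assume "z \<in> path_component_of_set X (a \<otimes>\<^bsub>G\<^esub> b)"
  then have z: "path_component_of X (a \<otimes>\<^bsub>G\<^esub> b) z" by simp
  have zG: "z \<in> carrier G" using z path_component_in_topspace top by metis
  have b': "inv\<^bsub>G\<^esub> b \<in> carrier G" using b by simp
  \<comment> \<open>Write \<open>z\<close> as the product of \<open>z \<otimes> inv b\<close> and \<open>b\<close>, and translate the path from \<open>a \<otimes> b\<close> to \<open>z\<close>.\<close>
  have "path_component_of X (a \<otimes>\<^bsub>G\<^esub> b \<otimes>\<^bsub>G\<^esub> inv\<^bsub>G\<^esub> b) (z \<otimes>\<^bsub>G\<^esub> inv\<^bsub>G\<^esub> b)"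
    using path_component_of_image[OF right[OF b'] z] .
  then have "path_component_of X a (z \<otimes>\<^bsub>G\<^esub> inv\<^bsub>G\<^esub> b)"
    using a b by (simp add: G.m_assoc)
  moreover have "path_component_of X b b" using b by (simp add: path_component_of_refl top)
  moreover have "z = z \<otimes>\<^bsub>G\<^esub> inv\<^bsub>G\<^esub> b \<otimes>\<^bsub>G\<^esub> b" using zG b by (simp add: G.m_assoc)
  ultimately show "z \<in> path_component_of_set X a <#>\<^bsub>G\<^esub> path_component_of_set X b"
    unfolding set_mult_def by blast
qed

lemma carrier_pi0: "carrier (pi0 G X) = path_component_of_set X ` carrier G"
  by (simp add: pi0_def path_components_of_def top)

lemma mult_pi0:
  assumes "a \<in> carrier G" "b \<in> carrier G"
  shows "path_component_of_set X a \<otimes>\<^bsub>pi0 G X\<^esub> path_component_of_set X b =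
           path_component_of_set X (a \<otimes>\<^bsub>G\<^esub> b)"
  using path_component_set_mult[OF assms] by (simp add: pi0_def)

lemma one_pi0: "\<one>\<^bsub>pi0 G X\<^esub> = path_component_of_set X \<one>\<^bsub>G\<^esub>"
  by (simp add: pi0_def)

lemma group_pi0: "group (pi0 G X)"
proof (rule groupI)
  fix x assume "x \<in> carrier (pi0 G X)"
  then obtain a where "a \<in> carrier G" "x = path_component_of_set X a" by (auto simp: carrier_pi0)
  then show "\<exists>y\<in>carrier (pi0 G X). y \<otimes>\<^bsub>pi0 G X\<^esub> x = \<one>\<^bsub>pi0 G X\<^esub>"
    by (intro bexI[of _ "path_component_of_set X (inv\<^bsub>G\<^esub> a)"]) (auto simp: mult_pi0 one_pi0 carrier_pi0)
qed (auto simp: carrier_pi0 mult_pi0 one_pi0 G.m_assoc)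

text \<open>A homomorphism that is constant on path components descends to \<open>\<pi>\<^sub>0\<close>, and a path that
  starts in its kernel stays there. So the path components of the kernel, as a subspace, are just
  those path components of \<open>G\<close> that meet it, and the map that inclusion induces on \<open>\<pi>\<^sub>0\<close>
  is itself an inclusion.\<close>

lemma left_exact_pi0:
  assumes p: "group_hom G C p"
    and const: "\<And>a b. path_component_of X a b \<Longrightarrow> p a = p b"
  defines "N \<equiv> kernel G C p"
  shows "\<exists>\<iota> \<rho>.
     (\<forall>a\<in>N. \<iota> (path_component_of_set (subtopology X N) a) = path_component_of_set X a) \<and>
     (\<forall>a\<in>carrier G. \<rho> (path_component_of_set X a) = p a) \<and>
     left_exact (pi0 (G\<lparr>carrier := N\<rparr>) (subtopology X N)) \<iota> (pi0 G X) \<rho> C"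
proof (intro exI conjI ballI)
  interpret p: group_hom G C p by (rule p)
  define \<rho> where "\<rho> D = p (SOME a. a \<in> D)" for D
  show \<rho>: "\<rho> (path_component_of_set X a) = p a" if "a \<in> carrier G" for a
  proof -
    have "a \<in> path_component_of_set X a" using that by (simp add: path_component_of_refl top)
    then have "(SOME b. b \<in> path_component_of_set X a) \<in> path_component_of_set X a"
      by (rule someI)
    then show ?thesis using const unfolding \<rho>_def by (metis mem_Collect_eq)
  qed
  have pc: "path_component_of_set (subtopology X N) a = path_component_of_set X a" if a: "a \<in> N" for a
  proof (intro subset_antisym subsetI; unfold mem_Collect_eq)
    fix b assume "path_component_of (subtopology X N) a b"
    then show "path_component_of X a b" using path_component_of_mono[of X N a b UNIV] by simp
  next
    fix b assume "path_component_of X a b"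
    then obtain Q where Q: "path_connectedin X Q" "a \<in> Q" "b \<in> Q"
      unfolding path_component_of by blast
    have "c \<in> N" if "c \<in> Q" for c
    proof -
      have "path_component_of X a c" using Q that unfolding path_component_of by blast
      then have "p c = p a" "c \<in> carrier G"
        using const path_component_in_topspace top by metis+
      then show ?thesis using a by (simp add: N_def kernel_def)
    qed
    then have "path_connectedin (subtopology X N) Q"
      using Q(1) by (auto simp: path_connectedin_subtopology)
    then show "path_component_of (subtopology X N) a b"
      using Q unfolding path_component_of by blast
  qed
  then show "id (path_component_of_set (subtopology X N) a) = path_component_of_set X a"
    if "a \<in> N" for a using that by simp
  have hom: "group_hom (pi0 G X) C \<rho>"
  proof (intro group_hom.intro group_hom_axioms.intro homI group_pi0 p.H.is_group)
    show "\<rho> x \<in> carrier C" if "x \<in> carrier (pi0 G X)" for x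
      using that \<rho> by (auto simp: carrier_pi0)
    show "\<rho> (x \<otimes>\<^bsub>pi0 G X\<^esub> y) = \<rho> x \<otimes>\<^bsub>C\<^esub> \<rho> y"
      if "x \<in> carrier (pi0 G X)" "y \<in> carrier (pi0 G X)" for x y
      using that \<rho> by (auto simp: carrier_pi0 mult_pi0)
  qed
  have NG: "N \<subseteq> carrier G" "\<one>\<^bsub>G\<^esub> \<in> N" by (auto simp: N_def kernel_def)
  have "path_components_of (subtopology X N) = path_component_of_set X ` N"
    using NG(1) pc by (simp add: path_components_of_def top Int_absorb1)
  also have "\<dots> = kernel (pi0 G X) C \<rho>"
    using \<rho> NG(1) by (force simp: kernel_def carrier_pi0 N_def)
  finally have "pi0 (G\<lparr>carrier := N\<rparr>) (subtopology X N) = (pi0 G X)\<lparr>carrier := kernel (pi0 G X) C \<rho>\<rparr>"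
    using pc[OF NG(2)] by (simp add: pi0_def set_mult_def)
  then show "left_exact (pi0 (G\<lparr>carrier := N\<rparr>) (subtopology X N)) id (pi0 G X) \<rho> C"
    using left_exact_kernel[OF hom] by simp
qed

end

theorem proposition9p14:
  fixes M :: "('a, real^3) smfd"
    and Ori :: "('a, real^3) chart set"
    and T :: "'a set"
  assumes "smooth_manifold M"
    and "compact_space (mtop M)"
    and "connected_space (mtop M)" and "pts M \<noteq> {}"
    and "orientation M Ori"
    and "irreducible_3mfd M"
    and "finite (boundary_components M)"
    and "\<forall>B\<in>boundary_components M. is_torus M B"
    and "jsj_decomposition M T"
  shows
    "let DA = Diff_plus_BTM M Ori T; XA = subtopology (Cinf_top M) DA;
         DB = Diff_plus_T M Ori T; XB = subtopology (Cinf_top M) DB;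
         AutG = Aut (jsj_graph M T)
     in left_exact (comp_group DA) id (comp_group DB) (graph_action M T) AutG \<and>
        (\<exists>\<iota> \<rho>.
           (\<forall>f\<in>DA. \<iota> (path_component_of_set XA f) = path_component_of_set XB f) \<and>
           (\<forall>f\<in>DB. \<rho> (path_component_of_set XB f) = graph_action M T f) \<and>
           left_exact (pi0 (comp_group DA) XA) \<iota> (pi0 (comp_group DB) XB) \<rho> AutG)"
proof -
  let ?DA = "Diff_plus_BTM M Ori T" and ?DB = "Diff_plus_T M Ori T"
  let ?AutG = "Aut (jsj_graph M T)" and ?XB = "subtopology (Cinf_top M) (Diff_plus_T M Ori T)"
  note M = assms(1) and ne = assms(4) and Ori = assms(5)
  have T: "closedin (mtop M) T" using jsj_decomposition_closedin[OF M assms(9)] .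
  have hom: "group_hom (comp_group ?DB) ?AutG (graph_action M T)"
    using group_hom_graph_action[OF M Ori] .
  have ker: "kernel (comp_group ?DB) ?AutG (graph_action M T) = ?DA"
    using kernel_graph_action[OF M] .
  have DA: "(comp_group ?DB)\<lparr>carrier := ?DA\<rparr> = comp_group ?DA" by (simp add: comp_group_def)
  have sub: "?DA \<subseteq> ?DB" by (auto simp: Diff_plus_BTM_def)
  have top: "topspace ?XB = carrier (comp_group ?DB)"
    using topspace_Cinf_top[OF M ne] Diff_plus_T_Diff_set by (auto simp: comp_group_def)
  have left: "continuous_map ?XB ?XB (\<lambda>h. g \<otimes>\<^bsub>comp_group ?DB\<^esub> h)"
    and right: "continuous_map ?XB ?XB (\<lambda>h. h \<otimes>\<^bsub>comp_group ?DB\<^esub> g)"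
    if g: "g \<in> carrier (comp_group ?DB)" for g
  proof -
    have "g \<in> ?DB" using g by (simp add: comp_group_def)
    then have closed: "g \<circ> h \<in> ?DB" "h \<circ> g \<in> ?DB" if "h \<in> ?DB" for h
      using that Diff_plus_T_compose[OF M Ori] by blast+
    have "g \<in> Diff_set M" using \<open>g \<in> ?DB\<close> Diff_plus_T_Diff_set by blast
    then show "continuous_map ?XB ?XB (\<lambda>h. g \<otimes>\<^bsub>comp_group ?DB\<^esub> h)"
      "continuous_map ?XB ?XB (\<lambda>h. h \<otimes>\<^bsub>comp_group ?DB\<^esub> g)"
      using Cinf_top_left_translation[OF M ne] Cinf_top_right_translation[OF M ne] closed
      by (auto simp: comp_group_def continuous_map_in_subtopology
          intro: continuous_map_from_subtopology)
  qed
  have XA: "subtopology ?XB ?DA = subtopology (Cinf_top M) ?DA"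
    using sub by (simp add: subtopology_subtopology Int_absorb1)
  have "left_exact (comp_group ?DA) id (comp_group ?DB) (graph_action M T) ?AutG"
    using left_exact_kernel[OF hom] unfolding ker DA .
  moreover have "\<exists>\<iota> \<rho>.
      (\<forall>f\<in>?DA. \<iota> (path_component_of_set (subtopology (Cinf_top M) ?DA) f) = path_component_of_set ?XB f) \<and>
      (\<forall>f\<in>?DB. \<rho> (path_component_of_set ?XB f) = graph_action M T f) \<and>
      left_exact (pi0 (comp_group ?DA) (subtopology (Cinf_top M) ?DA)) \<iota> (pi0 (comp_group ?DB) ?XB) \<rho> ?AutG"
    using left_exact_pi0[OF group_Diff_plus_T[OF M Ori] top left right hom
        graph_action_isotopy_invariant[OF M T]]
    unfolding ker DA XA by (simp add: comp_group_def)
  ultimately show ?thesis unfolding Let_def by blast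
qed

end
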